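(* Let $S\subseteq\mathbb{N}^d$ be a simplicial, fully embedded affine semigroup with extremal rays $\mathbf{a}_1,\dots,\mathbf{a}_d$. If $S$ is nearly Gorenstein but not Gorenstein, then $\mathrm{type}(S)\ge d$.
   Context: Setting: $\mathbb{K}$ is a field and $\mathbb{N}$ contains $0$. $S\subseteq\mathbb{N}^d$ ($d\ge 1$) is an affine semigroup minimally generated by $\mathbf{a}_1,\dots,\mathbf{a}_{d+r}$, simplicial and fully embedded in $\mathbb{N}^d$ with extremal rays $\mathbf{a}_1,\dots,\mathbf{a}_d$: the vectors $\mathbf{a}_1,\dots,\mathbf{a}_d$ are linearly independent and $S\subseteq\sum_{i=1}^d\mathbb{Q}_{\ge0}\mathbf{a}_i$. Moreover each $\mathbf{a}_i$ ($1\le i\le d$) is the smallest generator on its extremal ray: if another generator $\mathbf{a}_j=q\mathbf{a}_i$ with $0\neq q\in\mathbb{Q}$, then $q>1$. $\mathbb{K}[S]=\mathbb{K}[\mathbf{x}^{\mathbf{a}}:\mathbf{a}\in S]$ is the semigroup ring; $S$ is Gorenstein if $\mathbb{K}[S]$ is. $\mathrm{group}(S)=\{\mathbf{a}-\mathbf{b}:\mathbf{a},\mathbf{b}\in S\}$; $M=S\setminus\{\mathbf{0}\}$; $E=\{\mathbf{a}_1,\dots,\mathbf{a}_d\}$; $\mathrm{Ap}(S,E)=\{\mathbf{a}\in S : \mathbf{a}-\mathbf{a}_i\notin S \text{ for all } i=1,\dots,d\}$; $\mathbf{b}\preceq_S\mathbf{a}$ iff $\mathbf{a}-\mathbf{b}\in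 S$; $\mathrm{QF}(S)=\{\mathbf{m}-\sum_{i=1}^d\mathbf{a}_i : \mathbf{m}\in\max_{\preceq_S}\mathrm{Ap}(S,E)\}$. $\mathrm{type}(S)=|\mathrm{QF}(S)|=|\max_{\preceq_S}\mathrm{Ap}(S,E)|$, which equals the Cohen-Macaulay type of $\mathbb{K}[S]$ when $\mathbb{K}[S]$ is Cohen-Macaulay. $\omega_S=\{-\mathbf{f}:\mathbf{f}\in\mathrm{QF}(S)\}+S$, $\omega_S^{-1}=\{\mathbf{z}\in\mathrm{group}(S): \mathbf{z}+\omega_S\subseteq S\}$, and $\mathrm{tr}(S)=\omega_S+\omega_S^{-1}$ (the set of exponents of the monomials in the trace ideal of the canonical module of $\mathbb{K}[S]$ in the Cohen-Macaulay case). $S$ is nearly Gorenstein if $\mathbb{K}[S]$ is Cohen-Macaulay and $M\subseteq\mathrm{tr}(S)$. *)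

theory Defs
  imports "HOL-Analysis.Finite_Cartesian_Product" "HOL-Library.Poly_Mapping"
    "HOL-Library.Extended_Nat" "HOL-Algebra.Ring_Divisibility"
begin

hide_const (open) Multiset.mult

section \<open>Localization at a prime ideal\<close>

text \<open>Fractions a/s are pairs (a, s); the identification is the usual one for rings that may have
  zero divisors.\<close>

definition frac_rel :: "('a, 'b) ring_scheme \<Rightarrow> 'a set \<Rightarrow> (('a \<times> 'a) \<times> ('a \<times> 'a)) set" where
  "frac_rel R T = {((a, s), (b, t)) | a s b t.
     a \<in> carrier R \<and> b \<in> carrier R \<and> s \<in> T \<and> t \<in> T \<and>
     (\<exists>u\<in>T. u \<otimes>\<^bsub>R\<^esub> (a \<otimes>\<^bsub>R\<^esub> t) = u \<otimes>\<^bsub>R\<^esub> (b \<otimes>\<^bsub>R\<^esub> s))}"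

definition ring_of_fractions :: "('a, 'b) ring_scheme \<Rightarrow> 'a set \<Rightarrow> ('a \<times> 'a) set ring" where
  "ring_of_fractions R T =
    \<lparr> carrier = (carrier R \<times> T) // frac_rel R T,
      mult = (\<lambda>U V. frac_rel R T ``
        {(a \<otimes>\<^bsub>R\<^esub> b, s \<otimes>\<^bsub>R\<^esub> t) | a s b t. (a, s) \<in> U \<and> (b, t) \<in> V}),
      one = frac_rel R T `` {(\<one>\<^bsub>R\<^esub>, \<one>\<^bsub>R\<^esub>)},
      zero = frac_rel R T `` {(\<zero>\<^bsub>R\<^esub>, \<one>\<^bsub>R\<^esub>)},
      add = (\<lambda>U V. frac_rel R T ``
        {((a \<otimes>\<^bsub>R\<^esub> t) \<oplus>\<^bsub>R\<^esub> (b \<otimes>\<^bsub>R\<^esub> s), s \<otimes>\<^bsub>R\<^esub> t) | a s b t. (a, s) \<in> U \<and> (b, t) \<in> V}) \<rparr>"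

definition localize_at :: "('a, 'b) ring_scheme \<Rightarrow> 'a set \<Rightarrow> ('a \<times> 'a) set ring" where
  "localize_at R P = ring_of_fractions R (carrier R - P)"

section \<open>Cohen-Macaulay and Gorenstein rings\<close>

definition local_ring :: "('a, 'b) ring_scheme \<Rightarrow> bool" where
  "local_ring A \<longleftrightarrow> cring A \<and> (\<exists>!M. maximalideal M A)"

definition krull_dim :: "('a, 'b) ring_scheme \<Rightarrow> enat" where
  "krull_dim R = Sup {enat n | n. \<exists>c :: nat \<Rightarrow> 'a set.
     (\<forall>i\<le>n. primeideal (c i) R) \<and> (\<forall>i<n. c i \<subset> c (Suc i))}"

definition regular_sequence :: "('a, 'b) ring_scheme \<Rightarrow> 'a list \<Rightarrow> bool" where
  "regular_sequence R xs \<longleftrightarrow>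
     set xs \<subseteq> carrier R \<and>
     (\<forall>i<length xs. \<forall>a\<in>carrier R.
        xs ! i \<otimes>\<^bsub>R\<^esub> a \<in> Idl\<^bsub>R\<^esub> (set (take i xs)) \<longrightarrow> a \<in> Idl\<^bsub>R\<^esub> (set (take i xs))) \<and>
     Idl\<^bsub>R\<^esub> (set xs) \<noteq> carrier R"

text \<open>In a local ring, a regular sequence automatically consists of elements of the maximal ideal,
  because the ideal it generates is proper.\<close>

definition local_depth :: "('a, 'b) ring_scheme \<Rightarrow> enat" where
  "local_depth A = Sup {enat (length xs) | xs. regular_sequence A xs}"

definition cohen_macaulay_local :: "('a, 'b) ring_scheme \<Rightarrow> bool" where
  "cohen_macaulay_local A \<longleftrightarrow>
     noetherian_ring A \<and> local_ring A \<and> local_depth A = krull_dim A"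

definition cohen_macaulay :: "('a, 'b) ring_scheme \<Rightarrow> bool" where
  "cohen_macaulay R \<longleftrightarrow> cring R \<and> noetherian_ring R \<and>
     (\<forall>P. maximalideal P R \<longrightarrow> cohen_macaulay_local (localize_at R P))"

text \<open>For a local ring B with maximal ideal M, the socle is the annihilator of M, that is
  Hom(B/M, B), a vector space over the residue field B/M. As M annihilates it, its subspaces are
  the ideals contained in it, so its dimension is the least number of elements that generate it as
  an ideal.\<close>

definition local_socle :: "('a, 'b) ring_scheme \<Rightarrow> 'a set" where
  "local_socle B = {b \<in> carrier B. \<forall>M. maximalideal M B \<longrightarrow> (\<forall>m\<in>M. m \<otimes>\<^bsub>B\<^esub> b = \<zero>\<^bsub>B\<^esub>)}"

definition socle_has_dim :: "('a, 'b) ring_scheme \<Rightarrow> nat \<Rightarrow> bool" where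
  "socle_has_dim B n \<longleftrightarrow>
     (\<exists>G. G \<subseteq> carrier B \<and> finite G \<and> card G = n \<and> Idl\<^bsub>B\<^esub> G = local_socle B) \<and>
     (\<forall>G. G \<subseteq> carrier B \<and> finite G \<and> Idl\<^bsub>B\<^esub> G = local_socle B \<longrightarrow> n \<le> card G)"

text \<open>The Cohen-Macaulay type of a Cohen-Macaulay local ring A with residue field k is
  dim Ext(k, A) in degree t = depth A, which is the socle dimension of A/(xs) for any
  regular sequence xs of length t. A Cohen-Macaulay local ring is Gorenstein if its type is one.\<close>

definition has_cohen_macaulay_type :: "('a, 'b) ring_scheme \<Rightarrow> nat \<Rightarrow> bool" where
  "has_cohen_macaulay_type A n \<longleftrightarrow>
     (\<exists>xs. regular_sequence A xs \<and> enat (length xs) = local_depth A \<and>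
           socle_has_dim (A Quot (Idl\<^bsub>A\<^esub> (set xs))) n)"

definition gorenstein_local :: "('a, 'b) ring_scheme \<Rightarrow> bool" where
  "gorenstein_local A \<longleftrightarrow> cohen_macaulay_local A \<and> has_cohen_macaulay_type A 1"

definition gorenstein :: "('a, 'b) ring_scheme \<Rightarrow> bool" where
  "gorenstein R \<longleftrightarrow> cring R \<and> noetherian_ring R \<and>
     (\<forall>P. maximalideal P R \<longrightarrow> gorenstein_local (localize_at R P))"

section \<open>Simplicial affine semigroups\<close>

text \<open>Elements of \<open>\<nat>\<^sup>d\<close> are the vectors of \<open>\<int>\<^sup>d\<close> with nonnegative entries, so that
  differences of semigroup elements live in the same type; d is \<open>CARD('d)\<close>.\<close>

definition rat_vec :: "int ^ 'd \<Rightarrow> rat ^ 'd" where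
  "rat_vec v = (\<chi> i. of_int (v $ i))"

definition generated_semigroup :: "(int ^ 'd) set \<Rightarrow> (int ^ 'd) set" where
  "generated_semigroup G = {(\<Sum>g\<in>G. int (c g) *s g) | c :: int ^ 'd \<Rightarrow> nat. True}"

text \<open>\<open>G\<close> is the minimal generating set; the extremal rays \<open>a i\<close> are indexed by the coordinates,
  as there are exactly d of them.\<close>

definition simplicial_affine_semigroup ::
    "(int ^ 'd) set \<Rightarrow> (int ^ 'd) set \<Rightarrow> ('d \<Rightarrow> int ^ 'd) \<Rightarrow> bool" where
  "simplicial_affine_semigroup S G a \<longleftrightarrow>
     (\<forall>s\<in>S. \<forall>i. 0 \<le> s $ i) \<and>
     finite G \<and> S = generated_semigroup G \<and> (\<forall>H. H \<subset> G \<longrightarrow> generated_semigroup H \<noteq> S) \<and>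
     range a \<subseteq> G \<and>
     (\<forall>c :: 'd \<Rightarrow> rat. (\<Sum>i\<in>UNIV. c i *s rat_vec (a i)) = 0 \<longrightarrow> (\<forall>i. c i = 0)) \<and>
     (\<forall>s\<in>S. \<exists>c :: 'd \<Rightarrow> rat. (\<forall>i. 0 \<le> c i) \<and> rat_vec s = (\<Sum>i\<in>UNIV. c i *s rat_vec (a i))) \<and>
     (\<forall>i. \<forall>g\<in>G. \<forall>q :: rat. g \<noteq> a i \<and> q \<noteq> 0 \<and> rat_vec g = q *s rat_vec (a i) \<longrightarrow> q > 1)"

text \<open>Elements of \<open>(int ^ 'd) \<Rightarrow>\<^sub>0 'k\<close> are Laurent polynomials in d variables with the
  convolution product; the semigroup ring consists of those supported in \<open>S\<close>.\<close>

definition semigroup_ring ::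
    "'k::field itself \<Rightarrow> (int ^ 'd) set \<Rightarrow> ((int ^ 'd) \<Rightarrow>\<^sub>0 'k) ring" where
  "semigroup_ring _ S =
    \<lparr> carrier = {p. Poly_Mapping.keys p \<subseteq> S}, mult = (*), one = 1, zero = 0, add = (+) \<rparr>"

definition semigroup_group :: "(int ^ 'd) set \<Rightarrow> (int ^ 'd) set" where
  "semigroup_group S = {s - t | s t. s \<in> S \<and> t \<in> S}"

definition apery :: "(int ^ 'd) set \<Rightarrow> ('d \<Rightarrow> int ^ 'd) \<Rightarrow> (int ^ 'd) set" where
  "apery S a = {s \<in> S. \<forall>i. s - a i \<notin> S}"

definition semigroup_le :: "(int ^ 'd) set \<Rightarrow> int ^ 'd \<Rightarrow> int ^ 'd \<Rightarrow> bool" where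
  "semigroup_le S b c \<longleftrightarrow> c - b \<in> S"

definition max_apery :: "(int ^ 'd) set \<Rightarrow> ('d \<Rightarrow> int ^ 'd) \<Rightarrow> (int ^ 'd) set" where
  "max_apery S a = {m \<in> apery S a. \<forall>m'\<in>apery S a. semigroup_le S m m' \<longrightarrow> m' = m}"

definition quasi_frobenius :: "(int ^ 'd) set \<Rightarrow> ('d \<Rightarrow> int ^ 'd) \<Rightarrow> (int ^ 'd) set" where
  "quasi_frobenius S a = {m - (\<Sum>i\<in>UNIV. a i) | m. m \<in> max_apery S a}"

definition semigroup_type :: "(int ^ 'd) set \<Rightarrow> ('d \<Rightarrow> int ^ 'd) \<Rightarrow> nat" where
  "semigroup_type S a = card (quasi_frobenius S a)"

definition canonical_ideal :: "(int ^ 'd) set \<Rightarrow> ('d \<Rightarrow> int ^ 'd) \<Rightarrow> (int ^ 'd) set" where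
  "canonical_ideal S a = {- f + s | f s. f \<in> quasi_frobenius S a \<and> s \<in> S}"

definition canonical_inverse :: "(int ^ 'd) set \<Rightarrow> ('d \<Rightarrow> int ^ 'd) \<Rightarrow> (int ^ 'd) set" where
  "canonical_inverse S a =
     {z \<in> semigroup_group S. \<forall>w\<in>canonical_ideal S a. z + w \<in> S}"

definition semigroup_trace :: "(int ^ 'd) set \<Rightarrow> ('d \<Rightarrow> int ^ 'd) \<Rightarrow> (int ^ 'd) set" where
  "semigroup_trace S a =
     {w + z | w z. w \<in> canonical_ideal S a \<and> z \<in> canonical_inverse S a}"

definition nearly_gorenstein ::
    "'k::field itself \<Rightarrow> (int ^ 'd) set \<Rightarrow> ('d \<Rightarrow> int ^ 'd) \<Rightarrow> bool" where
  "nearly_gorenstein K S a \<longleftrightarrow>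
     cohen_macaulay (semigroup_ring K S) \<and> S - {0} \<subseteq> semigroup_trace S a"

end

theory Submission
  imports Defs
begin

text \<open>An extremal generator \<open>a i\<close> is irreducible in S. If it lies in the trace, that is, if it is the sum of an
  element of \<open>\<omega>\<close> and an element z of its inverse, then z either is a quasi-Frobenius element f
  itself or equals \<open>a i + f\<close> for such an f. In the first case \<open>f - g\<close> lies in S for all quasi-Frobenius
  elements g, so the Apery set has a greatest element and the ring is Gorenstein. Otherwise every ray i
  receives a quasi-Frobenius element \<open>\<phi> i\<close> such that \<open>a i + \<phi> i - g\<close> lies in S for all g. This
  assignment is injective: if \<open>\<phi> i = \<phi> j = f\<close> with \<open>i \<noteq> j\<close>, then \<open>f - g\<close> enters S after adding \<open>a i\<close> as
  well as after adding \<open>a j\<close>, so by the Cohen-Macaulay property it lies in S itself, which is the first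
  case again. Hence there are at least d quasi-Frobenius elements.

  The link to the semigroup ring R consists of two statements.

  If R is Cohen-Macaulay, an element of the group that enters S in the directions of two different
  rays lies in S (\<open>cohen_macaulay_fill\<close>). At the ideal of all elements without constant term, the dimension
  is at least d, witnessed by the primes of the faces, and so there is a regular sequence of
  length d. It forces the Koszul cohomology of every system of powers of the extremal monomials to
  vanish in degrees below d, while an element missing from S gives an explicit nonzero class.

  If moreover the Apery set has a greatest element, R is Gorenstein at every maximal ideal P
  (\<open>gorenstein_if_greatest_apery\<close>). By Zariski's lemma P contains a monic polynomial in each extremal
  monomial. Division by these polynomials shows that they form a regular sequence. It has the maximal
  length d because d + 1 elements of R satisfy a polynomial relation, which bounds the length of chains
  of primes. The quotient of R by these polynomials is a finite-dimensional algebra with a perfect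
  bilinear form, built from the greatest element, so the annihilator of P in it is generated by one
  nonzero element; this is the socle of the quotient of the local ring.\<close>

section \<open>Products of Laurent polynomials\<close>

abbreviation "lookup \<equiv> Poly_Mapping.lookup"
abbreviation "keys \<equiv> Poly_Mapping.keys"
abbreviation "single \<equiv> Poly_Mapping.single"

lemma lookup_mult_finite:
  fixes f g :: "'a::comm_monoid_add \<Rightarrow>\<^sub>0 'k::comm_semiring_0"
  assumes "finite A" "keys f \<subseteq> A" "finite B" "keys g \<subseteq> B"
  shows "lookup (f * g) k =
    (\<Sum>x\<in>A. \<Sum>y\<in>B. lookup f x * lookup g y when k = x + y)"
proof -
  have "lookup (f * g) k =
     (\<Sum>(x, y). lookup f x * lookup g y when k = x + y)"
    by (simp add: times_poly_mapping.rep_eq prod_fun_unfold_prod)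
  also have "\<dots> = (\<Sum>(x, y)\<in>A \<times> B. lookup f x * lookup g y when k = x + y)"
  proof (rule Sum_any.expand_superset)
    show "finite (A \<times> B)" using assms by auto
    show "{p. (case p of (x, y) \<Rightarrow> lookup f x * lookup g y when k = x + y) \<noteq> 0}
      \<subseteq> A \<times> B"
    proof
      fix p assume p: "p \<in> {p. (case p of (x, y) \<Rightarrow>
        lookup f x * lookup g y when k = x + y) \<noteq> 0}"
      obtain x y where xy: "p = (x, y)" by (cases p)
      have "lookup f x \<noteq> 0" "lookup g y \<noteq> 0"
        using p unfolding xy by (auto simp: when_def split: if_splits)
      then show "p \<in> A \<times> B" using assms unfolding xy
        by (auto simp: lookup_not_eq_zero_eq_in_keys)
    qed
  qed
  finally show ?thesis by (simp add: sum.cartesian_product)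
qed

lemma lookup_single_mult:
  fixes f :: "'a::ab_group_add \<Rightarrow>\<^sub>0 'k::comm_semiring_0"
  shows "lookup (single v c * f) k = c * lookup f (k - v)"
proof -
  have "lookup (single v c * f) k =
    (\<Sum>x\<in>{v}. \<Sum>y\<in>insert (k - v) (keys f).
       lookup (single v c) x * lookup f y when k = x + y)"
    by (rule lookup_mult_finite) auto
  also have "\<dots> = (\<Sum>y\<in>insert (k - v) (keys f). if y = k - v then c * lookup f y else 0)"
    by (auto simp: when_def algebra_simps intro!: sum.cong)
  also have "\<dots> = c * lookup f (k - v)"
    by simp
  finally show ?thesis .
qed

lemma poly_mapping_expand:
  fixes f :: "'a \<Rightarrow>\<^sub>0 'k::comm_monoid_add"
  shows "f = (\<Sum>v\<in>keys f. single v (lookup f v))"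
  by (rule poly_mapping_eqI) (simp add: lookup_sum lookup_single when_def not_in_keys_iff_lookup_eq_zero)

lemma lookup_mult_unique_pair:
  fixes f g :: "'a::comm_monoid_add \<Rightarrow>\<^sub>0 'k::comm_semiring_0"
  assumes "\<And>x y. \<lbrakk>x \<in> keys f; y \<in> keys g; x + y = v + w\<rbrakk> \<Longrightarrow> x = v \<and> y = w"
  shows "lookup (f * g) (v + w) = lookup f v * lookup g w"
proof -
  let ?A = "insert v (keys f)" and ?B = "insert w (keys g)"
  have "lookup (f * g) (v + w) =
    (\<Sum>x\<in>?A. \<Sum>y\<in>?B. lookup f x * lookup g y when v + w = x + y)"
    by (rule lookup_mult_finite) auto
  also have "\<dots> = (\<Sum>x\<in>?A. \<Sum>y\<in>?B. if x = v then (if y = w then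
      lookup f x * lookup g y else 0) else 0)"
  proof (intro sum.cong refl)
    fix x y
    show "(lookup f x * lookup g y when v + w = x + y) =
      (if x = v then (if y = w then lookup f x * lookup g y else 0) else 0)"
    proof (cases "x \<in> keys f \<and> y \<in> keys g")
      case True
      then show ?thesis using assms[of x y] by (auto simp: when_def)
    next
      case False
      then have "lookup f x * lookup g y = 0"
        by (auto simp: not_in_keys_iff_lookup_eq_zero)
      then show ?thesis by (auto simp: when_def)
    qed
  qed
  also have "\<dots> = lookup f v * lookup g w"
  proof -
    have "(\<Sum>y\<in>?B. if x = v then (if y = w then
      lookup f x * lookup g y else 0) else 0) =
      (if x = v then lookup f x * lookup g w else 0)" for x
      by (cases "x = v") (simp_all add: sum.delta)
    then show ?thesis by (simp add: sum.delta)
  qed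
  finally show ?thesis .
qed

text \<open>Maximizing one coordinate after the other singles out a pair of exponents whose sum arises in
  no other way. Maximizing an arbitrary additive functional first makes both exponents extreme for it as
  well.\<close>

lemma exists_unique_sum:
  fixes X Y :: "(int ^ 'd) set" and \<phi> :: "int ^ 'd \<Rightarrow> int"
  assumes "finite X" "X \<noteq> {}" "finite Y" "Y \<noteq> {}"
    and additive: "\<And>u v. \<phi> (u + v) = \<phi> u + \<phi> v"
  shows "\<exists>x\<in>X. \<exists>y\<in>Y. (\<forall>x'\<in>X. \<phi> x' \<le> \<phi> x) \<and> (\<forall>y'\<in>Y. \<phi> y' \<le> \<phi> y) \<and>
    (\<forall>x'\<in>X. \<forall>y'\<in>Y. x' + y' = x + y \<longrightarrow> x' = x \<and> y' = y)"
proof -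
  define face where "face = (\<lambda>X' Y'. X' \<subseteq> X \<and> Y' \<subseteq> Y \<and> X' \<noteq> {} \<and> Y' \<noteq> {} \<and>
    (\<forall>x\<in>X'. \<forall>y\<in>Y'. \<forall>x'\<in>X. \<forall>y'\<in>Y. x' + y' = x + y \<longrightarrow> x' \<in> X' \<and> y' \<in> Y'))"
  have faceD: "X' \<subseteq> X" "Y' \<subseteq> Y" "X' \<noteq> {}" "Y' \<noteq> {}" if "face X' Y'" for X' Y'
    using that unfolding face_def by simp_all
  have face_sum: "x' \<in> X' \<and> y' \<in> Y'"
    if "face X' Y'" "x \<in> X'" "y \<in> Y'" "x' \<in> X" "y' \<in> Y" "x' + y' = x + y" for X' Y' x y x' y'
    using that(1)[unfolded face_def] that(2-) by blast
  have select: "\<exists>X'' Y''. face X'' Y'' \<and> X'' \<subseteq> X' \<and> Y'' \<subseteq> Y' \<and>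
      (\<forall>x\<in>X''. \<forall>x'\<in>X'. \<psi> x' \<le> \<psi> x) \<and> (\<forall>y\<in>Y''. \<forall>y'\<in>Y'. \<psi> y' \<le> \<psi> y)"
    if F: "face X' Y'" and add: "\<And>u v. \<psi> (u + v) = \<psi> u + (\<psi> v :: int)" for X' Y' \<psi>
  proof -
    have fin: "finite X'" "finite Y'" using faceD[OF F] assms by (auto intro: finite_subset)
    define X'' where "X'' = {x \<in> X'. \<psi> x = Max (\<psi> ` X')}"
    define Y'' where "Y'' = {y \<in> Y'. \<psi> y = Max (\<psi> ` Y')}"
    have leX: "\<psi> x \<le> Max (\<psi> ` X')" if "x \<in> X'" for x
      using fin that by auto
    have leY: "\<psi> y \<le> Max (\<psi> ` Y')" if "y \<in> Y'" for y
      using fin that by auto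
    have "face X'' Y''"
      unfolding face_def
    proof (intro conjI ballI impI)
      show "X'' \<subseteq> X" "Y'' \<subseteq> Y" using faceD[OF F] by (auto simp: X''_def Y''_def)
      have "Max (\<psi> ` X') \<in> \<psi> ` X'" "Max (\<psi> ` Y') \<in> \<psi> ` Y'"
        using fin faceD[OF F] by (auto intro!: Max_in)
      then show "X'' \<noteq> {}" "Y'' \<noteq> {}"
        unfolding X''_def Y''_def by force+
      fix x y x' y' assume h: "x \<in> X''" "y \<in> Y''" "x' \<in> X" "y' \<in> Y" "x' + y' = x + y"
      then have m: "x' \<in> X'" "y' \<in> Y'"
        using face_sum[OF F, of x y x' y'] by (auto simp: X''_def Y''_def)
      have "\<psi> x' + \<psi> y' = \<psi> x + \<psi> y" using add[of x' y'] add[of x y] h by simp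
      then show "x' \<in> X''" "y' \<in> Y''"
        using leX[OF m(1)] leY[OF m(2)] h m by (auto simp: X''_def Y''_def)
    qed
    moreover have "X'' \<subseteq> X'" "Y'' \<subseteq> Y'" "\<forall>x\<in>X''. \<forall>x'\<in>X'. \<psi> x' \<le> \<psi> x"
      "\<forall>y\<in>Y''. \<forall>y'\<in>Y'. \<psi> y' \<le> \<psi> y"
      using leX leY by (auto simp: X''_def Y''_def)
    ultimately show ?thesis by blast
  qed
  have "face X Y" using assms unfolding face_def by simp
  from select[OF this additive] obtain X0 Y0 where XY0: "face X0 Y0"
    "\<forall>x\<in>X0. \<forall>x'\<in>X. \<phi> x' \<le> \<phi> x" "\<forall>y\<in>Y0. \<forall>y'\<in>Y. \<phi> y' \<le> \<phi> y" by blast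
  have "\<exists>X' Y'. face X' Y' \<and> X' \<subseteq> X0 \<and> Y' \<subseteq> Y0 \<and>
      (\<forall>i\<in>C. \<forall>x\<in>X'. \<forall>x'\<in>X'. x $ i = x' $ i) \<and> (\<forall>i\<in>C. \<forall>y\<in>Y'. \<forall>y'\<in>Y'. y $ i = y' $ i)"
    if "finite C" for C :: "'d set"
    using that
  proof (induction C rule: finite_induct)
    case empty
    show ?case using XY0 by blast
  next
    case (insert i C)
    then obtain X' Y' where g: "face X' Y'" "X' \<subseteq> X0" "Y' \<subseteq> Y0"
      "\<And>i x x'. i \<in> C \<Longrightarrow> x \<in> X' \<Longrightarrow> x' \<in> X' \<Longrightarrow> x $ i = x' $ i"
      "\<And>i y y'. i \<in> C \<Longrightarrow> y \<in> Y' \<Longrightarrow> y' \<in> Y' \<Longrightarrow> y $ i = y' $ i"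
      by blast
    obtain X'' Y'' where h: "face X'' Y''" "X'' \<subseteq> X'" "Y'' \<subseteq> Y'"
      "\<And>x x'. x \<in> X'' \<Longrightarrow> x' \<in> X' \<Longrightarrow> x' $ i \<le> x $ i"
      "\<And>y y'. y \<in> Y'' \<Longrightarrow> y' \<in> Y' \<Longrightarrow> y' $ i \<le> y $ i"
      using select[OF g(1), of "\<lambda>x. x $ i"] by auto
    have constX: "x $ k = x' $ k" if "k \<in> insert i C" "x \<in> X''" "x' \<in> X''" for k x x'
      using that h(2) g(4)[of k x x'] h(4)[of x x'] h(4)[of x' x] by (auto simp: subset_iff)
    have constY: "y $ k = y' $ k" if "k \<in> insert i C" "y \<in> Y''" "y' \<in> Y''" for k y y'
      using that h(3) g(5)[of k y y'] h(5)[of y y'] h(5)[of y' y] by (auto simp: subset_iff)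
    show ?case
    proof (intro exI conjI ballI)
      show "face X'' Y''" "X'' \<subseteq> X0" "Y'' \<subseteq> Y0" using h(1,2,3) g(2,3) by auto
    qed (rule constX constY; assumption)+
  qed
  from this[of UNIV, simplified] obtain X' Y' where g: "face X' Y'" "X' \<subseteq> X0" "Y' \<subseteq> Y0"
    and const: "\<forall>i. \<forall>x\<in>X'. \<forall>x'\<in>X'. x $ i = x' $ i" "\<forall>i. \<forall>y\<in>Y'. \<forall>y'\<in>Y'. y $ i = y' $ i"
    by metis
  have singleX: "x = x'" if "x \<in> X'" "x' \<in> X'" for x x'
    unfolding vec_eq_iff using const(1) that by blast
  have singleY: "y = y'" if "y \<in> Y'" "y' \<in> Y'" for y y'
    unfolding vec_eq_iff using const(2) that by blast
  obtain x y where xy: "x \<in> X'" "y \<in> Y'" using faceD[OF g(1)] by blast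
  have "x' = x \<and> y' = y" if "x' \<in> X" "y' \<in> Y" "x' + y' = x + y" for x' y'
    using face_sum[OF g(1) xy that] singleX[OF _ xy(1)] singleY[OF _ xy(2)] by blast
  moreover have "x \<in> X" "y \<in> Y" using faceD[OF g(1)] xy by auto
  moreover have "x \<in> X0" "y \<in> Y0" using g(2,3) xy by auto
  ultimately show ?thesis
    using XY0(2,3) by (intro bexI[of _ x] bexI[of _ y]) simp_all
qed

section \<open>Localization of a domain\<close>

locale subdomain =
  fixes R :: "'r::comm_ring_1 set"
  assumes zero_mem [simp, intro]: "0 \<in> R"
    and one_mem [simp, intro]: "1 \<in> R"
    and add_mem [intro]: "x \<in> R \<Longrightarrow> y \<in> R \<Longrightarrow> x + y \<in> R"
    and mult_mem [intro]: "x \<in> R \<Longrightarrow> y \<in> R \<Longrightarrow> x * y \<in> R"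
    and uminus_mem [intro]: "x \<in> R \<Longrightarrow> - x \<in> R"
    and no_zero_div: "x \<in> R \<Longrightarrow> y \<in> R \<Longrightarrow> x * y = 0 \<Longrightarrow> x = 0 \<or> y = 0"
begin

lemma diff_mem [intro]: "x \<in> R \<Longrightarrow> y \<in> R \<Longrightarrow> x - y \<in> R"
  using add_mem[of x "- y"] by (simp add: uminus_mem)

lemma sum_mem [intro]: "(\<And>i. i \<in> I \<Longrightarrow> f i \<in> R) \<Longrightarrow> sum f I \<in> R"
  by (induction I rule: infinite_finite_induct) auto

lemma prod_mem [intro]: "(\<And>i. i \<in> I \<Longrightarrow> f i \<in> R) \<Longrightarrow> prod f I \<in> R"
  by (induction I rule: infinite_finite_induct) auto

lemma power_mem [intro]: "x \<in> R \<Longrightarrow> x ^ n \<in> R"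
  by (induction n) auto

lemma mult_cancel: "u \<in> R \<Longrightarrow> x \<in> R \<Longrightarrow> y \<in> R \<Longrightarrow> u \<noteq> 0 \<Longrightarrow> u * x = u * y \<longleftrightarrow> x = y"
  using no_zero_div[of u "x - y"] by (auto simp: algebra_simps)

end

definition ring_on :: "'r::comm_ring_1 set \<Rightarrow> 'r ring" where
  "ring_on R = \<lparr> carrier = R, mult = (*), one = 1, zero = 0, add = (+) \<rparr>"

lemma ring_on_sel [simp]:
  "carrier (ring_on R) = R" "mult (ring_on R) = (*)" "one (ring_on R) = 1"
  "zero (ring_on R) = 0" "add (ring_on R) = (+)"
  by (simp_all add: ring_on_def)

text \<open>Ideals of the subring, described by the operations of the ambient type.\<close>

definition (in subdomain) idl :: "'r set \<Rightarrow> bool" where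
  "idl I \<longleftrightarrow> I \<subseteq> R \<and> 0 \<in> I \<and> (\<forall>x\<in>I. \<forall>y\<in>I. x + y \<in> I) \<and> (\<forall>x\<in>I. \<forall>r\<in>R. r * x \<in> I)"

context subdomain
begin

lemma cring_ring_on: "cring (ring_on R)"
proof (rule cringI)
  show "abelian_group (ring_on R)"
  proof (rule abelian_groupI)
    fix x assume "x \<in> carrier (ring_on R)"
    then show "\<exists>y\<in>carrier (ring_on R). y \<oplus>\<^bsub>ring_on R\<^esub> x = \<zero>\<^bsub>ring_on R\<^esub>"
      by (intro bexI[of _ "- x"]) auto
  qed (auto simp: algebra_simps)
  show "Group.comm_monoid (ring_on R)"
    by (rule comm_monoidI) (auto simp: algebra_simps)
qed (auto simp: algebra_simps)

lemma idlD:
  assumes "idl I"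
  shows "I \<subseteq> R" "0 \<in> I" "x \<in> I \<Longrightarrow> y \<in> I \<Longrightarrow> x + y \<in> I" "x \<in> I \<Longrightarrow> r \<in> R \<Longrightarrow> r * x \<in> I"
    "x \<in> I \<Longrightarrow> r \<in> R \<Longrightarrow> x * r \<in> I" "x \<in> I \<Longrightarrow> - x \<in> I" "x \<in> I \<Longrightarrow> y \<in> I \<Longrightarrow> x - y \<in> I"
    "x \<in> I \<Longrightarrow> x \<in> R"
proof -
  show *: "I \<subseteq> R" "0 \<in> I" "x \<in> I \<Longrightarrow> y \<in> I \<Longrightarrow> x + y \<in> I" "x \<in> I \<Longrightarrow> r \<in> R \<Longrightarrow> r * x \<in> I" for x y r
    using assms unfolding idl_def by auto
  show "x \<in> I \<Longrightarrow> r \<in> R \<Longrightarrow> x * r \<in> I" using *(4)[of x r] by (simp add: mult.commute)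
  show neg: "x \<in> I \<Longrightarrow> - x \<in> I" for x using *(4)[of x "- 1"] by auto
  show "x \<in> I \<Longrightarrow> y \<in> I \<Longrightarrow> x - y \<in> I" using *(3)[of x "- y"] neg by simp
  show "x \<in> I \<Longrightarrow> x \<in> R" using * by auto
qed

lemma idl_sum: "idl I \<Longrightarrow> (\<And>j. j \<in> J \<Longrightarrow> f j \<in> I) \<Longrightarrow> sum f J \<in> I"
  by (induction J rule: infinite_finite_induct) (auto intro: idlD)

lemma ideal_ring_on_iff: "ideal I (ring_on R) \<longleftrightarrow> idl I"
proof
  assume "ideal I (ring_on R)"
  then interpret ideal I "ring_on R" .
  show "idl I"
    unfolding idl_def
  proof (intro conjI ballI)
    show "I \<subseteq> R" using a_subset by simp
    show "0 \<in> I" using additive_subgroup.zero_closed[OF is_additive_subgroup] by simp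
    fix x assume x: "x \<in> I"
    show "x + y \<in> I" if "y \<in> I" for y
      using additive_subgroup.a_closed[OF is_additive_subgroup x that] by simp
    show "r * x \<in> I" if "r \<in> R" for r using I_l_closed[OF x] that by simp
  qed
next
  assume I: "idl I"
  interpret cring "ring_on R" by (rule cring_ring_on)
  show "ideal I (ring_on R)"
  proof (rule idealI)
    show "ring (ring_on R)" by (rule ring_axioms)
    show "subgroup I (add_monoid (ring_on R))"
    proof (rule group.subgroupI[OF add.is_group])
      fix x assume x: "x \<in> I"
      then have "x \<in> R" using idlD(1)[OF I] by auto
      then have "\<ominus>\<^bsub>ring_on R\<^esub> x = - x"
        using minus_equality[of "- x" x] by auto
      then show "inv\<^bsub>add_monoid (ring_on R)\<^esub> x \<in> I"
        using idlD(6)[OF I x] by (simp add: a_inv_def)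
    qed (use idlD[OF I] in auto)
  qed (use idlD[OF I] in auto)
qed

lemma maximalideal_ring_onD:
  assumes "maximalideal P (ring_on R)"
  shows "idl P" "1 \<notin> P" "x \<in> R \<Longrightarrow> x \<notin> P \<Longrightarrow> \<exists>y\<in>R. x * y - 1 \<in> P"
    "x \<in> R \<Longrightarrow> y \<in> R \<Longrightarrow> x * y \<in> P \<Longrightarrow> x \<in> P \<or> y \<in> P"
proof -
  interpret maximalideal P "ring_on R" by (rule assms)
  show P: "idl P" using ideal_axioms ideal_ring_on_iff by simp
  have proper: "I = R" if "idl I" "1 \<in> I" for I
    using idlD[OF that(1)] that(2) mult_1_right by (metis subsetI subset_antisym)
  show one: "1 \<notin> P" using proper[OF P] I_notcarr by auto
  show inv: "\<exists>y\<in>R. x * y - 1 \<in> P" if x: "x \<in> R" "x \<notin> P" for x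
  proof -
    let ?I = "{x * y + p | y p. y \<in> R \<and> p \<in> P}"
    have I: "idl ?I"
      unfolding idl_def
    proof (intro conjI ballI)
      show "?I \<subseteq> R" using x idlD(1)[OF P] by auto
      show "0 \<in> ?I" using idlD(2)[OF P] by (auto intro!: exI[of _ 0])
      fix u assume "u \<in> ?I"
      then obtain y p where u: "u = x * y + p" "y \<in> R" "p \<in> P" by auto
      { fix v assume "v \<in> ?I"
        then obtain z q where v: "v = x * z + q" "z \<in> R" "q \<in> P" by auto
        have "u + v = x * (y + z) + (p + q)" using u v by (simp add: algebra_simps)
        then show "u + v \<in> ?I" using u v idlD(3)[OF P] by blast }
      { fix r assume r: "r \<in> R"
        have "r * u = x * (r * y) + r * p" using u by (simp add: algebra_simps)
        then show "r * u \<in> ?I" using u r idlD(4)[OF P] by blast }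
    qed
    have "p \<in> ?I" if "p \<in> P" for p
      by (rule CollectI, rule exI[of _ 0], rule exI[of _ p]) (use that in simp)
    moreover have "x \<in> ?I"
      by (rule CollectI, rule exI[of _ 1], rule exI[of _ 0]) (use idlD(2)[OF P] in simp)
    ultimately have "?I = R"
      using I_maximal[of ?I] I ideal_ring_on_iff idlD(1)[OF I] x(2)
      unfolding ring_on_sel by blast
    then have "1 \<in> ?I" using one_mem by simp
    then obtain y p where "1 = x * y + p" "y \<in> R" "p \<in> P" by auto
    then have "x * y - 1 = - p" by (simp add: algebra_simps)
    then show ?thesis using \<open>y \<in> R\<close> \<open>p \<in> P\<close> idlD(6)[OF P] by metis
  qed
  show "x \<in> P \<or> y \<in> P" if xy: "x \<in> R" "y \<in> R" "x * y \<in> P"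
  proof (rule ccontr)
    assume neg: "\<not> (x \<in> P \<or> y \<in> P)"
    then obtain z where z: "z \<in> R" "x * z - 1 \<in> P" using inv[of x] xy by auto
    have "y = z * (x * y) - y * (x * z - 1)" by (simp add: algebra_simps)
    also have "\<dots> \<in> P"
      by (intro idlD(7)[OF P] idlD(4)[OF P] xy z)
    finally show False using neg by simp
  qed
qed

end

text \<open>R is localized at the complement T of P; \<open>frac a s\<close> is the class of the fraction a/s. Since R
  has no zero divisors, equality of fractions is equality of cross products.\<close>

locale localized_subdomain = subdomain R for R :: "'r::comm_ring_1 set" +
  fixes P :: "'r set"
  assumes P_idl: "idl P"
    and P_one: "1 \<notin> P"
    and P_prime: "x \<in> R \<Longrightarrow> y \<in> R \<Longrightarrow> x * y \<in> P \<Longrightarrow> x \<in> P \<or> y \<in> P"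
begin

definition T :: "'r set" where "T = R - P"

definition A :: "('r \<times> 'r) set ring" where "A = localize_at (ring_on R) P"

definition frac :: "'r \<Rightarrow> 'r \<Rightarrow> ('r \<times> 'r) set" where
  "frac a s = frac_rel (ring_on R) T `` {(a, s)}"

lemma T_mem: "s \<in> T \<Longrightarrow> s \<in> R" "s \<in> T \<Longrightarrow> s \<notin> P" "s \<in> R \<Longrightarrow> s \<notin> P \<Longrightarrow> s \<in> T"
  by (auto simp: T_def)

lemma T_one [simp, intro]: "1 \<in> T"
  using P_one by (auto simp: T_def)

lemma T_mult [intro]: "s \<in> T \<Longrightarrow> t \<in> T \<Longrightarrow> s * t \<in> T"
  using P_prime by (auto simp: T_def)

lemma T_prod [intro]: "(\<And>i. i \<in> I \<Longrightarrow> f i \<in> T) \<Longrightarrow> prod f I \<in> T"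
  by (induction I rule: infinite_finite_induct) auto

lemma T_nonzero: "s \<in> T \<Longrightarrow> s \<noteq> 0"
  using idlD(2)[OF P_idl] by (auto simp: T_def)

lemma frac_rel_iff:
  "((a, s), (b, t)) \<in> frac_rel (ring_on R) T \<longleftrightarrow>
    a \<in> R \<and> b \<in> R \<and> s \<in> T \<and> t \<in> T \<and> a * t = b * s"
proof -
  have "a * t = b * s" if "u \<in> T" "u * (a * t) = u * (b * s)" "a \<in> R" "b \<in> R" "s \<in> T" "t \<in> T" for u
    using that mult_cancel[of u "a * t" "b * s"] T_nonzero T_mem(1) by blast
  then show ?thesis
    unfolding frac_rel_def by (auto intro: bexI[of _ 1])
qed

lemma frac_mem_iff: "(b, t) \<in> frac a s \<longleftrightarrow> a \<in> R \<and> b \<in> R \<and> s \<in> T \<and> t \<in> T \<and> a * t = b * s"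
  by (simp add: frac_def frac_rel_iff)

lemma frac_rel_cancel:
  assumes "a \<in> R" "b \<in> R" "c \<in> R" "s \<in> T" "t \<in> T" "u \<in> T" "a * t = b * s" "b * u = c * t"
  shows "a * u = c * s"
proof -
  have "t * (a * u) = (a * t) * u" by (simp add: algebra_simps)
  also have "\<dots> = s * (b * u)" unfolding assms(7) by (simp add: algebra_simps)
  also have "\<dots> = t * (c * s)" unfolding assms(8) by (simp add: algebra_simps)
  finally show ?thesis
    using mult_cancel[of t "a * u" "c * s"] assms T_nonzero T_mem(1) by auto
qed

lemma frac_eq_iff:
  assumes "a \<in> R" "b \<in> R" "s \<in> T" "t \<in> T"
  shows "frac a s = frac b t \<longleftrightarrow> a * t = b * s"
proof
  assume "frac a s = frac b t"
  moreover have "(b, t) \<in> frac b t" using assms by (simp add: frac_mem_iff)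
  ultimately show "a * t = b * s" using frac_mem_iff by blast
next
  assume eq: "a * t = b * s"
  have "(c, u) \<in> frac a s \<longleftrightarrow> (c, u) \<in> frac b t" for c u
  proof
    assume "(c, u) \<in> frac a s"
    then show "(c, u) \<in> frac b t"
      using frac_rel_cancel[OF assms(2,1) _ assms(4,3) _ eq[symmetric], of c u] assms
      unfolding frac_mem_iff by blast
  next
    assume "(c, u) \<in> frac b t"
    then show "(c, u) \<in> frac a s"
      using frac_rel_cancel[OF assms(1,2) _ assms(3,4) _ eq, of c u] assms
      unfolding frac_mem_iff by blast
  qed
  then show "frac a s = frac b t" by auto
qed

lemma carrier_A: "carrier A = {frac a s | a s. a \<in> R \<and> s \<in> T}"
  unfolding A_def localize_at_def ring_of_fractions_def quotient_def frac_def
  by (auto simp: T_def)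

lemma frac_carrier [intro]: "a \<in> R \<Longrightarrow> s \<in> T \<Longrightarrow> frac a s \<in> carrier A"
  by (auto simp: carrier_A)

lemma carrier_A_cases:
  assumes "x \<in> carrier A" obtains a s where "x = frac a s" "a \<in> R" "s \<in> T"
  using assms by (auto simp: carrier_A)

lemma Image_frac_rel:
  assumes "Z \<noteq> {}" and "\<And>z. z \<in> Z \<Longrightarrow> frac (fst z) (snd z) = x"
  shows "frac_rel (ring_on R) T `` Z = x"
proof -
  have "frac_rel (ring_on R) T `` Z = (\<Union>z\<in>Z. frac (fst z) (snd z))"
    by (auto simp: frac_def)
  then show ?thesis using assms by auto
qed

lemma mult_frac:
  assumes "a \<in> R" "b \<in> R" "s \<in> T" "t \<in> T"
  shows "frac a s \<otimes>\<^bsub>A\<^esub> frac b t = frac (a * b) (s * t)"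
proof -
  let ?Z = "{(a' * b', s' * t') | a' s' b' t'. (a', s') \<in> frac a s \<and> (b', t') \<in> frac b t}"
  have "frac a s \<otimes>\<^bsub>A\<^esub> frac b t = frac_rel (ring_on R) T `` ?Z"
    by (simp add: A_def localize_at_def ring_of_fractions_def flip: T_def)
  also have "\<dots> = frac (a * b) (s * t)"
  proof (rule Image_frac_rel)
    have "(a, s) \<in> frac a s" "(b, t) \<in> frac b t" using assms by (auto simp: frac_mem_iff)
    then show "?Z \<noteq> {}" by blast
    fix z assume "z \<in> ?Z"
    then obtain a' s' b' t' where z: "z = (a' * b', s' * t')" "(a', s') \<in> frac a s" "(b', t') \<in> frac b t"
      by blast
    then have h: "a' \<in> R" "b' \<in> R" "s' \<in> T" "t' \<in> T" "a * s' = a' * s" "b * t' = b' * t"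
      by (auto simp: frac_mem_iff)
    have "a' * b' * (s * t) = (a' * s) * (b' * t)" by (simp add: algebra_simps)
    also have "\<dots> = (a * b) * (s' * t')" using h by (simp add: algebra_simps flip: h(5,6))
    finally have "frac (a' * b') (s' * t') = frac (a * b) (s * t)"
      using assms h by (subst frac_eq_iff) auto
    then show "frac (fst z) (snd z) = frac (a * b) (s * t)"
      using z by simp
  qed
  finally show ?thesis .
qed

lemma add_frac:
  assumes "a \<in> R" "b \<in> R" "s \<in> T" "t \<in> T"
  shows "frac a s \<oplus>\<^bsub>A\<^esub> frac b t = frac (a * t + b * s) (s * t)"
proof -
  let ?Z = "{(a' * t' + b' * s', s' * t') | a' s' b' t'. (a', s') \<in> frac a s \<and> (b', t') \<in> frac b t}"
  have "frac a s \<oplus>\<^bsub>A\<^esub> frac b t = frac_rel (ring_on R) T `` ?Z"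
    by (simp add: A_def localize_at_def ring_of_fractions_def flip: T_def)
  also have "\<dots> = frac (a * t + b * s) (s * t)"
  proof (rule Image_frac_rel)
    have "(a, s) \<in> frac a s" "(b, t) \<in> frac b t" using assms by (auto simp: frac_mem_iff)
    then show "?Z \<noteq> {}" by blast
    fix z assume "z \<in> ?Z"
    then obtain a' s' b' t' where z: "z = (a' * t' + b' * s', s' * t')"
      "(a', s') \<in> frac a s" "(b', t') \<in> frac b t"
      by blast
    then have h: "a' \<in> R" "b' \<in> R" "s' \<in> T" "t' \<in> T" "a * s' = a' * s" "b * t' = b' * t"
      by (auto simp: frac_mem_iff)
    have "(a' * t' + b' * s') * (s * t) = (a' * s) * (t' * t) + (b' * t) * (s' * s)"
      by (simp add: algebra_simps)
    also have "\<dots> = (a * t + b * s) * (s' * t')" unfolding h(5,6)[symmetric]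
      by (simp add: algebra_simps)
    finally have "frac (a' * t' + b' * s') (s' * t') = frac (a * t + b * s) (s * t)"
      using assms h T_mem(1) by (subst frac_eq_iff) auto
    then show "frac (fst z) (snd z) = frac (a * t + b * s) (s * t)"
      using z by simp
  qed
  finally show ?thesis .
qed

lemma one_A: "\<one>\<^bsub>A\<^esub> = frac 1 1" and zero_A: "\<zero>\<^bsub>A\<^esub> = frac 0 1"
  by (simp_all add: A_def localize_at_def ring_of_fractions_def frac_def flip: T_def)

lemma cring_A: "cring A"
proof (rule cringI)
  show "abelian_group A"
  proof (rule abelian_groupI)
    fix x y z assume "x \<in> carrier A" "y \<in> carrier A" "z \<in> carrier A"
    then obtain a b c s t u where h: "x = frac a s" "y = frac b t" "z = frac c u"
      "a \<in> R" "b \<in> R" "c \<in> R" "s \<in> T" "t \<in> T" "u \<in> T" by (metis carrier_A_cases)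
    then have h': "s \<in> R" "t \<in> R" "u \<in> R" using T_mem(1) by auto
    show "x \<oplus>\<^bsub>A\<^esub> y \<in> carrier A" using h h' by (auto simp: add_frac)
    show "x \<oplus>\<^bsub>A\<^esub> y \<oplus>\<^bsub>A\<^esub> z = x \<oplus>\<^bsub>A\<^esub> (y \<oplus>\<^bsub>A\<^esub> z)"
      using h h' by (simp add: add_frac add_mem mult_mem T_mult algebra_simps)
    show "x \<oplus>\<^bsub>A\<^esub> y = y \<oplus>\<^bsub>A\<^esub> x"
      using h h' by (simp add: add_frac algebra_simps)
    show "\<zero>\<^bsub>A\<^esub> \<oplus>\<^bsub>A\<^esub> x = x"
      using h h' by (simp add: zero_A add_frac)
    have "frac (- a) s \<oplus>\<^bsub>A\<^esub> x = \<zero>\<^bsub>A\<^esub>"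
      using h h' by (simp add: zero_A add_frac uminus_mem T_mult frac_eq_iff)
    then show "\<exists>y\<in>carrier A. y \<oplus>\<^bsub>A\<^esub> x = \<zero>\<^bsub>A\<^esub>" using h by auto
  qed (auto simp: zero_A)
  show "Group.comm_monoid A"
  proof (rule comm_monoidI)
    fix x y z assume "x \<in> carrier A" "y \<in> carrier A" "z \<in> carrier A"
    then obtain a b c s t u where h: "x = frac a s" "y = frac b t" "z = frac c u"
      "a \<in> R" "b \<in> R" "c \<in> R" "s \<in> T" "t \<in> T" "u \<in> T" by (metis carrier_A_cases)
    show "x \<otimes>\<^bsub>A\<^esub> y \<in> carrier A" using h by (auto simp: mult_frac)
    show "x \<otimes>\<^bsub>A\<^esub> y \<otimes>\<^bsub>A\<^esub> z = x \<otimes>\<^bsub>A\<^esub> (y \<otimes>\<^bsub>A\<^esub> z)"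
      using h by (simp add: mult_frac mult_mem T_mult algebra_simps)
    show "x \<otimes>\<^bsub>A\<^esub> y = y \<otimes>\<^bsub>A\<^esub> x"
      using h by (simp add: mult_frac algebra_simps)
    show "\<one>\<^bsub>A\<^esub> \<otimes>\<^bsub>A\<^esub> x = x"
      using h by (simp add: one_A mult_frac)
  qed (auto simp: one_A)
  fix x y z assume "x \<in> carrier A" "y \<in> carrier A" "z \<in> carrier A"
  then obtain a b c s t u where h: "x = frac a s" "y = frac b t" "z = frac c u"
    "a \<in> R" "b \<in> R" "c \<in> R" "s \<in> T" "t \<in> T" "u \<in> T" by (metis carrier_A_cases)
  then have h': "s \<in> R" "t \<in> R" "u \<in> R" using T_mem(1) by auto
  show "(x \<oplus>\<^bsub>A\<^esub> y) \<otimes>\<^bsub>A\<^esub> z = x \<otimes>\<^bsub>A\<^esub> z \<oplus>\<^bsub>A\<^esub> y \<otimes>\<^bsub>A\<^esub> z"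
    using h h' by (simp add: add_frac mult_frac add_mem mult_mem T_mult frac_eq_iff algebra_simps)
qed

lemma ideal_frac_denom:
  assumes "ideal J A" "a \<in> R" "s \<in> T" "t \<in> T" "frac a s \<in> J"
  shows "frac a t \<in> J"
proof -
  have "frac s t \<otimes>\<^bsub>A\<^esub> frac a s \<in> J"
    using ideal.I_l_closed[OF assms(1,5) frac_carrier] assms T_mem(1) by blast
  also have "frac s t \<otimes>\<^bsub>A\<^esub> frac a s = frac a t"
    using assms T_mem(1) by (simp add: mult_frac mult_mem T_mult frac_eq_iff algebra_simps)
  finally show ?thesis .
qed

text \<open>Ideals of the localization are handled through their preimages in R.\<close>

definition contract :: "('r \<times> 'r) set set \<Rightarrow> 'r set" where
  "contract J = {a \<in> R. frac a 1 \<in> J}"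

lemma frac_mem_ideal_iff:
  assumes "ideal J A" "a \<in> R" "s \<in> T"
  shows "frac a s \<in> J \<longleftrightarrow> a \<in> contract J"
  using ideal_frac_denom[OF assms(1)] assms by (auto simp: contract_def)

lemma contract_idl:
  assumes "ideal J A" shows "idl (contract J)"
proof -
  interpret ideal J A by (rule assms)
  have "a + b \<in> contract J" if "a \<in> contract J" "b \<in> contract J" for a b
  proof -
    have "frac a 1 \<oplus>\<^bsub>A\<^esub> frac b 1 \<in> J" using that by (auto simp: contract_def)
    then show ?thesis using that by (auto simp: contract_def add_frac)
  qed
  moreover have "r * a \<in> contract J" if "a \<in> contract J" "r \<in> R" for a r
  proof -
    have "frac r 1 \<otimes>\<^bsub>A\<^esub> frac a 1 \<in> J" using that by (auto simp: contract_def intro!: I_l_closed)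
    then show ?thesis using that by (auto simp: contract_def mult_frac)
  qed
  moreover have "0 \<in> contract J"
    using additive_subgroup.zero_closed[OF is_additive_subgroup] by (auto simp: contract_def zero_A)
  ultimately show ?thesis by (auto simp: idl_def contract_def)
qed

lemma contract_saturated:
  assumes "ideal J A" "s \<in> T" "a \<in> R" "s * a \<in> contract J"
  shows "a \<in> contract J"
proof -
  have "frac (s * a) s \<in> J"
    using frac_mem_ideal_iff[OF assms(1) mult_mem[OF T_mem(1)[OF assms(2)] assms(3)] assms(2)] assms(4)
    by simp
  moreover have "frac (s * a) s = frac a 1"
    using assms T_mem(1) by (subst frac_eq_iff) (auto simp: algebra_simps)
  ultimately show ?thesis using assms by (simp add: contract_def)
qed

definition extend :: "'r set \<Rightarrow> ('r \<times> 'r) set set" where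
  "extend I = {frac a s | a s. a \<in> I \<and> s \<in> T}"

lemma extend_ideal:
  assumes I: "idl I" shows "ideal (extend I) A"
proof -
  interpret cring A by (rule cring_A)
  have lmul: "x \<otimes>\<^bsub>A\<^esub> y \<in> extend I" if y: "y \<in> extend I" and x: "x \<in> carrier A" for x y
  proof -
    obtain b t where "x = frac b t" "b \<in> R" "t \<in> T"
      using x by (rule carrier_A_cases)
    moreover obtain a s where "y = frac a s" "a \<in> I" "s \<in> T"
      using y unfolding extend_def by blast
    moreover have "b * a \<in> I" "a \<in> R" if "a \<in> I" "b \<in> R" for a b
      using idlD(1)[OF I] idlD(4)[OF I] that by auto
    ultimately show ?thesis unfolding extend_def
      by (auto simp: mult_frac)
  qed
  have sub: "extend I \<subseteq> carrier A" using idlD(1)[OF I] by (auto simp: extend_def)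
  show ?thesis
  proof (rule idealI[OF ring_axioms])
    show "subgroup (extend I) (add_monoid A)"
    proof (rule group.subgroupI[OF add.is_group])
      show "extend I \<subseteq> carrier (add_monoid A)" using sub by simp
      show "extend I \<noteq> {}" using idlD(2)[OF I] by (auto simp: extend_def)
      fix x assume x: "x \<in> extend I"
      then have "\<ominus>\<^bsub>A\<^esub> x = (\<ominus>\<^bsub>A\<^esub> \<one>\<^bsub>A\<^esub>) \<otimes>\<^bsub>A\<^esub> x"
        using sub by (auto simp: l_minus)
      then have "\<ominus>\<^bsub>A\<^esub> x \<in> extend I"
        using lmul[OF x, of "\<ominus>\<^bsub>A\<^esub> \<one>\<^bsub>A\<^esub>"] by simp
      then show "inv\<^bsub>add_monoid A\<^esub> x \<in> extend I" unfolding a_inv_def .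
      fix y assume y: "y \<in> extend I"
      obtain a s b t where h: "x = frac a s" "a \<in> I" "s \<in> T" "y = frac b t" "b \<in> I" "t \<in> T"
        using x y by (auto simp: extend_def)
      then have "x \<oplus>\<^bsub>A\<^esub> y = frac (a * t + b * s) (s * t)"
        using idlD(8)[OF I] by (simp add: add_frac)
      moreover have "a * t + b * s \<in> I"
        by (intro idlD(3)[OF I] idlD(5)[OF I] h T_mem(1))
      ultimately show "x \<otimes>\<^bsub>add_monoid A\<^esub> y \<in> extend I" using h by (auto simp: extend_def)
    qed
  next
    fix a x assume "a \<in> extend I" "x \<in> carrier A"
    then show "x \<otimes>\<^bsub>A\<^esub> a \<in> extend I" "a \<otimes>\<^bsub>A\<^esub> x \<in> extend I"
      using lmul[of a x] sub m_comm[of a x] by auto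
  qed
qed

lemma contract_extend_iff:
  assumes I: "idl I" and "a \<in> R"
  shows "a \<in> contract (extend I) \<longleftrightarrow> (\<exists>s\<in>T. s * a \<in> I)"
proof
  assume "a \<in> contract (extend I)"
  then obtain b s where "frac a 1 = frac b s" "b \<in> I" "s \<in> T"
    by (auto simp: contract_def extend_def)
  then have "a * s = b" using idlD(1)[OF I] assms frac_eq_iff[of a b 1 s] by auto
  then show "\<exists>s\<in>T. s * a \<in> I" using \<open>b \<in> I\<close> \<open>s \<in> T\<close> by (auto simp: mult.commute)
next
  assume "\<exists>s\<in>T. s * a \<in> I"
  then obtain s where s: "s \<in> T" "s * a \<in> I" by auto
  then have "s * a \<in> contract (extend I)" using idlD(1)[OF I] by (auto simp: contract_def extend_def)
  then show "a \<in> contract (extend I)" using contract_saturated extend_ideal[OF I] s assms by blast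
qed

lemma extend_contract:
  assumes "ideal J A" shows "extend (contract J) = J"
proof -
  have "x \<in> J" if "x \<in> extend (contract J)" for x
    using that frac_mem_ideal_iff[OF assms] by (auto simp: extend_def contract_def)
  moreover have "x \<in> extend (contract J)" if x: "x \<in> J" for x
  proof -
    obtain a s where "x = frac a s" "a \<in> R" "s \<in> T"
      using ideal.Icarr[OF assms x] by (rule carrier_A_cases)
    then show ?thesis using frac_mem_ideal_iff[OF assms] x unfolding extend_def by blast
  qed
  ultimately show ?thesis by blast
qed

lemma ideal_A_eqI:
  assumes "ideal J A" "ideal J' A" "contract J = contract J'" shows "J = J'"
  using extend_contract assms by metis

lemma contract_mono: "J \<subseteq> J' \<Longrightarrow> contract J \<subseteq> contract J'"
  by (auto simp: contract_def)

lemma contract_proper: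
  assumes "ideal J A" "J \<noteq> carrier A" shows "contract J \<subseteq> P"
proof
  fix a assume a: "a \<in> contract J"
  interpret ideal J A by (rule assms)
  show "a \<in> P"
  proof (rule ccontr)
    assume "a \<notin> P"
    then have "a \<in> T" "a \<in> R" using a by (auto simp: T_def contract_def)
    then have "frac a a \<in> J" using frac_mem_ideal_iff[OF assms(1)] a by auto
    moreover have "frac a a = \<one>\<^bsub>A\<^esub>" using \<open>a \<in> T\<close> \<open>a \<in> R\<close> by (simp add: one_A frac_eq_iff)
    ultimately show False using one_imp_carrier assms(2) by simp
  qed
qed

lemma contract_prime:
  assumes "primeideal J A"
  shows "idl (contract J)" "contract J \<subseteq> P"
    "a \<in> R \<Longrightarrow> b \<in> R \<Longrightarrow> a * b \<in> contract J \<Longrightarrow> a \<in> contract J \<or> b \<in> contract J"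
proof -
  interpret primeideal J A by (rule assms)
  show "idl (contract J)" by (rule contract_idl[OF ideal_axioms])
  show "contract J \<subseteq> P" using contract_proper[OF ideal_axioms] I_notcarr by auto
  show "a \<in> contract J \<or> b \<in> contract J" if "a \<in> R" "b \<in> R" "a * b \<in> contract J"
    using I_prime[of "frac a 1" "frac b 1"] that by (auto simp: contract_def mult_frac)
qed

lemma extend_prime:
  assumes I: "idl I" and sub: "I \<subseteq> P"
    and prime: "\<And>a b. a \<in> R \<Longrightarrow> b \<in> R \<Longrightarrow> a * b \<in> I \<Longrightarrow> a \<in> I \<or> b \<in> I"
  shows "primeideal (extend I) A" "contract (extend I) = I"
proof -
  show c: "contract (extend I) = I"
  proof (intro equalityI subsetI)
    fix a assume "a \<in> contract (extend I)"
    then obtain s where "a \<in> R" "s \<in> T" "s * a \<in> I"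
      using contract_extend_iff[OF I] by (auto simp: contract_def)
    then show "a \<in> I" using prime[of s a] sub by (auto simp: T_def)
  next
    fix a assume "a \<in> I"
    then show "a \<in> contract (extend I)"
      using idlD(1)[OF I] by (auto simp: contract_def extend_def)
  qed
  have J: "ideal (extend I) A" by (rule extend_ideal[OF I])
  show "primeideal (extend I) A"
  proof (rule primeidealI[OF J cring_A])
    have "1 \<notin> contract (extend I)" using c sub P_one by auto
    then have "\<one>\<^bsub>A\<^esub> \<notin> extend I" by (auto simp: contract_def one_A)
    then show "carrier A \<noteq> extend I"
      using cring.cring_simprules(6)[OF cring_A] by auto
    fix x y assume xy: "x \<in> carrier A" "y \<in> carrier A" "x \<otimes>\<^bsub>A\<^esub> y \<in> extend I"
    then obtain a s b t where h: "x = frac a s" "a \<in> R" "s \<in> T" "y = frac b t" "b \<in> R" "t \<in> T"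
      by (metis carrier_A_cases)
    then have "a * b \<in> I" using xy frac_mem_ideal_iff[OF J, of "a * b" "s * t"] c
      by (auto simp: mult_frac)
    then show "x \<in> extend I \<or> y \<in> extend I"
      using prime[of a b] h frac_mem_ideal_iff[OF J] c by auto
  qed
qed

end

section \<open>Koszul cohomology and depth\<close>

text \<open>A cochain of the Koszul complex of \<open>ys\<close> assigns a ring element to each subset of the index
  set, coded by its characteristic list; its degree is the number of entries True.\<close>

fun koszul :: "'r::comm_ring_1 list \<Rightarrow> (bool list \<Rightarrow> 'r) \<Rightarrow> bool list \<Rightarrow> 'r" where
  "koszul [] c l = 0"
| "koszul (y # ys) c [] = 0"
| "koszul (y # ys) c (b # l) =
    (if b then y * c (False # l) - koszul ys (\<lambda>l. c (True # l)) l else koszul ys (\<lambda>l. c (False # l)) l)"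

lemma koszul_linear:
  "koszul ys (\<lambda>l. r * c l + t * e l) l = r * koszul ys c l + t * koszul ys e l"
proof (induction ys arbitrary: c e l)
  case (Cons y ys)
  show ?case
    by (cases l) (simp_all add: Cons.IH algebra_simps)
qed simp

lemma koszul_scale: "koszul ys (\<lambda>l. r * c l) l = r * koszul ys c l"
  using koszul_linear[of ys r c 0 "\<lambda>_. 0" l] by simp

lemma koszul_add: "koszul ys (\<lambda>l. c l + e l) l = koszul ys c l + koszul ys e l"
  using koszul_linear[of ys 1 c 1 e l] by simp

lemma koszul_diff: "koszul ys (\<lambda>l. c l - e l) l = koszul ys c l - koszul ys e l"
  using koszul_linear[of ys 1 c "- 1" e l] by simp

lemma koszul_zero [simp]: "koszul ys (\<lambda>l. 0) l = 0"
  using koszul_scale[of ys 0 "\<lambda>_. 0" l] by simp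

lemma koszul_sum: "koszul ys (\<lambda>l. \<Sum>j\<in>J. f j l) l = (\<Sum>j\<in>J. koszul ys (f j) l)"
  by (induction J rule: infinite_finite_induct) (simp_all add: koszul_add)

lemma koszul_koszul: "koszul ys (koszul ys c) l = 0"
proof (induction ys arbitrary: c l)
  case (Cons y ys)
  show ?case
  proof (cases l)
    case (Cons b l')
    have "koszul ys (\<lambda>l. y * c (False # l) - koszul ys (\<lambda>l. c (True # l)) l) l' =
      y * koszul ys (\<lambda>l. c (False # l)) l'"
      by (simp add: koszul_diff koszul_scale Cons.IH)
    then show ?thesis using Cons.IH[of "\<lambda>l. c (False # l)" l'] by (simp add: Cons)
  qed simp
qed simp

text \<open>Removing the k-th index is a homotopy from multiplication by the k-th entry to zero; hence
  every entry annihilates the cohomology.\<close>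

fun contraction :: "nat \<Rightarrow> (bool list \<Rightarrow> 'r::comm_ring_1) \<Rightarrow> bool list \<Rightarrow> 'r" where
  "contraction k c [] = 0"
| "contraction 0 c (b # l) = (if b then 0 else c (True # l))"
| "contraction (Suc k) c (b # l) =
    (if b then - contraction k (\<lambda>l. c (True # l)) l else contraction k (\<lambda>l. c (False # l)) l)"

lemma contraction_linear:
  "contraction k (\<lambda>l. r * c l - e l) l = r * contraction k c l - contraction k e l"
proof (induction k arbitrary: c e l)
  case 0
  show ?case by (cases l) simp_all
next
  case (Suc k)
  show ?case by (cases l) (simp_all add: Suc.IH)
qed

lemma contraction_homotopy:
  assumes "k < length ys" "length l = length ys"
  shows "koszul ys (contraction k c) l + contraction k (koszul ys c) l = ys ! k * c l"
  using assms
proof (induction ys arbitrary: k c l)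
  case (Cons y ys)
  then obtain b l' where l: "l = b # l'" "length l' = length ys" by (cases l) auto
  show ?case
  proof (cases k)
    case 0
    then show ?thesis by (simp add: l)
  next
    case (Suc k')
    have IH: "koszul ys (contraction k' c') l' + contraction k' (koszul ys c') l' = ys ! k' * c' l'" for c'
      using Cons.IH[of k' l' c'] Cons.prems l Suc by simp
    have neg: "koszul ys (\<lambda>l. - contraction k' (\<lambda>l. c (True # l)) l) l' =
      - koszul ys (contraction k' (\<lambda>l. c (True # l))) l'"
      using koszul_scale[of ys "- 1" "contraction k' (\<lambda>l. c (True # l))" l'] by simp
    have "koszul ys (contraction k' (\<lambda>l. c (True # l))) l' = ys ! k' * c (True # l') -
        contraction k' (koszul ys (\<lambda>l. c (True # l))) l'"
      using IH[of "\<lambda>l. c (True # l)"] by (simp add: algebra_simps)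
    moreover have "contraction k' (\<lambda>l. y * c (False # l) - koszul ys (\<lambda>l. c (True # l)) l) l' =
      y * contraction k' (\<lambda>l. c (False # l)) l' - contraction k' (koszul ys (\<lambda>l. c (True # l))) l'"
      using contraction_linear[of k' y "\<lambda>l. c (False # l)" "koszul ys (\<lambda>l. c (True # l))" l'] by simp
    ultimately show ?thesis
      using IH[of "\<lambda>l. c (False # l)"] neg by (simp add: l Suc)
  qed
qed simp

text \<open>The recursion suits the homotopy; the expansion with signs serves to read off single
  coefficients.\<close>

definition koszul_sign :: "bool list \<Rightarrow> nat \<Rightarrow> 'r::comm_ring_1" where
  "koszul_sign l j = (- 1) ^ count_list (take j l) True"

lemma koszul_expand:
  assumes "length l = length ys"
  shows "koszul ys c l =
    (\<Sum>j<length ys. if l ! j then koszul_sign l j * ys ! j * c (l[j := False]) else 0)"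
  using assms
proof (induction ys arbitrary: c l)
  case (Cons y ys)
  then obtain b l' where l: "l = b # l'" "length l' = length ys" by (cases l) auto
  have "(\<Sum>j<length ys. if l' ! j then koszul_sign (b # l') (Suc j) * ys ! j * c (b # l'[j := False]) else 0) =
    (if b then -1 else 1) * koszul ys (\<lambda>l. c (b # l)) l'"
    using l by (auto simp: Cons.IH sum_negf[symmetric] koszul_sign_def intro!: sum.cong)
  then show ?case using l(2) unfolding l(1)
    by (cases b) (simp_all add: sum.lessThan_Suc_shift koszul_sign_def del: sum.lessThan_Suc cong: if_cong)
qed simp

text \<open>Degrees are integers so that cochains of negative degree, which vanish, need no separate
  treatment.\<close>

definition homogeneous :: "nat \<Rightarrow> int \<Rightarrow> (bool list \<Rightarrow> 'r::zero) \<Rightarrow> bool" where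
  "homogeneous n i c \<longleftrightarrow> (\<forall>l. c l \<noteq> 0 \<longrightarrow> length l = n \<and> int (count_list l True) = i)"

lemma homogeneousD: "homogeneous n i c \<Longrightarrow> length l \<noteq> n \<or> int (count_list l True) \<noteq> i \<Longrightarrow> c l = 0"
  unfolding homogeneous_def by blast

lemma homogeneous_nonzeroD:
  "homogeneous n i c \<Longrightarrow> c l \<noteq> 0 \<Longrightarrow> length l = n \<and> int (count_list l True) = i"
  unfolding homogeneous_def by blast

lemma homogeneous_Cons:
  assumes "homogeneous (Suc n) i c"
  shows "homogeneous n i (\<lambda>l. c (False # l))" "homogeneous n (i - 1) (\<lambda>l. c (True # l))"
  unfolding homogeneous_def
proof safe
  fix l
  show "length l = n" "int (count_list l True) = i" if "c (False # l) \<noteq> 0"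
    using homogeneous_nonzeroD[OF assms, of "False # l"] that by auto
  show "length l = n" "int (count_list l True) = i - 1" if "c (True # l) \<noteq> 0"
    using homogeneous_nonzeroD[OF assms, of "True # l"] that by auto
qed

lemma homogeneous_koszul:
  assumes "homogeneous (length ys) i c"
  shows "homogeneous (length ys) (i + 1) (koszul ys c)"
  using assms
proof (induction ys arbitrary: c i)
  case Nil
  show ?case by (simp add: homogeneous_def)
next
  case (Cons y ys)
  have c: "homogeneous (length ys) i (\<lambda>l. c (False # l))" "homogeneous (length ys) (i - 1) (\<lambda>l. c (True # l))"
    using homogeneous_Cons[of "length ys" i c] Cons.prems by simp_all
  show ?case
    unfolding homogeneous_def
  proof (intro allI impI)
    fix l assume nz: "koszul (y # ys) c l \<noteq> 0"
    then obtain b l' where l: "l = b # l'" by (cases l) auto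
    show "length l = length (y # ys) \<and> int (count_list l True) = i + 1"
    proof (cases b)
      case False
      then show ?thesis using nz homogeneousD[OF Cons.IH[OF c(1)], of l'] l by auto
    next
      case True
      then have "c (False # l') \<noteq> 0 \<or> koszul ys (\<lambda>l. c (True # l)) l' \<noteq> 0" using nz l by auto
      then show ?thesis
        using homogeneousD[OF Cons.IH[OF c(2)], of l'] homogeneousD[OF c(1), of l'] l True by auto
    qed
  qed
qed

lemma homogeneous_contraction:
  assumes "homogeneous n i c"
  shows "homogeneous n (i - 1) (contraction k c)"
  using assms
proof (induction k arbitrary: c i n)
  case 0
  show ?case
    unfolding homogeneous_def
  proof (intro allI impI)
    fix l assume "contraction 0 c l \<noteq> 0"
    then obtain l' where l: "l = False # l'" "c (True # l') \<noteq> 0"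
      by (cases l) (auto split: if_splits)
    then show "length l = n \<and> int (count_list l True) = i - 1"
      using homogeneous_nonzeroD[OF 0, of "True # l'"] by auto
  qed
next
  case (Suc k)
  show ?case
    unfolding homogeneous_def
  proof (intro allI impI)
    fix l assume nz: "contraction (Suc k) c l \<noteq> 0"
    then obtain b l' where l: "l = b # l'" by (cases l) auto
    have "contraction k (\<lambda>l. c (b # l)) l' \<noteq> 0" using nz l by (cases b) auto
    moreover have "\<exists>n'. n = Suc n'"
    proof (rule ccontr)
      assume "\<not> ?thesis"
      then have "c (b # l) = 0" for l using homogeneousD[OF Suc.prems, of "b # l"] by (cases n) auto
      moreover have "contraction k (\<lambda>l. 0 :: 'a) l = 0" for l
        using contraction_linear[of k 1 "\<lambda>_. 0" "\<lambda>_. 0 :: 'a" l] by simp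
      ultimately show False using \<open>contraction k (\<lambda>l. c (b # l)) l' \<noteq> 0\<close> by simp
    qed
    then obtain n' where n: "n = Suc n'" by blast
    have c: "homogeneous n' i (\<lambda>l. c (False # l))" "homogeneous n' (i - 1) (\<lambda>l. c (True # l))"
      using homogeneous_Cons[of n' i c] Suc.prems n by simp_all
    ultimately show "length l = n \<and> int (count_list l True) = i - 1"
      using homogeneous_nonzeroD[OF Suc.IH[OF c(1)], of l'] homogeneous_nonzeroD[OF Suc.IH[OF c(2)], of l'] l n
      by (cases b) auto
  qed
qed

context subdomain
begin

lemma koszul_idl:
  assumes I: "idl I" and "set ys \<subseteq> R" and "\<And>l. c l \<in> I"
  shows "koszul ys c l \<in> I"
  using assms(2,3)
proof (induction ys arbitrary: c l)
  case Nil
  show ?case using idlD(2)[OF I] by simp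
next
  case (Cons y ys)
  have "koszul ys (\<lambda>l. c (b # l)) l' \<in> I" for b l' using Cons by simp
  then show ?case
    using Cons.prems idlD(2)[OF I] by (cases l) (auto intro!: idlD(7)[OF I] idlD(4)[OF I])
qed

lemma contraction_idl:
  assumes I: "idl I" and "\<And>l. c l \<in> I"
  shows "contraction k c l \<in> I"
  using assms(2)
proof (induction k arbitrary: c l)
  case 0
  then show ?case using idlD(2)[OF I] by (cases l) auto
next
  case (Suc k)
  have "contraction k (\<lambda>l. c (b # l)) l' \<in> I" for b l' using Suc by simp
  then show ?case using idlD(2)[OF I] by (cases l) (auto intro!: idlD(6)[OF I])
qed

lemma idl_R: "idl R"
  by (auto simp: idl_def)

end

context localized_subdomain
begin

text \<open>The denominator s makes these notions refer to the Koszul complex of \<open>ys\<close> on the localization of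
  R/I at P, without leaving R.\<close>

definition coboundary :: "'r list \<Rightarrow> 'r set \<Rightarrow> int \<Rightarrow> (bool list \<Rightarrow> 'r) \<Rightarrow> bool" where
  "coboundary ys I i c \<longleftrightarrow> (\<exists>s\<in>T. \<exists>e. (\<forall>l. e l \<in> R) \<and> homogeneous (length ys) (i - 1) e \<and>
     (\<forall>l. s * c l - koszul ys e l \<in> I))"

definition koszul_vanishes :: "'r list \<Rightarrow> 'r set \<Rightarrow> int \<Rightarrow> bool" where
  "koszul_vanishes ys I i \<longleftrightarrow> (\<forall>c. (\<forall>l. c l \<in> R) \<longrightarrow> homogeneous (length ys) i c \<longrightarrow>
     (\<forall>l. koszul ys c l \<in> I) \<longrightarrow> coboundary ys I i c)"

lemma koszul_vanishes_negative:
  assumes "idl I" "i < 0"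
  shows "koszul_vanishes ys I i"
  unfolding koszul_vanishes_def coboundary_def
proof (intro allI impI)
  fix c :: "bool list \<Rightarrow> 'r" assume c: "homogeneous (length ys) i c"
  have "c l = 0" for l using homogeneousD[OF c, of l] assms(2) by auto
  then show "\<exists>s\<in>T. \<exists>e. (\<forall>l. e l \<in> R) \<and> homogeneous (length ys) (i - 1) e \<and>
      (\<forall>l. s * c l - koszul ys e l \<in> I)"
    using idlD(2)[OF assms(1)]
    by (intro bexI[of _ 1] exI[of _ "\<lambda>_. 0"]) (auto simp: homogeneous_def)
qed

lemma finite_bool_lists: "finite {l :: bool list. length l = n}"
  using finite_lists_length_eq[of "UNIV :: bool set" n] by simp

text \<open>A nonzerodivisor x with a power in the ideal of \<open>ys\<close> acts nilpotently on the cohomology of R/I,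
  by the homotopy, and it acts injectively in degree i if the group in degree i - 1 vanishes modulo x,
  by the long exact sequence of multiplication by x.\<close>

lemma koszul_vanishes_step:
  assumes I: "idl I" and I': "idl I'" and ys: "set ys \<subseteq> R" and x: "x \<in> R" "x \<in> I'"
    and regular: "\<And>a. a \<in> R \<Longrightarrow> x * a \<in> I \<Longrightarrow> a \<in> I"
    and sub: "I \<subseteq> I'"
    and quotient: "\<And>a. a \<in> I' \<Longrightarrow> \<exists>s\<in>T. \<exists>b\<in>R. s * a - x * b \<in> I"
    and power: "x ^ k = (\<Sum>j<length ys. g j * ys ! j)" "\<And>j. g j \<in> R"
    and vanishes: "koszul_vanishes ys I' (i - 1)"
  shows "koszul_vanishes ys I i"
proof -
  note RI = idl_R
  have cancel: "coboundary ys I i c" if c: "\<And>l. c l \<in> R" "homogeneous (length ys) i c"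
    and cob: "coboundary ys I i (\<lambda>l. x * c l)" for c
  proof -
    obtain s e where e: "s \<in> T" "\<And>l. e l \<in> R" "homogeneous (length ys) (i - 1) e"
      "\<And>l. s * (x * c l) - koszul ys e l \<in> I"
      using cob unfolding coboundary_def by blast
    have sR: "s \<in> R" using e T_mem(1) by auto
    have "koszul ys e l \<in> I'" for l
    proof -
      have "koszul ys e l = x * (s * c l) - (s * (x * c l) - koszul ys e l)"
        by (simp add: algebra_simps)
      then show ?thesis
        using idlD(7)[OF I' idlD(5)[OF I' x(2), of "s * c l"], of "s * (x * c l) - koszul ys e l"]
          e(4)[of l] sub mult_mem[OF sR c(1)] by auto
    qed
    then have "coboundary ys I' (i - 1) e"
      using vanishes e(2,3) unfolding koszul_vanishes_def by simp
    then obtain s' f where f: "s' \<in> T" "\<And>l. f l \<in> R" "homogeneous (length ys) (i - 1 - 1) f"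
      "\<And>l. s' * e l - koszul ys f l \<in> I'"
      unfolding coboundary_def by blast
    have "\<forall>l. \<exists>s\<in>T. \<exists>b\<in>R. s * (s' * e l - koszul ys f l) - x * b \<in> I"
      using quotient[OF f(4)] by blast
    then obtain \<sigma> b where b: "\<And>l. \<sigma> l \<in> T" "\<And>l. b l \<in> R"
      "\<And>l. \<sigma> l * (s' * e l - koszul ys f l) - x * b l \<in> I" by metis
    (* Only finitely many lists carry a nonzero value, so the product of their denominators clears all. *)
    define L where "L = {l :: bool list. length l = length ys}"
    define s'' where "s'' = prod \<sigma> L"
    define e' where "e' l = (if length l = length ys \<and> int (count_list l True) = i - 1
      then prod \<sigma> (L - {l}) * b l else 0)" for l
    have s'': "s'' \<in> T" unfolding s''_def using b(1) by blast
    have e'R: "e' l \<in> R" for l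
      unfolding e'_def using b(1,2) T_mem(1) by (auto intro!: mult_mem prod_mem)
    have koszf: "homogeneous (length ys) (i - 1) (koszul ys f)"
      using homogeneous_koszul[OF f(3)] by simp
    have fR: "koszul ys f l \<in> R" for l using koszul_idl[OF RI ys f(2)] .
    have key: "s'' * (s' * e l - koszul ys f l) - x * e' l \<in> I" for l
    proof (cases "length l = length ys \<and> int (count_list l True) = i - 1")
      case True
      then have "l \<in> L" by (simp add: L_def)
      then have "s'' = \<sigma> l * prod \<sigma> (L - {l})"
        unfolding s''_def by (rule prod.remove[rotated]) (simp add: L_def finite_bool_lists)
      then have "s'' * (s' * e l - koszul ys f l) - x * e' l =
        prod \<sigma> (L - {l}) * (\<sigma> l * (s' * e l - koszul ys f l) - x * b l)"
        using True by (simp add: e'_def algebra_simps)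
      moreover have "prod \<sigma> (L - {l}) \<in> R" using b(1) T_mem(1) by blast
      ultimately show ?thesis using idlD(4)[OF I b(3)] by simp
    next
      case False
      then have "e l = 0" "koszul ys f l = 0" "e' l = 0"
        using homogeneousD[OF e(3)] homogeneousD[OF koszf] by (auto simp: e'_def)
      then show ?thesis using idlD(2)[OF I] by simp
    qed
    have dkey: "s'' * (s' * koszul ys e l) - x * koszul ys e' l \<in> I" for l
    proof -
      have "koszul ys (\<lambda>l. s'' * (s' * e l - koszul ys f l) - x * e' l) l \<in> I"
        by (rule koszul_idl[OF I ys key])
      then show ?thesis
        by (simp add: koszul_diff koszul_scale koszul_koszul)
    qed
    have "s * s' * s'' * c l - koszul ys e' l \<in> I" for l
    proof (rule regular)
      show "s * s' * s'' * c l - koszul ys e' l \<in> R"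
        using koszul_idl[OF RI ys e'R] sR f(1) s'' T_mem(1) c(1) by (intro diff_mem mult_mem) auto
      have "x * (s * s' * s'' * c l - koszul ys e' l) =
        (s'' * s') * (s * (x * c l) - koszul ys e l) + (s'' * (s' * koszul ys e l) - x * koszul ys e' l)"
        by (simp add: algebra_simps)
      also have "\<dots> \<in> I"
        using s'' f(1) T_mem(1) by (intro idlD(3)[OF I] dkey idlD(4)[OF I] e(4) mult_mem) auto
      finally show "x * (s * s' * s'' * c l - koszul ys e' l) \<in> I" .
    qed
    moreover have "homogeneous (length ys) (i - 1) e'" by (simp add: homogeneous_def e'_def)
    ultimately show ?thesis
      unfolding coboundary_def using e(1) f(1) s'' e'R
      by (intro bexI[of _ "s * s' * s''"] exI[of _ e']) auto
  qed
  have cancel_power: "coboundary ys I i c" if "\<And>l. c l \<in> R" "homogeneous (length ys) i c"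
    "coboundary ys I i (\<lambda>l. x ^ k * c l)" for c k
    using that
  proof (induction k)
    case 0
    then show ?case by simp
  next
    case (Suc k)
    have hom: "homogeneous (length ys) i (\<lambda>l. x ^ k * c l)"
      using Suc.prems(2) unfolding homogeneous_def by (metis mult_zero_right)
    have "coboundary ys I i (\<lambda>l. x ^ k * c l)"
      by (rule cancel) (use Suc.prems x hom in \<open>auto simp: algebra_simps\<close>)
    then show ?case using Suc by blast
  qed
  show ?thesis
    unfolding koszul_vanishes_def
  proof (intro allI impI)
    fix c assume c: "\<forall>l. c l \<in> R" "homogeneous (length ys) i c" "\<forall>l. koszul ys c l \<in> I"
    define e where "e l = (\<Sum>j<length ys. g j * contraction j c l)" for l
    have cR: "contraction j c l \<in> R" for j l using contraction_idl[OF RI] c(1) by blast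
    have "x ^ k * c l - koszul ys e l \<in> I" for l
    proof (cases "length l = length ys")
      case True
      have "koszul ys e l = (\<Sum>j<length ys. g j * koszul ys (contraction j c) l)"
        unfolding e_def by (simp add: koszul_sum koszul_scale)
      then have "x ^ k * c l - koszul ys e l =
        (\<Sum>j<length ys. g j * (ys ! j * c l - koszul ys (contraction j c) l))"
        by (simp add: power(1) sum_distrib_right sum_distrib_left sum_subtractf algebra_simps)
      also have "\<dots> = (\<Sum>j<length ys. g j * contraction j (koszul ys c) l)"
        using contraction_homotopy[OF _ True, of _ c, symmetric] by (intro sum.cong) auto
      also have "\<dots> \<in> I"
        using c(3) by (intro idl_sum[OF I] idlD(4)[OF I] contraction_idl[OF I] power(2)) auto
      finally show ?thesis .
    next
      case False
      have "homogeneous (length ys) (i - 1) e"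
        unfolding homogeneous_def
      proof (intro allI impI)
        fix l assume "e l \<noteq> 0"
        then obtain j where "contraction j c l \<noteq> 0" unfolding e_def by (metis (no_types, lifting) mult_zero_right sum.neutral)
        then show "length l = length ys \<and> int (count_list l True) = i - 1"
          using homogeneous_contraction[OF c(2)] unfolding homogeneous_def by blast
      qed
      then have "koszul ys e l = 0" using homogeneousD[OF homogeneous_koszul] False by blast
      then show ?thesis using homogeneousD[OF c(2)] False idlD(2)[OF I] by simp
    qed
    moreover have "homogeneous (length ys) (i - 1) e"
      unfolding homogeneous_def
    proof (intro allI impI)
      fix l assume "e l \<noteq> 0"
      then obtain j where "contraction j c l \<noteq> 0" unfolding e_def by (metis (no_types, lifting) mult_zero_right sum.neutral)
      then show "length l = length ys \<and> int (count_list l True) = i - 1"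
        using homogeneous_contraction[OF c(2)] unfolding homogeneous_def by blast
    qed
    moreover have "e l \<in> R" for l unfolding e_def using cR power(2) by blast
    ultimately have "coboundary ys I i (\<lambda>l. x ^ k * c l)"
      unfolding coboundary_def by (intro bexI[of _ 1] exI[of _ e]) auto
    then show "coboundary ys I i c" using cancel_power c by blast
  qed
qed

text \<open>A regular sequence of fractions is replaced by its numerators. They lie in P because the sequence
  generates a proper ideal, and each is a nonzerodivisor modulo the preimage in R of the ideal that
  its predecessors generate.\<close>

lemma regular_sequence_contract:
  assumes reg: "regular_sequence A xs"
  obtains I r where "I 0 = {0}" "\<And>l. idl (I l)" "\<And>l. l < length xs \<Longrightarrow> r l \<in> P"
    "\<And>l. l < length xs \<Longrightarrow> r l \<in> I (Suc l)" "\<And>l. I l \<subseteq> I (Suc l)"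
    "\<And>l a. l < length xs \<Longrightarrow> a \<in> R \<Longrightarrow> r l * a \<in> I l \<Longrightarrow> a \<in> I l"
    "\<And>l a. l < length xs \<Longrightarrow> a \<in> I (Suc l) \<Longrightarrow> \<exists>s\<in>T. \<exists>b\<in>R. s * a - r l * b \<in> I l"
proof -
  interpret cring A by (rule cring_A)
  have xs: "set xs \<subseteq> carrier A" "Idl\<^bsub>A\<^esub> (set xs) \<noteq> carrier A"
    and regular: "\<And>i a. i < length xs \<Longrightarrow> a \<in> carrier A \<Longrightarrow> xs ! i \<otimes>\<^bsub>A\<^esub> a \<in> Idl\<^bsub>A\<^esub> (set (take i xs)) \<Longrightarrow>
      a \<in> Idl\<^bsub>A\<^esub> (set (take i xs))"
    using reg unfolding regular_sequence_def by blast+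
  define J where "J l = Idl\<^bsub>A\<^esub> (set (take l xs))" for l
  have J: "ideal (J l) A" for l
    unfolding J_def using xs by (intro genideal_ideal) (meson order_trans set_take_subset)
  have "\<exists>a s. xs ! l = frac a s \<and> a \<in> R \<and> s \<in> T" if "l < length xs" for l
    using xs(1) nth_mem[OF that] carrier_A_cases by (metis subsetD)
  then obtain r t where rt: "\<And>l. l < length xs \<Longrightarrow> xs ! l = frac (r l) (t l)"
    "\<And>l. l < length xs \<Longrightarrow> r l \<in> R" "\<And>l. l < length xs \<Longrightarrow> t l \<in> T" by metis
  have Jmono: "J l \<subseteq> J (Suc l)" for l
    unfolding J_def
    by (rule genideal_minimal[OF J[unfolded J_def]])
      (use genideal_self[of "set (take (Suc l) xs)"] xs set_take_subset[of "Suc l" xs]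
        set_take_subset_set_take[of l "Suc l" xs] in auto)
  have xJ: "xs ! l \<in> J (Suc l)" if "l < length xs" for l
  proof -
    have "xs ! l \<in> set (take (Suc l) xs)" using that by (simp add: take_Suc_conv_app_nth)
    then show ?thesis unfolding J_def using genideal_self[of "set (take (Suc l) xs)"] xs
        set_take_subset[of "Suc l" xs] by blast
  qed
  have Jtop: "J (length xs) \<noteq> carrier A" using xs by (simp add: J_def)
  have JP: "contract (J l) \<subseteq> P" if "l \<le> length xs" for l
  proof -
    have "J l \<subseteq> J (length xs)" using that Jmono by (rule lift_Suc_mono_le[rotated])
    then show ?thesis using contract_proper[OF J Jtop] contract_mono by blast
  qed
  have split: "\<exists>b\<in>carrier A. \<exists>j\<in>J l. z = j \<oplus>\<^bsub>A\<^esub> xs ! l \<otimes>\<^bsub>A\<^esub> b" if l: "l < length xs" and z: "z \<in> J (Suc l)" for l z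
  proof -
    have x: "xs ! l \<in> carrier A" using xs(1) nth_mem[OF l] by blast
    have "ideal (J l <+>\<^bsub>A\<^esub> PIdl\<^bsub>A\<^esub> (xs ! l)) A"
      using add_ideals[OF J cgenideal_ideal[OF x]] .
    moreover have "set (take (Suc l) xs) \<subseteq> J l <+>\<^bsub>A\<^esub> PIdl\<^bsub>A\<^esub> (xs ! l)"
    proof
      fix y assume "y \<in> set (take (Suc l) xs)"
      then have "y \<in> set (take l xs) \<or> y = xs ! l" using l by (auto simp: take_Suc_conv_app_nth)
      then show "y \<in> J l <+>\<^bsub>A\<^esub> PIdl\<^bsub>A\<^esub> (xs ! l)"
      proof
        assume y: "y \<in> set (take l xs)"
        then have "y \<in> J l" unfolding J_def using genideal_self[of "set (take l xs)"] xs
            set_take_subset[of l xs] by blast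
        moreover have "\<zero>\<^bsub>A\<^esub> \<in> PIdl\<^bsub>A\<^esub> (xs ! l)"
          using additive_subgroup.zero_closed[OF ideal.axioms(1)[OF cgenideal_ideal[OF x]]] .
        moreover have "y = y \<oplus>\<^bsub>A\<^esub> \<zero>\<^bsub>A\<^esub>" using ideal.Icarr[OF J \<open>y \<in> J l\<close>] by simp
        ultimately show ?thesis unfolding set_add_def' by blast
      next
        assume y: "y = xs ! l"
        have "\<zero>\<^bsub>A\<^esub> \<in> J l"
          using additive_subgroup.zero_closed[OF ideal.axioms(1)[OF J]] .
        moreover have "y = \<zero>\<^bsub>A\<^esub> \<oplus>\<^bsub>A\<^esub> y" using x y by simp
        ultimately show ?thesis unfolding set_add_def' using cgenideal_self[OF x] y by blast
      qed
    qed
    ultimately have "z \<in> J l <+>\<^bsub>A\<^esub> PIdl\<^bsub>A\<^esub> (xs ! l)"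
      using genideal_minimal[of "J l <+>\<^bsub>A\<^esub> PIdl\<^bsub>A\<^esub> (xs ! l)" "set (take (Suc l) xs)"] z unfolding J_def by blast
    then obtain j b where "j \<in> J l" "b \<in> carrier A" "z = j \<oplus>\<^bsub>A\<^esub> (b \<otimes>\<^bsub>A\<^esub> xs ! l)"
      unfolding set_add_def' cgenideal_def by blast
    then show ?thesis using m_comm[of b "xs ! l"] x by auto
  qed
  show ?thesis
  proof (rule that[of "\<lambda>l. contract (J l)" r])
    have "J 0 = {\<zero>\<^bsub>A\<^esub>}" unfolding J_def
      using genideal_minimal[OF zeroideal, of "{}"] additive_subgroup.zero_closed[OF ideal.axioms(1)[OF J[of 0]]]
      by (auto simp: J_def)
    then show "contract (J 0) = {0}"
      by (auto simp: contract_def zero_A frac_eq_iff)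
    show "idl (contract (J l))" for l by (rule contract_idl[OF J])
    show "contract (J l) \<subseteq> contract (J (Suc l))" for l by (rule contract_mono[OF Jmono])
    fix l assume l: "l < length xs"
    show rJ: "r l \<in> contract (J (Suc l))" using xJ[OF l] rt[OF l] frac_mem_ideal_iff[OF J] by simp
    then show "r l \<in> P" using JP[of "Suc l"] l by auto
    { fix a assume a: "a \<in> R" "r l * a \<in> contract (J l)"
      have "frac (r l * a) (t l) \<in> J l \<longleftrightarrow> r l * a \<in> contract (J l)"
        by (rule frac_mem_ideal_iff[OF J mult_mem]) (use a rt[OF l] in auto)
      then have "xs ! l \<otimes>\<^bsub>A\<^esub> frac a 1 \<in> J l" using rt[OF l] a by (simp add: mult_frac)
      then have "frac a 1 \<in> J l" using regular[OF l frac_carrier[OF a(1) T_one]] unfolding J_def by blast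
      then show "a \<in> contract (J l)" using a by (simp add: contract_def) }
    { fix a assume "a \<in> contract (J (Suc l))"
      then have a: "a \<in> R" "frac a 1 \<in> J (Suc l)" by (auto simp: contract_def)
      from split[OF l a(2)] obtain \<beta> j where \<beta>: "\<beta> \<in> carrier A" "j \<in> J l"
        "frac a 1 = j \<oplus>\<^bsub>A\<^esub> xs ! l \<otimes>\<^bsub>A\<^esub> \<beta>" by blast
      obtain b u where b: "\<beta> = frac b u" "b \<in> R" "u \<in> T" using \<beta>(1) by (rule carrier_A_cases)
      obtain c v where c: "j = frac c v" "c \<in> R" "v \<in> T"
        using ideal.Icarr[OF J \<beta>(2)] by (rule carrier_A_cases)
      have cJ: "c \<in> contract (J l)" using \<beta>(2) c frac_mem_ideal_iff[OF J] by simp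
      have R: "u \<in> R" "v \<in> R" "t l \<in> R" "r l \<in> R" using b c rt[OF l] T_mem(1) by auto
      have tu: "t l * u \<in> T" using rt[OF l] b by auto
      have "frac a 1 = frac (c * (t l * u) + (r l * b) * v) (v * (t l * u))"
        using \<beta>(3) b c rt[OF l] R tu by (simp add: mult_frac add_frac mult_mem)
      then have "a * (v * (t l * u)) = (c * (t l * u) + (r l * b) * v) * 1"
        using a b c R tu by (subst (asm) frac_eq_iff) auto
      then have "(v * (t l * u)) * a - r l * (b * v) = c * (t l * u)"
        by (simp add: algebra_simps)
      also have "\<dots> \<in> contract (J l)" by (rule idlD(5)[OF contract_idl[OF J] cJ]) (use R in auto)
      finally show "\<exists>s\<in>T. \<exists>b\<in>R. s * a - r l * b \<in> contract (J l)"
        using c(3) tu b(2) R by blast }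
  qed
qed

text \<open>Descending induction along the regular sequence: modulo all of its elements only negative degrees
  are claimed to vanish, and each element that is removed extends the range by one degree.\<close>

theorem koszul_vanishes_below_depth:
  assumes reg: "regular_sequence A xs" and ys: "set ys \<subseteq> R"
    and radical: "\<And>x. x \<in> P \<Longrightarrow> \<exists>k g. x ^ k = (\<Sum>j<length ys. g j * ys ! j) \<and> (\<forall>j. g j \<in> R)"
    and "i < int (length xs)"
  shows "koszul_vanishes ys {0} i"
proof -
  obtain I r where I: "I 0 = {0}" "\<And>l. idl (I l)" "\<And>l. l < length xs \<Longrightarrow> r l \<in> P"
    "\<And>l. l < length xs \<Longrightarrow> r l \<in> I (Suc l)" "\<And>l. I l \<subseteq> I (Suc l)"
    "\<And>l a. l < length xs \<Longrightarrow> a \<in> R \<Longrightarrow> r l * a \<in> I l \<Longrightarrow> a \<in> I l"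
    "\<And>l a. l < length xs \<Longrightarrow> a \<in> I (Suc l) \<Longrightarrow> \<exists>s\<in>T. \<exists>b\<in>R. s * a - r l * b \<in> I l"
    by (rule regular_sequence_contract[OF reg]) (rule that; assumption)
  have "koszul_vanishes ys (I l) (int m - 1)" if "l + m \<le> length xs" for l m
    using that
  proof (induction m arbitrary: l)
    case 0
    then show ?case using koszul_vanishes_negative[OF I(2)] by simp
  next
    case (Suc m)
    then have l: "l < length xs" by simp
    obtain k g where kg: "r l ^ k = (\<Sum>j<length ys. g j * ys ! j)" "\<And>j. g j \<in> R"
      using radical[OF I(3)[OF l]] by blast
    have rR: "r l \<in> R" using I(3)[OF l] idlD(1)[OF P_idl] by auto
    show ?case
    proof (rule koszul_vanishes_step[OF I(2) I(2)[of "Suc l"] ys rR I(4)[OF l] I(6)[OF l] I(5) I(7)[OF l] kg])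
      show "koszul_vanishes ys (I (Suc l)) (int (Suc m) - 1 - 1)"
        using Suc.IH[of "Suc l"] Suc.prems by simp
    qed
  qed
  from this[of 0 "nat (i + 1)"] show ?thesis
  proof (cases "i < 0")
    case True
    then show ?thesis using koszul_vanishes_negative[OF I(2)[of 0]] I(1) by simp
  qed (use assms(4) I(1) in \<open>simp add: nat_le_iff\<close>)
qed

end

section \<open>Chains of primes and algebraic dependence\<close>

lemma exists_nontrivial_relation:
  fixes M :: "'e \<Rightarrow> 'b \<Rightarrow> 'k::field"
  assumes "finite B" "finite E" "card B < card E"
  shows "\<exists>Q. (\<exists>e\<in>E. Q e \<noteq> 0) \<and> (\<forall>b\<in>B. (\<Sum>e\<in>E. Q e * M e b) = 0)"
  using assms
proof (induction B arbitrary: E M rule: finite_induct)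
  case empty
  then obtain e where "e \<in> E" by (metis card.empty card_eq_0_iff ex_in_conv less_irrefl)
  then show ?case by (intro exI[of _ "\<lambda>_. 1"]) auto
next
  case (insert b B)
  show ?case
  proof (cases "\<forall>e\<in>E. M e b = 0")
    case True
    have "card B < card E" using insert by simp
    then obtain Q where "\<exists>e\<in>E. Q e \<noteq> 0" "\<forall>b\<in>B. (\<Sum>e\<in>E. Q e * M e b) = 0"
      using insert.IH[of E M] insert.prems(1) by blast
    then show ?thesis using True by (intro exI[of _ Q]) auto
  next
    case False
    then obtain e0 where e0: "e0 \<in> E" "M e0 b \<noteq> 0" by blast
    have "card B < card (E - {e0})" using insert e0(1) by simp
    then obtain Q' where Q': "\<exists>e\<in>E - {e0}. Q' e \<noteq> 0"
      "\<forall>b'\<in>B. (\<Sum>e\<in>E - {e0}. Q' e * (M e b' - M e b / M e0 b * M e0 b')) = 0"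
      using insert.IH[of "E - {e0}" "\<lambda>e b'. M e b' - M e b / M e0 b * M e0 b'"] insert.prems(1) by auto
    define \<sigma> where "\<sigma> = (\<Sum>e\<in>E - {e0}. Q' e * M e b)"
    define Q where "Q = Q'(e0 := - \<sigma> / M e0 b)"
    have sum: "(\<Sum>e\<in>E. Q e * M e b') = - \<sigma> / M e0 b * M e0 b' + (\<Sum>e\<in>E - {e0}. Q' e * M e b')" for b'
    proof -
      have "(\<Sum>e\<in>E. Q e * M e b') = Q e0 * M e0 b' + (\<Sum>e\<in>E - {e0}. Q e * M e b')"
        using insert.prems(1) e0(1) by (rule sum.remove)
      also have "(\<Sum>e\<in>E - {e0}. Q e * M e b') = (\<Sum>e\<in>E - {e0}. Q' e * M e b')"
        by (intro sum.cong) (auto simp: Q_def)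
      finally show ?thesis by (simp add: Q_def)
    qed
    have "(\<Sum>e\<in>E. Q e * M e b') = 0" if "b' \<in> B" for b'
    proof -
      have "0 = (\<Sum>e\<in>E - {e0}. Q' e * (M e b' - M e b / M e0 b * M e0 b'))" using Q'(2) that by simp
      also have "\<dots> = (\<Sum>e\<in>E - {e0}. Q' e * M e b') - (\<Sum>e\<in>E - {e0}. Q' e * M e b * (M e0 b' / M e0 b))"
        unfolding sum_subtractf[symmetric]
        by (intro sum.cong refl) (simp add: right_diff_distrib mult.assoc)
      also have "\<dots> = (\<Sum>e\<in>E - {e0}. Q' e * M e b') - \<sigma> * (M e0 b' / M e0 b)"
        by (simp add: \<sigma>_def sum_distrib_right sum_divide_distrib)
      finally show ?thesis unfolding sum by (simp add: field_simps)
    qed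
    moreover have "(\<Sum>e\<in>E. Q e * M e b) = 0" unfolding sum using e0(2) by (simp flip: \<sigma>_def)
    moreover have "\<exists>e\<in>E. Q e \<noteq> 0" using Q'(1) by (auto simp: Q_def)
    ultimately show ?thesis by blast
  qed
qed

definition power_product :: "'r::comm_ring_1 list \<Rightarrow> nat list \<Rightarrow> 'r" where
  "power_product xs \<alpha> = (\<Prod>j<length xs. xs ! j ^ (\<alpha> ! j))"

lemma power_product_Cons: "power_product (x # xs) (n # \<alpha>) = x ^ n * power_product xs \<alpha>"
  by (simp add: power_product_def prod.lessThan_Suc_shift del: prod.lessThan_Suc)

context subdomain
begin

lemma power_product_mem: "set xs \<subseteq> R \<Longrightarrow> power_product xs \<alpha> \<in> R"
  unfolding power_product_def by (auto intro!: prod_mem power_mem)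

text \<open>Elements that separate the successive members of a chain of primes satisfy no polynomial
  relation with unit coefficients: the terms with the least exponent of the first element survive
  division by a power of it and reduction modulo the next prime, and so on along the chain.\<close>

lemma chain_no_relation:
  assumes "\<And>i. i \<le> length xs \<Longrightarrow> idl (q i)"
    and "\<And>i x y. i \<le> length xs \<Longrightarrow> x \<in> R \<Longrightarrow> y \<in> R \<Longrightarrow> x * y \<in> q i \<Longrightarrow> x \<in> q i \<or> y \<in> q i"
    and "\<And>i. i < length xs \<Longrightarrow> q i \<subseteq> q (Suc i)"
    and "\<And>i. i < length xs \<Longrightarrow> xs ! i \<in> q (Suc i) - q i"
    and "finite E" "E \<noteq> {}"
    and "\<And>\<alpha>. \<alpha> \<in> E \<Longrightarrow> length \<alpha> = length xs \<and> Q \<alpha> \<in> R \<and> (\<forall>i\<le>length xs. Q \<alpha> \<notin> q i)"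
  shows "(\<Sum>\<alpha>\<in>E. Q \<alpha> * power_product xs \<alpha>) \<notin> q 0"
  using assms
proof (induction xs arbitrary: q E Q)
  case Nil
  then have "E = {[]}" by auto
  then show ?case using Nil.prems(7)[of "[]"] by (simp add: power_product_def)
next
  case (Cons x xs)
  have R: "set (x # xs) \<subseteq> R"
  proof
    fix z assume "z \<in> set (x # xs)"
    then obtain i where "i < length (x # xs)" "z = (x # xs) ! i" by (metis in_set_conv_nth)
    then show "z \<in> R" using Cons.prems(4)[of i] idlD(1)[OF Cons.prems(1)[of "Suc i"]] by auto
  qed
  have x: "x \<in> q 1" "x \<notin> q 0" "x \<in> R" using Cons.prems(4)[of 0] R by auto
  define n where "n = Min (hd ` E)"
  define E0 where "E0 = {\<alpha> \<in> E. hd \<alpha> = n}"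
  define E1 where "E1 = tl ` E0"
  have nonempty: "\<alpha> = hd \<alpha> # tl \<alpha>" if "\<alpha> \<in> E" for \<alpha>
    using Cons.prems(7)[OF that] by (cases \<alpha>) auto
  have "n \<in> hd ` E" unfolding n_def using Cons.prems(5,6) by (intro Min_in) auto
  then have "E0 \<noteq> {}" by (auto simp: E0_def)
  have le: "n \<le> hd \<alpha>" if "\<alpha> \<in> E" for \<alpha> unfolding n_def using Cons.prems(5) that by (intro Min_le) auto
  have inj: "inj_on tl E0"
    by (rule inj_onI) (metis (mono_tags, lifting) E0_def mem_Collect_eq nonempty)
  have E1D: "n # \<beta> \<in> E" if "\<beta> \<in> E1" for \<beta>
    using that nonempty by (auto simp: E1_def E0_def)
  define rest where "rest = (\<Sum>\<alpha>\<in>E - E0. Q \<alpha> * x ^ (hd \<alpha> - n - 1) * power_product xs (tl \<alpha>))"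
  define lead where "lead = (\<Sum>\<beta>\<in>E1. Q (n # \<beta>) * power_product xs \<beta>)"
  have restR: "rest \<in> R" unfolding rest_def
    using Cons.prems(7) x(3) R power_product_mem[of xs] by (intro sum_mem mult_mem power_mem) auto
  have leadR: "lead \<in> R" unfolding lead_def
    using Cons.prems(7)[OF E1D] R power_product_mem[of xs] by (intro sum_mem mult_mem) auto
  have "(\<Sum>\<alpha>\<in>E0. Q \<alpha> * power_product (x # xs) \<alpha>) = x ^ n * lead"
  proof -
    have "(\<Sum>\<alpha>\<in>E0. Q \<alpha> * power_product (x # xs) \<alpha>) =
      (\<Sum>\<alpha>\<in>E0. x ^ n * (Q (n # tl \<alpha>) * power_product xs (tl \<alpha>)))"
    proof (rule sum.cong[OF refl])
      fix \<alpha> assume "\<alpha> \<in> E0"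
      then have "\<alpha> = n # tl \<alpha>" using nonempty by (auto simp: E0_def)
      then show "Q \<alpha> * power_product (x # xs) \<alpha> = x ^ n * (Q (n # tl \<alpha>) * power_product xs (tl \<alpha>))"
        by (metis power_product_Cons mult.left_commute)
    qed
    also have "\<dots> = x ^ n * lead"
      unfolding lead_def E1_def by (simp add: sum.reindex[OF inj] sum_distrib_left)
    finally show ?thesis .
  qed
  moreover have "(\<Sum>\<alpha>\<in>E - E0. Q \<alpha> * power_product (x # xs) \<alpha>) = x ^ n * (x * rest)"
    unfolding rest_def sum_distrib_left
  proof (rule sum.cong[OF refl])
    fix \<alpha> assume \<alpha>: "\<alpha> \<in> E - E0"
    then have "n < hd \<alpha>" using le[of \<alpha>] by (auto simp: E0_def)
    then have "x ^ hd \<alpha> = x ^ n * (x * x ^ (hd \<alpha> - n - 1))"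
      by (simp flip: power_add power_Suc)
    moreover have "power_product (x # xs) \<alpha> = x ^ hd \<alpha> * power_product xs (tl \<alpha>)"
      using nonempty[of \<alpha>] \<alpha> power_product_Cons by (metis DiffD1)
    ultimately show "Q \<alpha> * power_product (x # xs) \<alpha> =
        x ^ n * (x * (Q \<alpha> * x ^ (hd \<alpha> - n - 1) * power_product xs (tl \<alpha>)))"
      by (simp add: algebra_simps)
  qed
  moreover have "(\<Sum>\<alpha>\<in>E. Q \<alpha> * power_product (x # xs) \<alpha>) =
      (\<Sum>\<alpha>\<in>E - E0. Q \<alpha> * power_product (x # xs) \<alpha>) + (\<Sum>\<alpha>\<in>E0. Q \<alpha> * power_product (x # xs) \<alpha>)"
    using Cons.prems(5) by (intro sum.subset_diff) (auto simp: E0_def)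
  ultimately have eq: "(\<Sum>\<alpha>\<in>E. Q \<alpha> * power_product (x # xs) \<alpha>) = x ^ n * (lead + x * rest)"
    by (simp add: algebra_simps)
  have "lead \<notin> q 1"
  proof -
    have "lead \<notin> q (Suc 0)" unfolding lead_def
    proof (rule Cons.IH[of "\<lambda>i. q (Suc i)" E1 "\<lambda>\<beta>. Q (n # \<beta>)"])
      show "finite E1" "E1 \<noteq> {}" using Cons.prems(5) \<open>E0 \<noteq> {}\<close> by (auto simp: E1_def E0_def)
      show "length \<beta> = length xs \<and> Q (n # \<beta>) \<in> R \<and> (\<forall>i\<le>length xs. Q (n # \<beta>) \<notin> q (Suc i))"
        if "\<beta> \<in> E1" for \<beta> using Cons.prems(7)[OF E1D[OF that]] by auto
      show "idl (q (Suc i))" if "i \<le> length xs" for i using Cons.prems(1) that by simp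
      show "y \<in> q (Suc i) \<or> z \<in> q (Suc i)"
        if "i \<le> length xs" "y \<in> R" "z \<in> R" "y * z \<in> q (Suc i)" for i y z
        using Cons.prems(2)[of "Suc i" y z] that by simp
      show "q (Suc i) \<subseteq> q (Suc (Suc i))" if "i < length xs" for i using Cons.prems(3)[of "Suc i"] that by simp
      show "xs ! i \<in> q (Suc (Suc i)) - q (Suc i)" if "i < length xs" for i
        using Cons.prems(4)[of "Suc i"] that by simp
    qed
    then show ?thesis by simp
  qed
  show ?case
  proof
    assume "(\<Sum>\<alpha>\<in>E. Q \<alpha> * power_product (x # xs) \<alpha>) \<in> q 0"
    then have mem: "x ^ n * (lead + x * rest) \<in> q 0" using eq by simp
    have q0: "idl (q 0)" using Cons.prems(1)[of 0] by simp
    have q1: "idl (q 1)" using Cons.prems(1)[of 1] by simp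
    have inR: "lead + x * rest \<in> R" using leadR restR x(3) by auto
    have "lead + x * rest \<in> q 0" using mem
    proof (induction n)
      case (Suc n)
      have "x * (x ^ n * (lead + x * rest)) \<in> q 0" using Suc.prems by (simp add: mult.assoc)
      then show ?case using Cons.prems(2)[of 0 x "x ^ n * (lead + x * rest)"] Suc.IH x inR by auto
    qed simp
    then have "lead + x * rest \<in> q 1" using Cons.prems(3)[of 0] by auto
    then have "(lead + x * rest) - x * rest \<in> q 1"
      by (rule idlD(7)[OF q1]) (rule idlD(5)[OF q1 x(1) restR])
    then show False using \<open>lead \<notin> q 1\<close> by simp
  qed
qed

end

context localized_subdomain
begin

lemma krull_dim_le:
  assumes dependent: "\<And>xs. length xs = Suc D \<Longrightarrow> set xs \<subseteq> R \<Longrightarrow>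
      \<exists>E Q. finite E \<and> E \<noteq> {} \<and> (\<forall>\<alpha>\<in>E. length \<alpha> = Suc D \<and> Q \<alpha> \<in> T) \<and>
        (\<Sum>\<alpha>\<in>E. Q \<alpha> * power_product xs \<alpha>) = 0"
  shows "krull_dim A \<le> enat D"
  unfolding krull_dim_def
proof (rule Sup_least, safe)
  fix n c assume c: "\<forall>i\<le>n. primeideal (c i) A" "\<forall>i<n. c i \<subset> c (Suc i)"
  show "enat n \<le> enat D"
  proof (rule ccontr)
    assume "\<not> enat n \<le> enat D"
    then have n: "Suc D \<le> n" by simp
    define q where "q i = contract (c i)" for i
    have q: "idl (q i)" "q i \<subseteq> P" "\<And>x y. x \<in> R \<Longrightarrow> y \<in> R \<Longrightarrow> x * y \<in> q i \<Longrightarrow> x \<in> q i \<or> y \<in> q i"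
      if "i \<le> n" for i
      using contract_prime[of "c i"] c(1) that unfolding q_def by blast+
    have strict: "q i \<subseteq> q (Suc i)" "\<exists>x. x \<in> q (Suc i) - q i" if "i < n" for i
    proof -
      have ideals: "ideal (c i) A" "ideal (c (Suc i)) A"
        using c(1) that by (simp_all add: primeideal.axioms(1))
      show "q i \<subseteq> q (Suc i)" unfolding q_def using c(2) that by (intro contract_mono) auto
      moreover have "q i \<noteq> q (Suc i)" unfolding q_def using ideal_A_eqI[OF ideals] c(2) that by blast
      ultimately show "\<exists>x. x \<in> q (Suc i) - q i" by blast
    qed
    obtain x where x: "\<And>i. i < n \<Longrightarrow> x i \<in> q (Suc i) - q i" using strict(2) by metis
    define xs where "xs = map x [0..<Suc D]"
    have len: "length xs = Suc D" by (simp add: xs_def)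
    have nth: "xs ! i = x i" if "i < Suc D" for i using that unfolding xs_def by (simp del: upt_Suc)
    have xsR: "set xs \<subseteq> R"
    proof
      fix z assume "z \<in> set xs"
      then obtain i where "i < Suc D" "z = x i" using nth len by (metis in_set_conv_nth)
      then show "z \<in> R" using x[of i] idlD(1)[OF q(1)[of "Suc i"]] n by auto
    qed
    obtain E Q where E: "finite E" "E \<noteq> {}" "\<And>\<alpha>. \<alpha> \<in> E \<Longrightarrow> length \<alpha> = Suc D \<and> Q \<alpha> \<in> T"
      "(\<Sum>\<alpha>\<in>E. Q \<alpha> * power_product xs \<alpha>) = 0" using dependent[OF len xsR] by blast
    have "(\<Sum>\<alpha>\<in>E. Q \<alpha> * power_product xs \<alpha>) \<notin> q 0"
    proof (rule chain_no_relation[of xs q E Q])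
      show "idl (q i)" if "i \<le> length xs" for i using q(1) that len n by simp
      show "y \<in> q i \<or> z \<in> q i" if "i \<le> length xs" "y \<in> R" "z \<in> R" "y * z \<in> q i" for i y z
        using q(3)[of i y z] that len n by simp
      show "q i \<subseteq> q (Suc i)" if "i < length xs" for i using strict(1) that len n by simp
      show "xs ! i \<in> q (Suc i) - q i" if "i < length xs" for i using x[of i] nth[of i] that len n by simp
      show "length \<alpha> = length xs \<and> Q \<alpha> \<in> R \<and> (\<forall>i\<le>length xs. Q \<alpha> \<notin> q i)" if "\<alpha> \<in> E" for \<alpha>
      proof -
        have "Q \<alpha> \<notin> q i" if "i \<le> length xs" for i
          using q(2)[of i] E(3)[OF \<open>\<alpha> \<in> E\<close>] T_mem(2) that len n by auto
        then show ?thesis using E(3)[OF that] T_mem(1) len by auto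
      qed
    qed (use E in auto)
    then show False using E(4) idlD(2)[OF q(1)[of 0]] by simp
  qed
qed

lemma krull_dim_ge:
  assumes p: "\<And>i. i \<le> n \<Longrightarrow> idl (p i)" "\<And>i. i \<le> n \<Longrightarrow> p i \<subseteq> P"
    "\<And>i x y. i \<le> n \<Longrightarrow> x \<in> R \<Longrightarrow> y \<in> R \<Longrightarrow> x * y \<in> p i \<Longrightarrow> x \<in> p i \<or> y \<in> p i"
    "\<And>i. i < n \<Longrightarrow> p i \<subset> p (Suc i)"
  shows "enat n \<le> krull_dim A"
  unfolding krull_dim_def
proof (rule Sup_upper, rule CollectI, intro exI conjI)
  show "enat n = enat n" ..
  show "\<forall>i\<le>n. primeideal (extend (p i)) A"
    using extend_prime(1) p by blast
  show "\<forall>i<n. extend (p i) \<subset> extend (p (Suc i))"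
  proof (intro allI impI)
    fix i assume i: "i < n"
    have "extend (p i) \<subseteq> extend (p (Suc i))" using p(4)[OF i] by (auto simp: extend_def)
    moreover have "contract (extend (p i)) = p i" "contract (extend (p (Suc i))) = p (Suc i)"
      using extend_prime(2)[OF p(1,2)] p(3) i by simp_all
    ultimately show "extend (p i) \<subset> extend (p (Suc i))" using p(4)[OF i] by (metis psubsetE psubsetI subset_refl)
  qed
qed

end

section \<open>Semigroup algebras\<close>

definition semigroup_algebra :: "(int ^ 'd) set \<Rightarrow> ((int ^ 'd) \<Rightarrow>\<^sub>0 'k::field) set" where
  "semigroup_algebra S = {p. keys p \<subseteq> S}"

abbreviation mon :: "int ^ 'd \<Rightarrow> (int ^ 'd) \<Rightarrow>\<^sub>0 'k::field" where
  "mon v \<equiv> single v 1"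

abbreviation const :: "'k \<Rightarrow> (int ^ 'd) \<Rightarrow>\<^sub>0 'k::field" where
  "const c \<equiv> single 0 c"

lemma semigroup_ring_eq: "semigroup_ring K S = ring_on (semigroup_algebra S)"
  by (simp add: semigroup_ring_def ring_on_def semigroup_algebra_def)

lemma semigroup_algebraI: "(\<And>v. lookup p v \<noteq> 0 \<Longrightarrow> v \<in> S) \<Longrightarrow> p \<in> semigroup_algebra S"
  by (auto simp: semigroup_algebra_def lookup_not_eq_zero_eq_in_keys)

lemma semigroup_algebra_lookup:
  "p \<in> semigroup_algebra S \<Longrightarrow> v \<notin> S \<Longrightarrow> lookup p v = 0"
  by (auto simp: semigroup_algebra_def not_in_keys_iff_lookup_eq_zero[symmetric])

lemma single_mem_semigroup_algebra: "v \<in> S \<Longrightarrow> single v c \<in> semigroup_algebra S"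
  by (auto simp: semigroup_algebra_def split: if_splits)

text \<open>All exponent pairs that compete with one in X and Y are confined to X and Y, so that an extreme pair
  there contributes a term of the product that cannot cancel.\<close>

lemma lookup_mult_nonzero:
  fixes f g :: "(int ^ 'd) \<Rightarrow>\<^sub>0 'k::field" and \<phi> :: "int ^ 'd \<Rightarrow> int"
  assumes X: "X \<subseteq> keys f" "X \<noteq> {}" and Y: "Y \<subseteq> keys g" "Y \<noteq> {}"
    and additive: "\<And>u v. \<phi> (u + v) = \<phi> u + \<phi> v"
    and face: "\<And>u v x y. u \<in> keys f \<Longrightarrow> v \<in> keys g \<Longrightarrow> x \<in> X \<Longrightarrow> y \<in> Y \<Longrightarrow>
      u + v = x + y \<Longrightarrow> u \<in> X \<and> v \<in> Y"
  obtains x y where "x \<in> X" "y \<in> Y" "lookup (f * g) (x + y) \<noteq> 0"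
    "\<And>x'. x' \<in> X \<Longrightarrow> \<phi> x' \<le> \<phi> x" "\<And>y'. y' \<in> Y \<Longrightarrow> \<phi> y' \<le> \<phi> y"
proof -
  have fin: "finite X" "finite Y" using X Y by (auto intro: finite_subset)
  obtain x y where xy: "x \<in> X" "y \<in> Y" "\<forall>x'\<in>X. \<phi> x' \<le> \<phi> x" "\<forall>y'\<in>Y. \<phi> y' \<le> \<phi> y"
    and unique: "\<forall>x'\<in>X. \<forall>y'\<in>Y. x' + y' = x + y \<longrightarrow> x' = x \<and> y' = y"
    using exists_unique_sum[OF fin(1) X(2) fin(2) Y(2) additive] by blast
  have "lookup (f * g) (x + y) = lookup f x * lookup g y"
    by (rule lookup_mult_unique_pair) (use face[OF _ _ xy(1,2)] unique in blast)
  also have "\<dots> \<noteq> 0" using xy X Y by (auto simp: lookup_not_eq_zero_eq_in_keys)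
  finally show ?thesis using that[OF xy(1,2)] xy(3,4) by blast
qed

lemma laurent_no_zero_divisors:
  fixes f g :: "(int ^ 'd) \<Rightarrow>\<^sub>0 'k::field"
  assumes "f * g = 0" shows "f = 0 \<or> g = 0"
proof (rule ccontr)
  assume "\<not> ?thesis"
  then have ne: "keys f \<noteq> {}" "keys g \<noteq> {}" by auto
  obtain x y where "lookup (f * g) (x + y) \<noteq> 0"
    by (rule lookup_mult_nonzero[OF order_refl ne(1) order_refl ne(2), of "\<lambda>_. 0"]) auto
  then show False using assms by simp
qed

lemma subdomain_semigroup_algebra:
  assumes "0 \<in> S" "\<And>s t. s \<in> S \<Longrightarrow> t \<in> S \<Longrightarrow> s + t \<in> S"
  shows "subdomain (semigroup_algebra S :: ((int ^ 'd) \<Rightarrow>\<^sub>0 'k::field) set)"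
proof
  fix x y :: "(int ^ 'd) \<Rightarrow>\<^sub>0 'k"
  assume xy: "x \<in> semigroup_algebra S" "y \<in> semigroup_algebra S"
  show "x + y \<in> semigroup_algebra S"
    using xy Poly_Mapping.keys_add[of x y] by (auto simp: semigroup_algebra_def)
  show "x * y \<in> semigroup_algebra S"
    using xy assms(2) keys_mult[of x y] by (fastforce simp: semigroup_algebra_def)
  show "- x \<in> semigroup_algebra S"
    using xy by (intro semigroup_algebraI) (metis lookup_uminus neg_equal_0_iff_equal semigroup_algebra_lookup)
  show "x = 0 \<or> y = 0" if "x * y = 0" using laurent_no_zero_divisors[OF that] .
qed (use assms in \<open>auto simp: semigroup_algebra_def\<close>)

lemma const_inverse: "c \<noteq> 0 \<Longrightarrow> const (inverse c) * const c = 1"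
  by (simp add: mult_single)

lemma mon_mult: "mon u * mon v = mon (u + v)"
  by (simp add: mult_single)

section \<open>Simplicial affine semigroups\<close>

locale simplicial_semigroup =
  fixes S G :: "(int ^ 'd) set" and a :: "'d \<Rightarrow> int ^ 'd"
  assumes simplicial: "simplicial_affine_semigroup S G a"
begin

lemma nonneg: "s \<in> S \<Longrightarrow> 0 \<le> s $ i"
  and finite_G: "finite G"
  and S_eq: "S = generated_semigroup G"
  and G_minimal: "H \<subset> G \<Longrightarrow> generated_semigroup H \<noteq> S"
  and a_G: "a i \<in> G"
  and a_independent: "(\<Sum>i\<in>UNIV. c i *s rat_vec (a i)) = 0 \<Longrightarrow> c i = 0"
  and in_cone: "s \<in> S \<Longrightarrow> \<exists>c. (\<forall>i. 0 \<le> c i) \<and> rat_vec s = (\<Sum>i\<in>UNIV. c i *s rat_vec (a i))"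
  using simplicial unfolding simplicial_affine_semigroup_def by blast+

lemma generated_S: "(\<Sum>g\<in>G. int (c g) *s g) \<in> S"
  by (auto simp: S_eq generated_semigroup_def)

lemma zero_S [simp, intro]: "0 \<in> S"
  using generated_S[of "\<lambda>_. 0"] by simp

lemma add_S [intro]: "s + t \<in> S" if st: "s \<in> S" "t \<in> S"
proof -
  obtain c e where "s = (\<Sum>g\<in>G. int (c g) *s g)" "t = (\<Sum>g\<in>G. int (e g) *s g)"
    using st S_eq unfolding generated_semigroup_def by blast
  then have "s + t = (\<Sum>g\<in>G. int (c g + e g) *s g)"
    by (simp add: sum.distrib vector_sadd_rdistrib)
  then show ?thesis using generated_S[of "\<lambda>g. c g + e g"] by simp
qed

lemma G_S: "g \<in> G \<Longrightarrow> g \<in> S"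
proof -
  assume g: "g \<in> G"
  have "(\<Sum>h\<in>G. int (if h = g then 1 else 0) *s h) = (\<Sum>h\<in>G. if h = g then h else 0)"
    by (intro sum.cong) auto
  also have "\<dots> = g" using g finite_G by simp
  finally show ?thesis using generated_S[of "\<lambda>h. if h = g then 1 else 0"] by simp
qed

lemma a_S [simp, intro]: "a i \<in> S"
  using a_G G_S by blast

lemma scale_S [intro]: "s \<in> S \<Longrightarrow> int n *s s \<in> S"
  by (induction n) (auto simp: vector_sadd_rdistrib)

lemma sum_S [intro]: "(\<And>i. i \<in> I \<Longrightarrow> f i \<in> S) \<Longrightarrow> sum f I \<in> S"
  by (induction I rule: infinite_finite_induct) auto

definition acomb :: "('d \<Rightarrow> nat) \<Rightarrow> int ^ 'd" where
  "acomb n = (\<Sum>i\<in>UNIV. int (n i) *s a i)"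

lemma acomb_S [simp, intro]: "acomb n \<in> S"
  unfolding acomb_def by blast

lemma acomb_add: "acomb n + acomb m = acomb (\<lambda>i. n i + m i)"
  by (simp add: acomb_def sum.distrib vector_sadd_rdistrib)

lemma acomb_zero [simp]: "acomb (\<lambda>_. 0) = 0"
  by (simp add: acomb_def)

lemma acomb_single: "acomb (\<lambda>j. if j = i then n else 0) = int n *s a i"
proof -
  have "acomb (\<lambda>j. if j = i then n else 0) = (\<Sum>j\<in>UNIV. if j = i then int n *s a j else 0)"
    unfolding acomb_def by (intro sum.cong) auto
  then show ?thesis by simp
qed

lemma scale_acomb: "int m *s acomb n = acomb (\<lambda>i. m * n i)"
  unfolding acomb_def by (induction m) (simp_all add: vector_sadd_rdistrib sum.distrib)

lemma acomb_split: "acomb n = acomb (n(i := 0)) + int (n i) *s a i"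
  unfolding acomb_single[symmetric] acomb_add
  by (rule arg_cong[of _ _ acomb]) (auto simp: fun_eq_iff)

definition coords :: "int ^ 'd \<Rightarrow> 'd \<Rightarrow> rat" where
  "coords s = (THE c. rat_vec s = (\<Sum>i\<in>UNIV. c i *s rat_vec (a i)))"

lemma coords_unique:
  assumes "(\<Sum>i\<in>UNIV. c i *s rat_vec (a i)) = (\<Sum>i\<in>UNIV. e i *s rat_vec (a i))"
  shows "c = e"
proof -
  have "(\<Sum>i\<in>UNIV. (c i - e i) *s rat_vec (a i)) =
    (\<Sum>i\<in>UNIV. c i *s rat_vec (a i)) - (\<Sum>i\<in>UNIV. e i *s rat_vec (a i))"
    by (simp add: sum_subtractf vector_sub_rdistrib)
  then show ?thesis using a_independent[of "\<lambda>i. c i - e i"] assms by auto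
qed

lemma coords_eqI: "rat_vec s = (\<Sum>i\<in>UNIV. c i *s rat_vec (a i)) \<Longrightarrow> coords s = c"
  unfolding coords_def by (rule the_equality) (auto intro: coords_unique)

lemma coords_S:
  assumes "s \<in> S"
  shows "rat_vec s = (\<Sum>i\<in>UNIV. coords s i *s rat_vec (a i))" "0 \<le> coords s i"
proof -
  obtain c where c: "\<forall>i. 0 \<le> c i" "rat_vec s = (\<Sum>i\<in>UNIV. c i *s rat_vec (a i))"
    using in_cone[OF assms] by blast
  then have "coords s = c" by (intro coords_eqI)
  then show "rat_vec s = (\<Sum>i\<in>UNIV. coords s i *s rat_vec (a i))" "0 \<le> coords s i" using c by auto
qed

lemma rat_vec_add: "rat_vec (u + v) = rat_vec u + rat_vec v"
  by (simp add: rat_vec_def vec_eq_iff)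

lemma rat_vec_scale: "rat_vec (k *s v) = of_int k *s rat_vec v"
  by (simp add: rat_vec_def vec_eq_iff)

lemma rat_vec_sum: "rat_vec (sum f I) = (\<Sum>i\<in>I. rat_vec (f i))"
  by (induction I rule: infinite_finite_induct) (auto simp: rat_vec_add, auto simp: rat_vec_def vec_eq_iff)

lemma rat_vec_inject: "rat_vec u = rat_vec v \<longleftrightarrow> u = v"
  by (simp add: rat_vec_def vec_eq_iff)

lemma coords_add: "s \<in> S \<Longrightarrow> t \<in> S \<Longrightarrow> coords (s + t) i = coords s i + coords t i"
proof -
  assume st: "s \<in> S" "t \<in> S"
  have "coords (s + t) = (\<lambda>i. coords s i + coords t i)"
    by (rule coords_eqI)
      (simp add: rat_vec_add coords_S(1)[OF st(1), symmetric] coords_S(1)[OF st(2), symmetric]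
        vector_sadd_rdistrib sum.distrib)
  then show ?thesis by simp
qed

lemma coords_acomb [simp]: "coords (acomb n) i = of_nat (n i)"
proof -
  have "coords (acomb n) = (\<lambda>i. of_nat (n i))"
    by (rule coords_eqI) (simp add: acomb_def rat_vec_sum rat_vec_scale)
  then show ?thesis by simp
qed

lemma coords_scale_a: "coords (int n *s a i) j = (if j = i then of_nat n else 0)"
  unfolding acomb_single[symmetric] coords_acomb by simp

lemma coords_ge:
  assumes "s - int n *s a i \<in> S" shows "of_nat n \<le> coords s i"
  using coords_add[OF assms scale_S[OF a_S], of n i i] coords_S(2)[OF assms, of i]
  by (simp add: coords_scale_a)

lemma coords_zero_imp:
  assumes "s \<in> S" "\<And>i. coords s i = 0" shows "s = 0"
  using coords_S(1)[OF assms(1)] rat_vec_inject[of s 0] assms(2) by (simp add: rat_vec_def vec_eq_iff)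

lemma common_denominator:
  fixes c :: "'d \<Rightarrow> rat"
  assumes "\<And>i. 0 \<le> c i"
  shows "\<exists>N>0. \<exists>n. \<forall>i. of_nat N * c i = of_nat (n i)"
proof -
  have "\<exists>k>0. \<exists>m. of_nat k * c i = of_nat m" for i
  proof -
    obtain p q where pq: "quotient_of (c i) = (p, q)" by fastforce
    then have q: "q > 0" "c i = of_int p / of_int q"
      using quotient_of_denom_pos quotient_of_div by auto
    then have "0 \<le> p" using assms[of i] by (simp add: zero_le_divide_iff)
    then show ?thesis using q by (intro exI[of _ "nat q"] conjI exI[of _ "nat p"]) auto
  qed
  then obtain k m where km: "\<And>i. k i > 0" "\<And>i. of_nat (k i) * c i = of_nat (m i)" by metis
  have "of_nat (\<Prod>i\<in>UNIV. k i) * c j = of_nat (m j * (\<Prod>i\<in>UNIV - {j}. k i))" for j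
    using km(2)[of j] by (subst prod.remove[of _ j]) (auto simp: algebra_simps)
  moreover have "(\<Prod>i\<in>UNIV. k i) > 0" using km(1) by (simp add: prod_pos)
  ultimately show ?thesis
    by (intro exI[of _ "\<Prod>i\<in>UNIV. k i"] conjI exI[of _ "\<lambda>j. m j * (\<Prod>i\<in>UNIV - {j}. k i)"] allI)
qed

lemma multiple_acomb:
  assumes "s \<in> S"
  obtains N n where "N > 0" "int N *s s = acomb n" "\<And>i. of_nat N * coords s i = of_nat (n i)"
proof -
  obtain N n where N: "N > 0" "\<And>i. of_nat N * coords s i = of_nat (n i)"
    using common_denominator[of "coords s"] coords_S(2)[OF assms] by blast
  have "rat_vec (int N *s s) = rat_vec (acomb n)"
    unfolding rat_vec_scale acomb_def rat_vec_sum coords_S(1)[OF assms]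
    by (simp add: N(2)[symmetric] vec_eq_iff sum_distrib_left mult.assoc)
  then show ?thesis using that N rat_vec_inject by blast
qed

definition total_degree :: "int ^ 'd \<Rightarrow> int" where
  "total_degree v = (\<Sum>i\<in>UNIV. v $ i)"

lemma total_degree_add: "total_degree (u + v) = total_degree u + total_degree v"
  and total_degree_diff: "total_degree (u - v) = total_degree u - total_degree v"
  and total_degree_scale: "total_degree (k *s v) = k * total_degree v"
  and total_degree_zero [simp]: "total_degree 0 = 0"
  by (simp_all add: total_degree_def sum.distrib sum_subtractf sum_distrib_left)

lemma total_degree_nonneg: "s \<in> S \<Longrightarrow> 0 \<le> total_degree s"
  unfolding total_degree_def by (intro sum_nonneg nonneg)

lemma total_degree_pos: "s \<in> S \<Longrightarrow> s \<noteq> 0 \<Longrightarrow> 0 < total_degree s"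
proof -
  assume s: "s \<in> S" "s \<noteq> 0"
  then obtain i where "s $ i \<noteq> 0" by (auto simp: vec_eq_iff)
  then have "0 < s $ i" using nonneg[OF s(1), of i] by simp
  then show ?thesis unfolding total_degree_def using nonneg[OF s(1)] by (intro sum_pos2[of _ i]) auto
qed

lemma S_antisym: "s \<in> S \<Longrightarrow> - s \<in> S \<Longrightarrow> s = 0"
  using total_degree_pos[of s] total_degree_nonneg[of "- s"] total_degree_diff[of 0 s] by force

lemma a_nonzero: "a i \<noteq> 0"
  using coords_scale_a[of 1 i i] coords_scale_a[of 0 i i] by auto

lemma zero_not_G: "0 \<notin> G"
proof
  assume "0 \<in> G"
  then have "generated_semigroup (G - {0}) \<noteq> S" by (intro G_minimal) auto
  moreover have "(\<Sum>g\<in>G - {0}. int (c g) *s g) = (\<Sum>g\<in>G. int (c g) *s g)" for c :: "int ^ 'd \<Rightarrow> nat"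
    using finite_G by (intro sum.mono_neutral_left) auto
  ultimately show False unfolding S_eq generated_semigroup_def by simp
qed

text \<open>Every generator has a multiple from which a prescribed multiple of some extremal ray can be
  subtracted, so only boundedly many copies of it occur in a reduced element.\<close>

lemma finite_reduced:
  fixes \<tau> :: "'d \<Rightarrow> nat"
  shows "finite {s \<in> S. \<forall>i. s - int (\<tau> i) *s a i \<notin> S}"
proof -
  have "\<exists>M i. int M *s g - int (\<tau> i) *s a i \<in> S" if g: "g \<in> G" for g
  proof -
    have gS: "g \<in> S" "g \<noteq> 0" using g G_S zero_not_G by auto
    obtain N n where N: "N > 0" "int N *s g = acomb n" "\<And>i. of_nat N * coords g i = of_nat (n i)"
      using multiple_acomb[OF gS(1)] by blast
    obtain i where "coords g i \<noteq> 0" using coords_zero_imp[OF gS(1)] gS(2) by blast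
    then have i: "n i > 0" using N(1) N(3)[of i] by (auto intro!: gr0I)
    have "int (\<tau> i * N) *s g = acomb (\<lambda>j. \<tau> i * n j)"
      using N(2) scale_acomb[of "\<tau> i" n] by (simp flip: vector_smult_assoc)
    also have "\<dots> = acomb (\<lambda>j. \<tau> i * n j - (if j = i then \<tau> i else 0)) + acomb (\<lambda>j. if j = i then \<tau> i else 0)"
      unfolding acomb_add using i by (intro arg_cong[of _ _ acomb]) auto
    finally have "int (\<tau> i * N) *s g - int (\<tau> i) *s a i = acomb (\<lambda>j. \<tau> i * n j - (if j = i then \<tau> i else 0))"
      unfolding acomb_single by simp
    then show ?thesis by (intro exI[of _ "\<tau> i * N"] exI[of _ i]) simp
  qed
  then obtain M \<iota> where M: "\<And>g. g \<in> G \<Longrightarrow> int (M g) *s g - int (\<tau> (\<iota> g)) *s a (\<iota> g) \<in> S" by metis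
  define F where "F = (\<lambda>c. \<Sum>g\<in>G. int (c g) *s g) ` (PiE G (\<lambda>g. {..<M g}))"
  have "finite F" unfolding F_def using finite_G by (intro finite_imageI finite_PiE) auto
  moreover have "{s \<in> S. \<forall>i. s - int (\<tau> i) *s a i \<notin> S} \<subseteq> F"
  proof
    fix s assume s: "s \<in> {s \<in> S. \<forall>i. s - int (\<tau> i) *s a i \<notin> S}"
    then obtain c where c: "s = (\<Sum>g\<in>G. int (c g) *s g)"
      using S_eq unfolding generated_semigroup_def by auto
    have "c g < M g" if g: "g \<in> G" for g
    proof (rule ccontr)
      assume "\<not> c g < M g"
      then have eq: "int (c g) *s g = int (M g) *s g + int (c g - M g) *s g"
        by (simp flip: vector_sadd_rdistrib)
      have "s = int (c g) *s g + (\<Sum>h\<in>G - {g}. int (c h) *s h)"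
        unfolding c using finite_G g by (rule sum.remove)
      then have "s - int (\<tau> (\<iota> g)) *s a (\<iota> g) = (int (M g) *s g - int (\<tau> (\<iota> g)) *s a (\<iota> g)) +
          (int (c g - M g) *s g + (\<Sum>h\<in>G - {g}. int (c h) *s h))"
        unfolding eq by (simp add: algebra_simps)
      also have "\<dots> \<in> S" using M[OF g] G_S g by (intro add_S scale_S sum_S) auto
      finally show False using s by blast
    qed
    moreover have "s = (\<Sum>g\<in>G. int (restrict c G g) *s g)" unfolding c by (intro sum.cong) auto
    ultimately show "s \<in> F" unfolding F_def by (intro image_eqI[of _ _ "restrict c G"]) auto
  qed
  ultimately show ?thesis by (rule finite_subset[rotated])
qed

end

section \<open>The dimension of the semigroup ring\<close>

context simplicial_semigroup
begin

lemma subdomain_S: "subdomain (semigroup_algebra S :: ((int ^ 'd) \<Rightarrow>\<^sub>0 'k::field) set)"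
  by (rule subdomain_semigroup_algebra) auto

text \<open>Counting: d + 1 elements have more power products of bounded exponent than there are monomials
  in the box that contains all of them.\<close>

lemma monomials_dependent:
  fixes xs :: "((int ^ 'd) \<Rightarrow>\<^sub>0 'k::field) list"
  assumes len: "length xs = Suc CARD('d)" and xs: "set xs \<subseteq> semigroup_algebra S"
  shows "\<exists>E Q. finite E \<and> E \<noteq> {} \<and> (\<forall>\<alpha>\<in>E. length \<alpha> = Suc CARD('d) \<and> Q \<alpha> \<noteq> 0) \<and>
    (\<Sum>\<alpha>\<in>E. const (Q \<alpha>) * power_product xs \<alpha>) = 0"
proof -
  let ?D = "CARD('d)"
  define box :: "nat \<Rightarrow> (int ^ 'd) set" where "box L = {v. \<forall>i. 0 \<le> v $ i \<and> v $ i \<le> int L}" for L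
  have box_mono: "box L \<subseteq> box L'" if "L \<le> L'" for L L'
  proof
    fix v assume v: "v \<in> box L"
    have "v $ i \<le> int L'" for i
    proof -
      have "v $ i \<le> int L" using v by (simp add: box_def)
      then show ?thesis using that by linarith
    qed
    then show "v \<in> box L'" using v by (simp add: box_def)
  qed
  have box_mult: "keys (f * g) \<subseteq> box (m + n)"
    if "keys f \<subseteq> box m" "keys g \<subseteq> box n" for f g :: "(int ^ 'd) \<Rightarrow>\<^sub>0 'k" and m n
  proof
    fix w assume "w \<in> keys (f * g)"
    then obtain u v where w: "w = u + v" "u \<in> keys f" "v \<in> keys g"
      using keys_mult[of f g] by blast
    then have "u \<in> box m" "v \<in> box n" using that by auto
    then show "w \<in> box (m + n)" unfolding w(1) box_def by (auto intro: add_mono add_nonneg_nonneg)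
  qed
  have box_card: "finite (box L) \<and> card (box L) \<le> (L + 1) ^ ?D" for L
  proof -
    let ?F = "PiE (UNIV :: 'd set) (\<lambda>_. {0..int L})"
    have sub: "box L \<subseteq> vec_lambda ` ?F"
    proof
      fix v assume "v \<in> box L"
      then have "(\<lambda>i. v $ i) \<in> ?F" by (auto simp: box_def)
      then show "v \<in> vec_lambda ` ?F" by (rule image_eqI[rotated]) simp
    qed
    have fin: "finite ?F" by (intro finite_PiE) auto
    have "card (box L) \<le> card (vec_lambda ` ?F)" using sub fin by (intro card_mono) auto
    also have "\<dots> \<le> card ?F" by (rule card_image_le[OF fin])
    also have "\<dots> = (L + 1) ^ ?D" by (simp add: card_PiE nat_add_distrib)
    finally show ?thesis using finite_subset[OF sub] fin by auto
  qed
  define K where "K = (\<Union>x\<in>set xs. keys x)"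
  have "finite ((\<lambda>(v, i). nat (v $ i)) ` (K \<times> UNIV))" by (simp add: K_def)
  then obtain C where "\<forall>n\<in>(\<lambda>(v, i). nat (v $ i)) ` (K \<times> UNIV). n \<le> C"
    unfolding finite_nat_set_iff_bounded_le by blast
  then have C: "nat (v $ i) \<le> C" if "v \<in> K" for v i
    using that by fastforce
  have KC: "keys x \<subseteq> box C" if "x \<in> set xs" for x
  proof
    fix v assume v: "v \<in> keys x"
    then have "v \<in> S" "v \<in> K" using that xs by (auto simp: K_def semigroup_algebra_def)
    then show "v \<in> box C" using C[of v] nonneg[of v] by (auto simp: box_def nat_le_iff)
  qed
  have key_power: "keys (x ^ n) \<subseteq> box (C * n)" if "keys x \<subseteq> box C"
    for x :: "(int ^ 'd) \<Rightarrow>\<^sub>0 'k" and n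
  proof (induction n)
    case 0
    show ?case by (auto simp: box_def)
  next
    case (Suc n)
    show ?case using box_mult[OF that Suc] by simp
  qed
  have key_product: "keys (power_product zs \<alpha>) \<subseteq> box (C * sum_list \<alpha>)"
    if "length \<alpha> = length zs" "\<And>z. z \<in> set zs \<Longrightarrow> keys z \<subseteq> box C"
    for zs :: "((int ^ 'd) \<Rightarrow>\<^sub>0 'k) list" and \<alpha>
    using that
  proof (induction \<alpha> zs rule: list_induct2)
    case Nil
    show ?case by (auto simp: box_def power_product_def)
  next
    case (Cons n \<alpha> z zs)
    have "keys (z ^ n * power_product zs \<alpha>) \<subseteq> box (C * n + C * sum_list \<alpha>)"
      using Cons by (intro box_mult key_power) auto
    then show ?case by (simp add: power_product_Cons algebra_simps)
  qed
  (* This bound on the exponents gives t ^ (d + 1) power products, but their exponents lie in a box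
     with at most (t - 1) * t ^ d points. *)
  define t where "t = (C * Suc ?D + 1) ^ ?D + 1"
  define L where "L = C * (Suc ?D * t)"
  define E0 where "E0 = {\<alpha>. set \<alpha> \<subseteq> {..<t} \<and> length \<alpha> = Suc ?D}"
  have E0: "finite E0" "card E0 = t ^ Suc ?D"
    unfolding E0_def using finite_lists_length_eq[of "{..<t}"] card_lists_length_eq[of "{..<t}"] by auto
  have keyL: "keys (power_product xs \<alpha>) \<subseteq> box L" if "\<alpha> \<in> E0" for \<alpha>
  proof -
    have "sum_list \<alpha> \<le> length \<alpha> * t" if "set \<alpha> \<subseteq> {..<t}" for \<alpha>
      using that by (induction \<alpha>) auto
    then have "C * sum_list \<alpha> \<le> L" using that unfolding L_def E0_def by (metis (mono_tags, lifting) mem_Collect_eq mult_le_mono2)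
    then show ?thesis
      using key_product[of \<alpha> xs] KC that len box_mono unfolding E0_def by force
  qed
  have "card (box L) \<le> (L + 1) ^ ?D" using box_card by blast
  also have "\<dots> \<le> ((C * Suc ?D + 1) * t) ^ ?D"
    by (rule power_mono) (auto simp: L_def t_def algebra_simps)
  also have "\<dots> = (t - 1) * t ^ ?D"
  proof -
    have "(C * Suc ?D + 1) ^ ?D = t - 1" by (simp add: t_def)
    then show ?thesis by (simp only: power_mult_distrib)
  qed
  also have "\<dots> < t * t ^ ?D" by (rule mult_strict_right_mono) (auto simp: t_def)
  finally have "card (box L) < card E0" by (simp add: E0(2))
  then obtain Q where Q: "\<exists>\<alpha>\<in>E0. Q \<alpha> \<noteq> 0"
    "\<forall>v\<in>box L. (\<Sum>\<alpha>\<in>E0. Q \<alpha> * lookup (power_product xs \<alpha>) v) = 0"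
    using exists_nontrivial_relation[of "box L" E0 "\<lambda>\<alpha>. lookup (power_product xs \<alpha>)"]
      box_card E0(1) by blast
  have "(\<Sum>\<alpha>\<in>E0. const (Q \<alpha>) * power_product xs \<alpha>) = 0"
  proof (rule poly_mapping_eqI)
    fix v
    have "lookup (\<Sum>\<alpha>\<in>E0. const (Q \<alpha>) * power_product xs \<alpha>) v =
      (\<Sum>\<alpha>\<in>E0. Q \<alpha> * lookup (power_product xs \<alpha>) v)"
      by (simp add: lookup_sum lookup_single_mult)
    also have "\<dots> = 0"
    proof (cases "v \<in> box L")
      case True
      then show ?thesis using Q(2) by blast
    next
      case False
      then have "lookup (power_product xs \<alpha>) v = 0" if "\<alpha> \<in> E0" for \<alpha>
        using keyL[OF that] by (meson not_in_keys_iff_lookup_eq_zero subsetD)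
      then show ?thesis by simp
    qed
    finally show "lookup (\<Sum>\<alpha>\<in>E0. const (Q \<alpha>) * power_product xs \<alpha>) v =
      lookup 0 v" by simp
  qed
  also have "(\<Sum>\<alpha>\<in>E0. const (Q \<alpha>) * power_product xs \<alpha>) =
      (\<Sum>\<alpha>\<in>{\<alpha> \<in> E0. Q \<alpha> \<noteq> 0}. const (Q \<alpha>) * power_product xs \<alpha>)"
    using E0(1) by (intro sum.mono_neutral_right) auto
  finally have "(\<Sum>\<alpha>\<in>{\<alpha> \<in> E0. Q \<alpha> \<noteq> 0}. const (Q \<alpha>) * power_product xs \<alpha>) = 0" .
  moreover have "finite {\<alpha> \<in> E0. Q \<alpha> \<noteq> 0}" "{\<alpha> \<in> E0. Q \<alpha> \<noteq> 0} \<noteq> {}"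
    "\<forall>\<alpha>\<in>{\<alpha> \<in> E0. Q \<alpha> \<noteq> 0}. length \<alpha> = Suc ?D \<and> Q \<alpha> \<noteq> 0"
    using E0(1) Q(1) by simp (use Q(1) in \<open>auto simp: E0_def\<close>)
  ultimately show ?thesis by (intro exI[of _ "{\<alpha> \<in> E0. Q \<alpha> \<noteq> 0}"] exI[of _ Q] conjI)
qed

lemma localized_maximal:
  assumes "maximalideal P (ring_on (semigroup_algebra S :: ((int ^ 'd) \<Rightarrow>\<^sub>0 'k::field) set))"
  shows "localized_subdomain (semigroup_algebra S) P"
proof -
  interpret subdomain "semigroup_algebra S :: ((int ^ 'd) \<Rightarrow>\<^sub>0 'k) set" by (rule subdomain_S)
  show ?thesis
    by unfold_locales (use maximalideal_ring_onD[OF assms] in auto)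
qed

lemma krull_dim_localization_le:
  fixes P :: "((int ^ 'd) \<Rightarrow>\<^sub>0 'k::field) set"
  assumes "localized_subdomain (semigroup_algebra S) P"
  shows "krull_dim (localized_subdomain.A (semigroup_algebra S) P) \<le> enat CARD('d)"
proof -
  interpret localized_subdomain "semigroup_algebra S" P by (rule assms)
  have unit: "const c \<in> T" if "c \<noteq> 0" for c :: 'k
  proof -
    have R: "const c \<in> semigroup_algebra S" "const (inverse c) \<in> semigroup_algebra S"
      by (auto intro!: single_mem_semigroup_algebra)
    have "const c \<notin> P"
      using idlD(4)[OF P_idl _ R(2), of "const c"] P_one const_inverse[OF that] by metis
    then show ?thesis using R T_mem(3) by blast
  qed
  show ?thesis
  proof (rule krull_dim_le)
    fix xs :: "((int ^ 'd) \<Rightarrow>\<^sub>0 'k) list"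
    assume xs: "length xs = Suc CARD('d)" "set xs \<subseteq> semigroup_algebra S"
    obtain E Q where "finite E" "E \<noteq> {}" "\<forall>\<alpha>\<in>E. length \<alpha> = Suc CARD('d) \<and> Q \<alpha> \<noteq> 0"
      "(\<Sum>\<alpha>\<in>E. const (Q \<alpha>) * power_product xs \<alpha>) = 0"
      using monomials_dependent[OF xs] by (elim exE conjE)
    then show "\<exists>E Q. finite E \<and> E \<noteq> {} \<and> (\<forall>\<alpha>\<in>E. length \<alpha> = Suc CARD('d) \<and> Q \<alpha> \<in> T) \<and>
        (\<Sum>\<alpha>\<in>E. Q \<alpha> * power_product xs \<alpha>) = 0"
      using unit by (intro exI[of _ E] exI[of _ "\<lambda>\<alpha>. const (Q \<alpha>)"]) auto
  qed
qed

definition face :: "'d set \<Rightarrow> (int ^ 'd) set" where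
  "face F = {s \<in> S. \<forall>i. i \<notin> F \<longrightarrow> coords s i = 0}"

lemma face_add_iff: "s \<in> S \<Longrightarrow> t \<in> S \<Longrightarrow> s + t \<in> face F \<longleftrightarrow> s \<in> face F \<and> t \<in> face F"
  using coords_S(2)[of s] coords_S(2)[of t] add_S[of s t]
  by (auto simp: face_def coords_add add_nonneg_eq_0_iff)

lemma face_empty: "face {} = {0}"
  using coords_zero_imp coords_acomb[of "\<lambda>_. 0"] by (auto simp: face_def)

definition face_prime :: "'d set \<Rightarrow> ((int ^ 'd) \<Rightarrow>\<^sub>0 'k::field) set" where
  "face_prime F = {f \<in> semigroup_algebra S. \<forall>s\<in>face F. lookup f s = 0}"

text \<open>A sum of elements of S lies in a face only if both summands do. Hence restricting supports to the face
  is multiplicative, with values in a ring without zero divisors.\<close>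

lemma face_prime_prime:
  fixes F :: "'d set"
  defines "p \<equiv> face_prime F :: ((int ^ 'd) \<Rightarrow>\<^sub>0 'k::field) set"
  shows "subdomain.idl (semigroup_algebra S) p"
    "x \<in> semigroup_algebra S \<Longrightarrow> y \<in> semigroup_algebra S \<Longrightarrow> x * y \<in> p \<Longrightarrow> x \<in> p \<or> y \<in> p"
proof -
  interpret subdomain "semigroup_algebra S :: ((int ^ 'd) \<Rightarrow>\<^sub>0 'k) set" by (rule subdomain_S)
  show "idl p"
    unfolding idl_def
  proof (intro conjI ballI)
    show "p \<subseteq> semigroup_algebra S" "0 \<in> p" by (auto simp: p_def face_prime_def)
    fix x assume x: "x \<in> p"
    show "x + y \<in> p" if "y \<in> p" for y using x that by (auto simp: p_def face_prime_def lookup_add)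
    fix r :: "(int ^ 'd) \<Rightarrow>\<^sub>0 'k" assume r: "r \<in> semigroup_algebra S"
    have "lookup (r * x) s = 0" if s: "s \<in> face F" for s
    proof (rule ccontr)
      assume "lookup (r * x) s \<noteq> 0"
      then have "s \<in> keys (r * x)" by (simp add: lookup_not_eq_zero_eq_in_keys)
      then obtain u v where uv: "s = u + v" "u \<in> keys r" "v \<in> keys x"
        using keys_mult[of r x] by blast
      then have "u \<in> S" "v \<in> S" using r x by (auto simp: p_def face_prime_def semigroup_algebra_def)
      then have "v \<in> face F" using face_add_iff s uv by blast
      then show False using x uv(3) by (auto simp: p_def face_prime_def)
    qed
    then show "r * x \<in> p" using r x by (auto simp: p_def face_prime_def)
  qed
  assume x: "x \<in> semigroup_algebra S" and y: "y \<in> semigroup_algebra S" and xy: "x * y \<in> p"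
  show "x \<in> p \<or> y \<in> p"
  proof (rule ccontr)
    assume neg: "\<not> (x \<in> p \<or> y \<in> p)"
    define X where "X = keys x \<inter> face F"
    define Y where "Y = keys y \<inter> face F"
    have ne: "X \<noteq> {}" "Y \<noteq> {}"
      using neg x y by (auto simp: X_def Y_def p_def face_prime_def lookup_not_eq_zero_eq_in_keys)
    have sub: "X \<subseteq> keys x" "Y \<subseteq> keys y" by (auto simp: X_def Y_def)
    obtain u v where "u \<in> X" "v \<in> Y" "lookup (x * y) (u + v) \<noteq> 0"
    proof (rule lookup_mult_nonzero[OF sub(1) ne(1) sub(2) ne(2), of "\<lambda>_. 0"])
      fix u v u' v' assume h: "u \<in> keys x" "v \<in> keys y" "u' \<in> X" "v' \<in> Y"
        "u + v = u' + v'"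
      have "u \<in> S" "v \<in> S" using h x y by (auto simp: semigroup_algebra_def)
      moreover have "u' + v' \<in> face F"
        using h(3,4) face_add_iff[of u' v' F] by (auto simp: X_def Y_def face_def)
      ultimately have "u \<in> face F \<and> v \<in> face F" using face_add_iff[of u v F] h(5) by simp
      then show "u \<in> X \<and> v \<in> Y" using h by (auto simp: X_def Y_def)
    qed auto
    moreover have "u + v \<in> face F"
      using \<open>u \<in> X\<close> \<open>v \<in> Y\<close> face_add_iff[of u v F] by (auto simp: X_def Y_def face_def)
    ultimately show False using xy by (auto simp: p_def face_prime_def)
  qed
qed

abbreviation augmentation :: "((int ^ 'd) \<Rightarrow>\<^sub>0 'k::field) set" where
  "augmentation \<equiv> face_prime {}"

lemma augmentation_iff: "f \<in> augmentation \<longleftrightarrow> f \<in> semigroup_algebra S \<and> lookup f 0 = 0"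
  by (simp add: face_prime_def face_empty)

lemma augmentation_maximal:
  "maximalideal augmentation (ring_on (semigroup_algebra S :: ((int ^ 'd) \<Rightarrow>\<^sub>0 'k::field) set))"
proof -
  let ?P = "augmentation :: ((int ^ 'd) \<Rightarrow>\<^sub>0 'k) set"
  let ?R = "semigroup_algebra S :: ((int ^ 'd) \<Rightarrow>\<^sub>0 'k) set"
  interpret subdomain ?R by (rule subdomain_S)
  show ?thesis
  proof (rule maximalidealI)
    show "ideal ?P (ring_on ?R)" using face_prime_prime(1) ideal_ring_on_iff by blast
    have "1 \<notin> ?P" by (simp add: augmentation_iff)
    then show "carrier (ring_on ?R) \<noteq> ?P" using one_mem by auto
    fix J assume "ideal J (ring_on ?R)" and PJ: "?P \<subseteq> J"
    then have J: "idl J" by (simp add: ideal_ring_on_iff)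
    show "J = ?P \<or> J = carrier (ring_on ?R)"
    proof (cases "J \<subseteq> ?P")
      case False
      then obtain f where f: "f \<in> J" "f \<notin> ?P" by blast
      define c where "c = lookup f 0"
      have fR: "f \<in> ?R" using f idlD(1)[OF J] by auto
      have c: "c \<noteq> 0" using f fR by (simp add: augmentation_iff c_def)
      have cR: "const b \<in> ?R" for b by (auto intro: single_mem_semigroup_algebra)
      have "f - const c \<in> ?P" using fR cR by (auto simp: augmentation_iff lookup_minus c_def)
      then have "f - (f - const c) \<in> J" by (rule idlD(7)[OF J f(1) subsetD[OF PJ]])
      then have "const (inverse c) * const c \<in> J" using idlD(4)[OF J _ cR] by simp
      then have "1 \<in> J" using const_inverse[OF c] by metis
      then have "x \<in> J" if "x \<in> ?R" for x using idlD(4)[OF J, of 1 x] that by simp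
      then show ?thesis using idlD(1)[OF J] by auto
    qed (use PJ in auto)
  qed
qed

text \<open>Faces that lose one ray at a time give a chain of d + 1 primes that ends at the augmentation ideal.\<close>

lemma krull_dim_augmentation_ge:
  "enat CARD('d) \<le> krull_dim (localized_subdomain.A (semigroup_algebra S)
     (augmentation :: ((int ^ 'd) \<Rightarrow>\<^sub>0 'k::field) set))"
proof -
  interpret localized_subdomain "semigroup_algebra S :: ((int ^ 'd) \<Rightarrow>\<^sub>0 'k) set" augmentation
    by (rule localized_maximal[OF augmentation_maximal])
  obtain e :: "nat \<Rightarrow> 'd" where e: "bij_betw e {0..<CARD('d)} UNIV"
    using ex_bij_betw_nat_finite[of "UNIV :: 'd set"] by auto
  define F where "F i = e ` {i..<CARD('d)}" for i
  have mono: "face_prime F' \<subseteq> face_prime F''" if "F'' \<subseteq> F'" for F' F'' :: "'d set"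
    using that by (auto simp: face_prime_def face_def)
  show ?thesis
  proof (rule krull_dim_ge[of _ "\<lambda>i. face_prime (F i)"])
    show "idl (face_prime (F i))" for i by (rule face_prime_prime(1))
    show "face_prime (F i) \<subseteq> (augmentation :: ((int ^ 'd) \<Rightarrow>\<^sub>0 'k) set)" for i by (rule mono) simp
    show "x \<in> face_prime (F i) \<or> y \<in> face_prime (F i)"
      if "x \<in> semigroup_algebra S" "y \<in> semigroup_algebra S" "x * y \<in> face_prime (F i)"
      for i and x y :: "(int ^ 'd) \<Rightarrow>\<^sub>0 'k"
      using face_prime_prime(2) that by blast
    fix i assume i: "i < CARD('d)"
    have coord: "coords (a (e i)) j = (if j = e i then 1 else 0)" for j
      using coords_scale_a[of 1 "e i" j] by simp
    have "e i \<in> F i" using i by (auto simp: F_def)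
    then have "a (e i) \<in> face (F i)" by (auto simp: face_def coord)
    then have "mon (a (e i)) \<notin> (face_prime (F i) :: ((int ^ 'd) \<Rightarrow>\<^sub>0 'k) set)"
      by (auto simp: face_prime_def intro!: bexI[of _ "a (e i)"])
    moreover have "e i \<notin> F (Suc i)"
      using e i unfolding F_def bij_betw_def inj_on_def by fastforce
    then have "a (e i) \<notin> face (F (Suc i))" by (auto simp: face_def coord)
    then have "mon (a (e i)) \<in> (face_prime (F (Suc i)) :: ((int ^ 'd) \<Rightarrow>\<^sub>0 'k) set)"
      by (auto simp: face_prime_def lookup_single when_def intro: single_mem_semigroup_algebra)
    moreover have "face_prime (F i) \<subseteq> (face_prime (F (Suc i)) :: ((int ^ 'd) \<Rightarrow>\<^sub>0 'k) set)"
      by (rule mono) (auto simp: F_def)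
    ultimately show "face_prime (F i) \<subset> (face_prime (F (Suc i)) :: ((int ^ 'd) \<Rightarrow>\<^sub>0 'k) set)" by blast
  qed
qed

section \<open>The Cohen-Macaulay property in terms of the semigroup\<close>

lemma total_degree_keys_power:
  assumes "x \<in> augmentation" "s \<in> keys (x ^ k)"
  shows "int k \<le> total_degree s"
  using assms(2)
proof (induction k arbitrary: s)
  case 0
  then show ?case by simp
next
  case (Suc k)
  then obtain u v where uv: "s = u + v" "u \<in> keys x" "v \<in> keys (x ^ k)"
    using keys_mult[of x "x ^ k"] by auto
  have "u \<in> S" using uv assms(1) by (auto simp: augmentation_iff semigroup_algebra_def)
  moreover have "u \<noteq> 0" using uv assms(1) by (auto simp: augmentation_iff)
  ultimately have "1 \<le> total_degree u" using total_degree_pos[of u] by simp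
  then show ?case using Suc.IH[OF uv(3)] by (simp add: uv(1) total_degree_add)
qed

text \<open>The exponents of the k-th power have degree at least k, whereas only finitely many elements of S
  remain outside S under all of the subtractions \<open>\<tau> i a i\<close>.\<close>

lemma power_in_parameter_ideal:
  fixes x :: "(int ^ 'd) \<Rightarrow>\<^sub>0 'k::field" and \<tau> :: "'d \<Rightarrow> nat" and ds :: "'d list"
  assumes x: "x \<in> augmentation" and ds: "set ds = UNIV"
  defines "ys \<equiv> map (\<lambda>i. mon (int (\<tau> i) *s a i)) ds"
  shows "\<exists>k g. x ^ k = (\<Sum>j<length ys. g j * ys ! j) \<and> (\<forall>j. g j \<in> semigroup_algebra S)"
proof -
  interpret subdomain "semigroup_algebra S :: ((int ^ 'd) \<Rightarrow>\<^sub>0 'k) set" by (rule subdomain_S)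
  have "finite ((\<lambda>s. nat (total_degree s)) ` {s \<in> S. \<forall>i. s - int (\<tau> i) *s a i \<notin> S})"
    using finite_reduced by blast
  then obtain B where B: "\<And>s. s \<in> S \<Longrightarrow> \<forall>i. s - int (\<tau> i) *s a i \<notin> S \<Longrightarrow> nat (total_degree s) < B"
    unfolding finite_nat_set_iff_bounded by blast
  define K where "K = keys (x ^ B)"
  have xB: "x ^ B \<in> semigroup_algebra S" using x by (auto simp: augmentation_iff)
  have "\<exists>j<length ds. s - int (\<tau> (ds ! j)) *s a (ds ! j) \<in> S" if "s \<in> K" for s
  proof -
    have "s \<in> S" using that xB by (auto simp: K_def semigroup_algebra_def)
    moreover have "\<not> nat (total_degree s) < B"
      using total_degree_keys_power[OF x that[unfolded K_def]] by simp
    ultimately obtain i where "s - int (\<tau> i) *s a i \<in> S" using B by blast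
    moreover obtain j where "j < length ds" "ds ! j = i" using ds by (metis UNIV_I in_set_conv_nth)
    ultimately show ?thesis by blast
  qed
  then obtain \<iota> where \<iota>: "\<And>s. s \<in> K \<Longrightarrow> \<iota> s < length ds"
    "\<And>s. s \<in> K \<Longrightarrow> s - int (\<tau> (ds ! \<iota> s)) *s a (ds ! \<iota> s) \<in> S" by metis
  define g where "g j = (\<Sum>s\<in>{s \<in> K. \<iota> s = j}. single
    (s - int (\<tau> (ds ! j)) *s a (ds ! j)) (lookup (x ^ B) s))" for j
  have "(\<Sum>j<length ys. g j * ys ! j) =
    (\<Sum>j\<in>{..<length ds}. \<Sum>s\<in>{s \<in> K. \<iota> s = j}. single s (lookup (x ^ B) s))"
    by (auto simp: ys_def g_def sum_distrib_right mult_single intro!: sum.cong)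
  also have "\<dots> = (\<Sum>s\<in>K. single s (lookup (x ^ B) s))"
    using \<iota>(1) by (intro sum.group) (auto simp: K_def)
  also have "\<dots> = x ^ B" unfolding K_def by (rule poly_mapping_expand[symmetric])
  finally have "x ^ B = (\<Sum>j<length ys. g j * ys ! j)" ..
  moreover have "g j \<in> semigroup_algebra S" for j
    unfolding g_def using \<iota>(2) by (intro sum_mem single_mem_semigroup_algebra) auto
  ultimately show ?thesis by blast
qed

lemma koszul_sign_cases: "koszul_sign l j = (1 :: 'a::comm_ring_1) \<or> koszul_sign l j = (- 1 :: 'a)"
  unfolding koszul_sign_def by (cases "even (count_list (take j l) True)") auto

lemma count_list_map_True: "count_list (map P xs) True = length (filter P xs)"
  by (induction xs) auto

text \<open>If b is missing from S, choose a maximal set V of rays along which no translate of the missing element b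
  lies in S. After a shift by multiples of these rays, b becomes a member of S as soon as a large
  multiple of any ray outside V is added. The monomial with exponent b then is a cochain over the
  group algebra whose coboundary has entries in the semigroup ring, and this cocycle of degree
  \<open>card V + 1 < d\<close> is not a coboundary over the semigroup ring.\<close>

theorem cohen_macaulay_fill:
  assumes CM: "cohen_macaulay (semigroup_ring TYPE('k::field) S)"
    and bi: "b + int n *s a i \<in> S" and bj: "b + int m *s a j \<in> S" and ij: "i \<noteq> j"
  shows "b \<in> S"
proof (rule ccontr)
  assume bS: "b \<notin> S"
  let ?R = "semigroup_algebra S :: ((int ^ 'd) \<Rightarrow>\<^sub>0 'k) set"
  let ?P = "augmentation :: ((int ^ 'd) \<Rightarrow>\<^sub>0 'k) set"
  interpret localized_subdomain ?R ?P
    by (rule localized_maximal[OF augmentation_maximal])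
  have "cohen_macaulay_local A"
    using CM augmentation_maximal unfolding cohen_macaulay_def semigroup_ring_eq A_def by blast
  then have depth: "enat CARD('d) \<le> local_depth A"
    using krull_dim_augmentation_ge[where 'k = 'k] unfolding cohen_macaulay_local_def by simp
  have "\<exists>xs. regular_sequence A xs \<and> CARD('d) \<le> length xs"
  proof (rule ccontr)
    assume none: "\<not> ?thesis"
    have "local_depth A \<le> enat (CARD('d) - 1)"
      unfolding local_depth_def
    proof (rule Sup_least, safe)
      fix xs assume "regular_sequence A xs"
      then have "length xs < CARD('d)" using none by force
      then show "enat (length xs) \<le> enat (CARD('d) - 1)" by simp
    qed
    then have "enat CARD('d) \<le> enat (CARD('d) - 1)" using depth by (rule order_trans[rotated])
    then have "CARD('d) \<le> CARD('d) - 1" by (simp only: enat_ord_simps)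
    moreover have "0 < CARD('d)" by (rule zero_less_card_finite)
    ultimately show False by linarith
  qed
  then obtain xs where xs: "regular_sequence A xs" "CARD('d) \<le> length xs" by blast

  define missing where "missing V \<longleftrightarrow> (\<forall>n. (\<forall>v. v \<notin> V \<longrightarrow> n v = 0) \<longrightarrow> b + acomb n \<notin> S)" for V
  have "missing {}"
  proof -
    have "b + acomb n \<notin> S" if "\<forall>v. n v = 0" for n
    proof -
      have "n = (\<lambda>_. 0)" using that by auto
      then show ?thesis using bS by simp
    qed
    then show ?thesis by (auto simp: missing_def)
  qed
  then obtain V where V: "missing V" "\<And>V'. V \<subset> V' \<Longrightarrow> \<not> missing V'"
    using finite_has_maximal2[of "{V. missing V}" "{}"] by (auto simp: psubset_eq)
  have not_V: "k \<notin> V" if "b + int n *s a k \<in> S" for k n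
  proof
    assume "k \<in> V"
    then have "b + acomb (\<lambda>j. if j = k then n else 0) \<notin> S" using V(1) by (auto simp: missing_def)
    then show False using that by (simp add: acomb_single)
  qed
  have iV: "i \<notin> V" "j \<notin> V" using not_V bi bj by blast+
  have "\<exists>n. (\<forall>v. v \<notin> insert u V \<longrightarrow> n v = 0) \<and> b + acomb n \<in> S" if "u \<notin> V" for u
    using V(2)[of "insert u V"] that unfolding missing_def by blast
  then obtain N where N: "\<And>u v. u \<notin> V \<Longrightarrow> v \<notin> insert u V \<Longrightarrow> N u v = (0 :: nat)"
    "\<And>u. u \<notin> V \<Longrightarrow> b + acomb (N u) \<in> S" by metis
  define M where "M v = (if v \<in> V then \<Sum>u\<in>UNIV. N u v else 0)" for v
  define K where "K = (\<Sum>u\<in>UNIV. N u u)"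
  define b' where "b' = b + acomb M"
  have b'S: "b' \<notin> S" using V(1) unfolding missing_def b'_def by (simp add: M_def)
  have b'K: "b' + int K *s a u \<in> S" if u: "u \<notin> V" for u
  proof -
    define n where "n v = M v + (if v = u then K else 0)" for v
    have "N u v \<le> n v" for v
      using N(1)[OF u, of v] u member_le_sum[of u UNIV "\<lambda>u. N u v"] member_le_sum[of u UNIV "\<lambda>u. N u u"]
      by (auto simp: n_def M_def K_def)
    then have "acomb n = acomb (N u) + acomb (\<lambda>v. n v - N u v)" by (simp add: acomb_add)
    moreover have "b' + int K *s a u = b + acomb n"
      unfolding b'_def n_def acomb_add[symmetric] acomb_single by (simp add: add.assoc)
    ultimately have "b' + int K *s a u = (b + acomb (N u)) + acomb (\<lambda>v. n v - N u v)"
      by (simp add: add.assoc)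
    also have "\<dots> \<in> S" using N(2)[OF u] by blast
    finally show ?thesis .
  qed
  define w where "w = b' + int K *s a i"
  have wS: "w \<in> S" unfolding w_def using b'K iV by blast
  have "\<exists>t. coords w v < of_nat t" for v by (rule reals_Archimedean2)
  then obtain t where t: "\<And>v. coords w v < of_nat (t v)" by metis
  (* Along V the powers are so large that subtracting their exponents from w leaves the cone. *)
  define \<tau> where "\<tau> v = (if v \<in> V then t v else K)" for v
  have w_V: "w - int (\<tau> v) *s a v \<notin> S" if "v \<in> V" for v
    using coords_ge[of w "\<tau> v" v] t[of v] that by (auto simp: \<tau>_def)

  obtain ds :: "'d list" where ds: "set ds = UNIV" "distinct ds"
    using finite_distinct_list[of "UNIV :: 'd set"] by auto
  have len: "length ds = CARD('d)" using distinct_card[OF ds(2)] ds(1) by simp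
  define ys :: "((int ^ 'd) \<Rightarrow>\<^sub>0 'k) list" where "ys = map (\<lambda>i. mon (int (\<tau> i) *s a i)) ds"
  have ys: "set ys \<subseteq> ?R" "length ys = length ds"
    unfolding ys_def by (auto intro!: single_mem_semigroup_algebra)
  define l0 where "l0 = map (\<lambda>x. x \<in> V) ds"
  define e0 :: "bool list \<Rightarrow> (int ^ 'd) \<Rightarrow>\<^sub>0 'k" where "e0 l = (if l = l0 then mon b' else 0)" for l
  define c where "c = koszul ys e0"
  have "count_list l0 True = card V"
    unfolding l0_def count_list_map_True using distinct_length_filter[OF ds(2), of "\<lambda>x. x \<in> V"] ds(1) by simp
  then have e0: "homogeneous (length ys) (int (card V)) e0"
    unfolding homogeneous_def e0_def using ys(2) by (auto simp: l0_def split: if_splits)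
  have c_hom: "homogeneous (length ys) (int (card V) + 1) c"
    unfolding c_def by (rule homogeneous_koszul[OF e0])
  have sign_R: "koszul_sign l j * f \<in> ?R" if "f \<in> ?R" for l j f
    using koszul_sign_cases[of l j, where 'a = "(int ^ 'd) \<Rightarrow>\<^sub>0 'k"] uminus_mem[OF that] that
    by (elim disjE) (simp_all only: mult_1 mult_minus1)
  have c_R: "c l \<in> ?R" for l
  proof (cases "length l = length ys")
    case True
    have "(if l ! j then koszul_sign l j * ys ! j * e0 (l[j := False]) else 0) \<in> ?R"
      if j: "j < length ys" for j
    proof (cases "l ! j \<and> l[j := False] = l0")
      case True
      have "ds ! j \<notin> V"
        using True j ys(2) \<open>length l = length ys\<close> nth_list_update_eq[of j l False] by (auto simp: l0_def)
      then have "ys ! j * e0 (l[j := False]) = mon (b' + int K *s a (ds ! j))"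
        using j ys(2) True by (simp add: ys_def e0_def \<tau>_def mon_mult add.commute)
      moreover have "mon (b' + int K *s a (ds ! j)) \<in> ?R"
        using b'K[OF \<open>ds ! j \<notin> V\<close>] by (rule single_mem_semigroup_algebra)
      ultimately show ?thesis using sign_R True by (simp add: mult.assoc)
    next
      case False
      then show ?thesis by (auto simp: e0_def)
    qed
    then show ?thesis unfolding c_def koszul_expand[OF True] by (intro sum_mem) auto
  next
    case False
    then show ?thesis using homogeneousD[OF c_hom] by simp
  qed
  have "V \<subseteq> UNIV - {i, j}" using iV by auto
  then have "card V \<le> card (UNIV - {i, j} :: 'd set)" by (intro card_mono) auto
  also have "\<dots> = CARD('d) - 2" using ij by (simp add: card_Diff_subset)
  finally have "card V \<le> CARD('d) - 2" .
  moreover have "card {i, j} \<le> CARD('d)" by (intro card_mono) auto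
  ultimately have "int (card V) + 1 < int (length xs)" using xs(2) ij by simp
  then have "koszul_vanishes ys {0} (int (card V) + 1)"
    using koszul_vanishes_below_depth[OF xs(1) ys(1)] power_in_parameter_ideal[OF _ ds(1), of _ \<tau>]
    unfolding ys_def by blast
  moreover have "koszul ys c l \<in> {0}" for l unfolding c_def by (simp add: koszul_koszul)
  ultimately have "coboundary ys {0} (int (card V) + 1) c"
    using c_R c_hom unfolding koszul_vanishes_def by blast
  then obtain s e where se: "s \<in> T" "\<And>l. e l \<in> ?R" "\<And>l. s * c l = koszul ys e l"
    unfolding coboundary_def by auto

  obtain k where k: "k < length ds" "ds ! k = i" using ds(1) by (metis UNIV_I in_set_conv_nth)
  define l1 where "l1 = l0[k := True]"
  have l1: "length l1 = length ys" "l1 ! k" "l1[k := False] = l0"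
    using k iV ys(2) by (auto simp: l1_def l0_def list_update_same_conv)
  have l1_nth: "ds ! r \<in> V" if "r < length ys" "r \<noteq> k" "l1 ! r" for r
    using that ys(2) by (auto simp: l1_def l0_def)
  have sign_lookup: "lookup (koszul_sign l r * f) v = 0 \<longleftrightarrow> lookup f v = 0"
    for l r v and f :: "(int ^ 'd) \<Rightarrow>\<^sub>0 'k"
    using koszul_sign_cases[of l r, where 'a = "(int ^ 'd) \<Rightarrow>\<^sub>0 'k"] by auto
  have e0_l1: "e0 (l1[r := False]) = 0" if "r < length ys" "r \<noteq> k" for r
  proof -
    have "l1[r := False] ! k \<noteq> l0 ! k" using that k iV l1 ys(2) by (auto simp: l0_def)
    then show ?thesis by (auto simp: e0_def)
  qed
  have "c l1 = (\<Sum>r<length ys. if r = k then koszul_sign l1 r * ys ! r * e0 l0 else 0)"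
    unfolding c_def koszul_expand[OF l1(1)] using e0_l1 l1 by (intro sum.cong) auto
  also have "\<dots> = koszul_sign l1 k * (ys ! k * mon b')"
    using k ys(2) by (simp add: e0_def mult.assoc)
  also have "ys ! k * mon b' = mon w"
    using k iV by (simp add: ys_def mon_mult w_def \<tau>_def add.commute)
  finally have "c l1 = koszul_sign l1 k * mon w" .
  then have "s * c l1 = koszul_sign l1 k * (mon w * s)" by (simp add: algebra_simps)
  moreover have "lookup (mon w * s) w \<noteq> 0"
    using T_mem(1,2)[OF se(1)] by (simp add: lookup_single_mult augmentation_iff)
  ultimately have "lookup (s * c l1) w \<noteq> 0" by (simp add: sign_lookup)
  moreover have "lookup (koszul ys e l1) w = 0"
  proof -
    have "lookup (if l1 ! r then koszul_sign l1 r * ys ! r * e (l1[r := False]) else 0) w = 0"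
      if r: "r < length ys" for r
    proof (cases "l1 ! r")
      case True
      have nS: "w - int (\<tau> (ds ! r)) *s a (ds ! r) \<notin> S"
      proof (cases "r = k")
        case True
        then show ?thesis using k iV b'S by (simp add: w_def \<tau>_def)
      next
        case False
        then show ?thesis using w_V l1_nth[OF r False \<open>l1 ! r\<close>] by blast
      qed
      have "ys ! r = mon (int (\<tau> (ds ! r)) *s a (ds ! r))" using r ys(2) by (simp add: ys_def)
      then have "lookup (ys ! r * e (l1[r := False])) w = 0"
        using semigroup_algebra_lookup[OF se(2) nS] by (simp add: lookup_single_mult)
      then show ?thesis using True by (simp add: mult.assoc sign_lookup)
    qed simp
    then show ?thesis unfolding koszul_expand[OF l1(1)] lookup_sum by (intro sum.neutral) auto
  qed
  ultimately show False using se(3)[of l1] by simp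
qed

text \<open>The rays of the combination can be removed one at a time, each against the i-th ray.\<close>

corollary cohen_macaulay_fill_combination:
  assumes CM: "cohen_macaulay (semigroup_ring TYPE('k::field) S)"
    and "b + int n *s a i \<in> S" and "b + acomb m \<in> S" and "m i = 0"
  shows "b \<in> S"
proof -
  have "b \<in> S" if "finite J" "b + (\<Sum>j\<in>J. int (m j) *s a j) \<in> S" "i \<notin> J" for J
    using that
  proof (induction J rule: finite_induct)
    case (insert j J)
    let ?b = "b + (\<Sum>j\<in>J. int (m j) *s a j)"
    have "?b + int (m j) *s a j \<in> S" using insert by (simp add: algebra_simps)
    moreover have "?b + int n *s a i \<in> S"
    proof -
      have eq: "?b + int n *s a i = (b + int n *s a i) + (\<Sum>j\<in>J. int (m j) *s a j)" by (simp add: algebra_simps)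
      show ?thesis unfolding eq by (intro add_S assms(2) sum_S scale_S a_S)
    qed
    ultimately have "?b \<in> S" using cohen_macaulay_fill[OF CM, of ?b "m j" j n i] insert by auto
    then show ?case using insert by simp
  qed simp
  moreover have "acomb m = (\<Sum>j\<in>UNIV - {i}. int (m j) *s a j)"
    unfolding acomb_def using assms(4) by (intro sum.mono_neutral_right) auto
  ultimately show ?thesis using assms(3) by simp
qed

end

section \<open>Maximal ideals contain polynomials in each extremal monomial\<close>

context simplicial_semigroup
begin

definition ray_cone :: "'d set \<Rightarrow> (int ^ 'd) set" where
  "ray_cone F = {acomb n | n. \<forall>v. v \<notin> F \<longrightarrow> n v = 0}"

lemma ray_cone_S: "ray_cone F \<subseteq> S"
  by (auto simp: ray_cone_def)

lemma subdomain_ray_cone: "subdomain (semigroup_algebra (ray_cone F) :: ((int ^ 'd) \<Rightarrow>\<^sub>0 'k::field) set)"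
proof (rule subdomain_semigroup_algebra)
  show "0 \<in> ray_cone F" unfolding ray_cone_def by (force intro: exI[of _ "\<lambda>_. 0"])
  show "s + t \<in> ray_cone F" if st: "s \<in> ray_cone F" "t \<in> ray_cone F" for s t
  proof -
    obtain n m where "s = acomb n" "t = acomb m" "\<forall>v. v \<notin> F \<longrightarrow> n v = 0" "\<forall>v. v \<notin> F \<longrightarrow> m v = 0"
      using st unfolding ray_cone_def by blast
    then show ?thesis unfolding ray_cone_def
      by (intro CollectI exI[of _ "\<lambda>v. n v + m v"]) (simp add: acomb_add)
  qed
qed

lemma algebra_ray_cone_S: "f \<in> semigroup_algebra (ray_cone F) \<Longrightarrow> f \<in> semigroup_algebra S"
  using ray_cone_S by (auto simp: semigroup_algebra_def)

lemma a_ray_cone: "i \<in> F \<Longrightarrow> a i \<in> ray_cone F"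
  unfolding ray_cone_def using acomb_single[of i 1]
  by (intro CollectI exI[of _ "\<lambda>j. if j = i then 1 else 0"]) auto

lemma expand_in_ray:
  fixes f :: "(int ^ 'd) \<Rightarrow>\<^sub>0 'k::field"
  assumes f: "f \<in> semigroup_algebra (ray_cone (insert i F))" "f \<noteq> 0" and i: "i \<notin> F"
  shows "\<exists>D p. (\<forall>j. p j \<in> semigroup_algebra (ray_cone F)) \<and> p D \<noteq> 0 \<and>
    f = (\<Sum>j\<le>D. p j * mon (int j *s a i))"
proof -
  interpret subdomain "semigroup_algebra (ray_cone F) :: ((int ^ 'd) \<Rightarrow>\<^sub>0 'k) set"
    by (rule subdomain_ray_cone)
  let ?K = "keys f"
  have "\<exists>n. s = acomb n \<and> (\<forall>v. v \<notin> insert i F \<longrightarrow> n v = 0)" if "s \<in> ?K" for s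
    using f(1) that unfolding semigroup_algebra_def ray_cone_def by blast
  then obtain n where n: "\<And>s. s \<in> ?K \<Longrightarrow> s = acomb (n s)"
    "\<And>s v. s \<in> ?K \<Longrightarrow> v \<notin> insert i F \<Longrightarrow> n s v = 0" by metis
  define \<iota> where "\<iota> s = n s i" for s
  define D where "D = Max (\<iota> ` ?K)"
  have ne: "?K \<noteq> {}" using f(2) by auto
  have "D \<in> \<iota> ` ?K" unfolding D_def using ne by (intro Max_in) auto
  then obtain s0 where s0: "s0 \<in> ?K" "\<iota> s0 = D" by auto
  have le: "\<iota> s \<le> D" if "s \<in> ?K" for s unfolding D_def using that by (intro Max_ge) auto
  define p where "p j = (\<Sum>s\<in>{s \<in> ?K. \<iota> s = j}.
    single (s - int j *s a i) (lookup f s))" for j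
  have cone: "s - int (\<iota> s) *s a i \<in> ray_cone F" if s: "s \<in> ?K" for s
  proof -
    have "s = acomb ((n s)(i := 0)) + int (\<iota> s) *s a i"
      using n(1)[OF s] acomb_split[of "n s" i] by (simp add: \<iota>_def)
    then have "s - int (\<iota> s) *s a i = acomb ((n s)(i := 0))" by (metis add_diff_cancel_right')
    then show ?thesis
      unfolding ray_cone_def using n(2)[OF s] by (intro CollectI exI[of _ "(n s)(i := 0)"]) auto
  qed
  have "p j \<in> semigroup_algebra (ray_cone F)" for j
    unfolding p_def using cone by (intro sum_mem single_mem_semigroup_algebra) auto
  moreover have "p D \<noteq> 0"
  proof -
    have "lookup (p D) (s0 - int D *s a i) =
      (\<Sum>s\<in>{s \<in> ?K. \<iota> s = D}. if s = s0 then lookup f s else 0)"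
      unfolding p_def lookup_sum by (intro sum.cong) (auto simp: lookup_single when_def)
    also have "\<dots> = lookup f s0" using s0 by (subst sum.delta) auto
    finally show ?thesis using s0(1) by auto
  qed
  moreover have "f = (\<Sum>j\<le>D. p j * mon (int j *s a i))"
  proof -
    have "(\<Sum>j\<le>D. p j * mon (int j *s a i)) =
      (\<Sum>j\<in>{..D}. \<Sum>s\<in>{s \<in> ?K. \<iota> s = j}. single s (lookup f s))"
      by (auto simp: p_def sum_distrib_right mult_single intro!: sum.cong)
    also have "\<dots> = (\<Sum>s\<in>?K. single s (lookup f s))"
      using le by (intro sum.group) auto
    also have "\<dots> = f" by (rule poly_mapping_expand[symmetric])
    finally show ?thesis ..
  qed
  ultimately show ?thesis by blast
qed

text \<open>The forms of top degree have a nonzero product.\<close>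

lemma key_degree_mult:
  fixes f g :: "(int ^ 'd) \<Rightarrow>\<^sub>0 'k::field"
  assumes f: "\<exists>x\<in>keys f. m \<le> total_degree x"
    and g: "\<exists>y\<in>keys g. n \<le> total_degree y"
  shows "\<exists>z\<in>keys (f * g). m + n \<le> total_degree z"
proof -
  have ne: "keys f \<noteq> {}" "keys g \<noteq> {}" using f g by blast+
  obtain x y where xy: "lookup (f * g) (x + y) \<noteq> 0"
    "\<And>x'. x' \<in> keys f \<Longrightarrow> total_degree x' \<le> total_degree x"
    "\<And>y'. y' \<in> keys g \<Longrightarrow> total_degree y' \<le> total_degree y"
    by (rule lookup_mult_nonzero[OF order_refl ne(1) order_refl ne(2) total_degree_add]) auto
  have "m \<le> total_degree x" "n \<le> total_degree y" using f g xy(2,3) by force+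
  then show ?thesis using xy(1)
    by (intro bexI[of _ "x + y"]) (auto simp: total_degree_add lookup_not_eq_zero_eq_in_keys)
qed

text \<open>Zariski's lemma for the residue field R/P. Let F be a maximal set of rays whose monomials are
  algebraically independent modulo P, and suppose that it is nonempty. After inverting the product h
  of the leading coefficients of algebraic equations for the other rays, R/P is generated by finitely
  many monomials over the polynomial ring in the rays of F. A maximal independent subset of these
  monomials, containing 1, serves as a basis up to a common denominator c. Reading off the
  coefficient of 1 in the inverse powers of u = 1 + h y shows that c is divisible by all powers of u
  (h is invertible modulo u), which contradicts the degree.\<close>

theorem no_independent_rays:
  fixes P :: "((int ^ 'd) \<Rightarrow>\<^sub>0 'k::field) set"
  assumes P: "maximalideal P (ring_on (semigroup_algebra S))"
    and indep: "\<And>f. f \<in> semigroup_algebra (ray_cone F) \<Longrightarrow> f \<in> P \<Longrightarrow> f = 0"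
    and dep: "\<And>i. i \<notin> F \<Longrightarrow> \<exists>f. f \<in> semigroup_algebra (ray_cone (insert i F)) \<and> f \<in> P \<and> f \<noteq> 0"
  shows "F = {}"
proof (rule ccontr)
  assume "F \<noteq> {}"
  then obtain i0 where i0: "i0 \<in> F" by blast
  let ?R = "semigroup_algebra S :: ((int ^ 'd) \<Rightarrow>\<^sub>0 'k) set"
  let ?Q = "semigroup_algebra (ray_cone F) :: ((int ^ 'd) \<Rightarrow>\<^sub>0 'k) set"
  interpret localized_subdomain ?R P by (rule localized_maximal[OF P])
  interpret Q: subdomain ?Q by (rule subdomain_ray_cone)
  note QR = algebra_ray_cone_S[of _ F]
  note PI = idlD[OF P_idl]
  define equation where "equation i D p \<longleftrightarrow> (\<forall>j. p j \<in> ?Q) \<and> p D \<noteq> 0 \<and>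
    (\<Sum>j\<le>D. p j * mon (int j *s a i)) \<in> P" for i D p
  have "\<exists>D p. equation i D p" if i: "i \<notin> F" for i
  proof -
    obtain f where f: "f \<in> semigroup_algebra (ray_cone (insert i F))" "f \<in> P" "f \<noteq> 0"
      using dep[OF i] by blast
    obtain D p where "\<forall>j. p j \<in> ?Q" "p D \<noteq> 0" "f = (\<Sum>j\<le>D. p j * mon (int j *s a i))"
      using expand_in_ray[OF f(1,3) i] by blast
    then show ?thesis using f(2) unfolding equation_def by (intro exI[of _ D] exI[of _ p]) simp
  qed
  then obtain D p where "\<And>i. i \<notin> F \<Longrightarrow> equation i (D i) (p i)" by metis
  then have p: "\<And>i j. i \<notin> F \<Longrightarrow> p i j \<in> ?Q" "\<And>i. i \<notin> F \<Longrightarrow> p i (D i) \<noteq> 0"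
    "\<And>i. i \<notin> F \<Longrightarrow> (\<Sum>j\<le>D i. p i j * mon (int j *s a i)) \<in> P"
    unfolding equation_def by simp_all
  have D_pos: "0 < D i" if "i \<notin> F" for i
  proof (rule ccontr)
    assume "\<not> 0 < D i"
    then have "p i (D i) \<in> P" using p(3)[OF that] by simp
    then show False using indep p(1,2)[OF that] by blast
  qed
  define h where "h = (\<Prod>i\<in>- F. p i (D i))"
  have hQ: "h \<in> ?Q" unfolding h_def using p(1) by (intro Q.prod_mem) auto
  have prod_nz: "prod g J \<noteq> 0" if "finite J" "\<And>j. j \<in> J \<Longrightarrow> g j \<in> ?Q \<and> g j \<noteq> 0"
    for g and J :: "'i set"
    using that
  proof (induction J rule: finite_induct)
    case (insert j J)
    then show ?case using Q.no_zero_div[of "g j" "prod g J"] Q.prod_mem[of J g] by auto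
  qed simp
  have h_nz: "h \<noteq> 0" unfolding h_def using p(1,2) by (intro prod_nz) auto

  define \<tau> where "\<tau> i = (if i \<in> F then 1 else D i)" for i
  define \<Sigma> where "\<Sigma> = {s \<in> S. \<forall>i. s - int (\<tau> i) *s a i \<notin> S}"
  have fin: "finite \<Sigma>" unfolding \<Sigma>_def by (rule finite_reduced)
  define span where "span X r \<longleftrightarrow> (\<exists>q e. (\<forall>t. q t \<in> ?Q) \<and> e \<in> P \<and> r = (\<Sum>t\<in>X. q t * mon t) + e)"
    for X r
  have span_add: "span X (r + r')" if rr: "span X r" "span X r'" for X r r'
  proof -
    obtain q e q' e' where h: "\<forall>t. q t \<in> ?Q" "e \<in> P" "r = (\<Sum>t\<in>X. q t * mon t) + e"
      "\<forall>t. q' t \<in> ?Q" "e' \<in> P" "r' = (\<Sum>t\<in>X. q' t * mon t) + e'"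
      using rr unfolding span_def by blast
    have "r + r' = (\<Sum>t\<in>X. (q t + q' t) * mon t) + (e + e')"
      using h by (simp add: sum.distrib algebra_simps)
    moreover have "\<forall>t. q t + q' t \<in> ?Q" "e + e' \<in> P" using h PI(3) by (auto intro: Q.add_mem)
    ultimately show ?thesis unfolding span_def
      by (intro exI[of _ "\<lambda>t. q t + q' t"] exI[of _ "e + e'"] conjI)
  qed
  have span_mult: "span X (g * r)" if g: "g \<in> ?Q" and r: "span X r" for X g r
  proof -
    obtain q e where h: "\<forall>t. q t \<in> ?Q" "e \<in> P" "r = (\<Sum>t\<in>X. q t * mon t) + e"
      using r unfolding span_def by blast
    have "g * r = (\<Sum>t\<in>X. (g * q t) * mon t) + g * e"
      using h(3) by (simp add: sum_distrib_left algebra_simps)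
    moreover have "\<forall>t. g * q t \<in> ?Q" using h(1) g by blast
    ultimately show ?thesis unfolding span_def using PI(4)[OF h(2) QR[OF g]]
      by (intro exI[of _ "\<lambda>t. g * q t"] exI[of _ "g * e"] conjI)
  qed
  have span_P: "span X e" if "e \<in> P" for X e
    unfolding span_def using that by (intro exI[of _ "\<lambda>_. 0"] exI[of _ e]) auto
  have span_mon: "span X (mon t)" if "finite X" "t \<in> X" for X t
  proof -
    have "(\<Sum>s\<in>X. (if s = t then 1 else 0) * mon s) = (\<Sum>s\<in>X. if s = t then mon s else (0 :: (int ^ 'd) \<Rightarrow>\<^sub>0 'k))"
      by (intro sum.cong) auto
    also have "\<dots> = mon t" using that by simp
    finally show ?thesis unfolding span_def using PI(2)
      by (intro exI[of _ "\<lambda>s. if s = t then 1 else 0"] exI[of _ 0]) auto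
  qed
  have span_sum: "span X (\<Sum>j\<in>J. g j)" if "\<And>j. j \<in> J \<Longrightarrow> span X (g j)" for X g and J :: "'j set"
    using that by (induction J rule: infinite_finite_induct) (auto intro: span_add span_P PI(2))
  have span_power: "span X (h ^ n * r)" if "span X (h ^ m * r)" "m \<le> n" for X r m n
  proof -
    have "h ^ n * r = h ^ (n - m) * (h ^ m * r)" using that(2) by (simp add: mult.assoc[symmetric] flip: power_add)
    then show ?thesis using span_mult[OF Q.power_mem[OF hQ] that(1)] by simp
  qed
  have mon_span: "\<exists>N. span \<Sigma> (h ^ N * mon s)" if "s \<in> S" for s
    using that
  proof (induction "nat (total_degree s)" arbitrary: s rule: less_induct)
    case less
    have smaller: "nat (total_degree t) < nat (total_degree s)" if "t \<in> S" "s - t \<in> S" "s \<noteq> t" for t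
      using total_degree_pos[of "s - t"] total_degree_nonneg[OF that(1)] that(2,3) by (simp add: total_degree_diff)
    show ?case
    proof (cases "s \<in> \<Sigma>")
      case True
      then show ?thesis using span_mon[OF fin True] by (intro exI[of _ 0]) simp
    next
      case False
      then obtain i where i: "s - int (\<tau> i) *s a i \<in> S" using less.prems by (auto simp: \<Sigma>_def)
      show ?thesis
      proof (cases "i \<in> F")
        case True
        then have t: "s - a i \<in> S" using i by (simp add: \<tau>_def)
        obtain N where "span \<Sigma> (h ^ N * mon (s - a i))"
          using less.hyps[OF smaller t] t a_nonzero[of i] by auto
        moreover have "mon (a i) \<in> ?Q" using a_ray_cone[OF True] by (rule single_mem_semigroup_algebra)
        ultimately have "span \<Sigma> (mon (a i) * (h ^ N * mon (s - a i)))" by (rule span_mult[rotated])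
        moreover have "mon (a i) * (h ^ N * mon (s - a i)) = h ^ N * (mon (a i) * mon (s - a i))"
          by (simp only: mult.left_commute)
        ultimately show ?thesis by (auto simp: mon_mult)
      next
        case False
        define t where "t = s - int (D i) *s a i"
        have t: "t \<in> S" using i False by (simp add: \<tau>_def t_def)
        have s_eq: "s = t + int (D i) *s a i" by (simp add: t_def)
        have "\<exists>N. span \<Sigma> (h ^ N * mon (t + int j *s a i))" if j: "j < D i" for j
        proof (rule less.hyps)
          show tj: "t + int j *s a i \<in> S" using t by blast
          have eq: "s - (t + int j *s a i) = int (D i - j) *s a i"
            using j unfolding s_eq by (simp add: of_nat_diff vector_sub_rdistrib)
          have "int (D i - j) *s a i \<noteq> 0"
            using coords_scale_a[of "D i - j" i i] coords_scale_a[of 0 i i] j by auto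
          then show "nat (total_degree (t + int j *s a i)) < nat (total_degree s)"
            using smaller[OF tj] eq by (metis a_S eq_iff_diff_eq_0 scale_S)
        qed
        then obtain N where N: "\<And>j. j < D i \<Longrightarrow> span \<Sigma> (h ^ N j * mon (t + int j *s a i))" by metis
        define M where "M = (\<Sum>j<D i. N j)"
        have lower: "span \<Sigma> (h ^ M * mon (t + int j *s a i))" if "j < D i" for j
          using span_power[OF N[OF that], of M] member_le_sum[of j "{..<D i}" N] that by (simp add: M_def)
        let ?f = "\<Sum>j\<le>D i. p i j * mon (int j *s a i)"
        have "?f * mon t = p i (D i) * mon s + (\<Sum>j<D i. p i j * mon (t + int j *s a i))"
          unfolding s_eq by (simp add: lessThan_Suc_atMost[symmetric] distrib_right sum_distrib_right
              mult.assoc mon_mult add.commute)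
        then have eq: "p i (D i) * mon s = ?f * mon t + (\<Sum>j<D i. (- p i j) * mon (t + int j *s a i))"
          by (simp add: sum_negf algebra_simps)
        have "span \<Sigma> (h ^ M * (?f * mon t))"
          by (intro span_P PI(4)[OF PI(5)[OF p(3)[OF False]]] single_mem_semigroup_algebra t QR Q.power_mem hQ)
        moreover have "span \<Sigma> (\<Sum>j<D i. (- p i j) * (h ^ M * mon (t + int j *s a i)))"
          using p(1)[OF False] lower by (intro span_sum, rule span_mult[OF Q.uminus_mem]) auto
        ultimately have "span \<Sigma> (h ^ M * (?f * mon t) + (\<Sum>j<D i. (- p i j) * (h ^ M * mon (t + int j *s a i))))"
          by (rule span_add)
        also have "h ^ M * (?f * mon t) + (\<Sum>j<D i. (- p i j) * (h ^ M * mon (t + int j *s a i))) =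
          h ^ M * (p i (D i) * mon s)"
          unfolding eq distrib_left sum_distrib_left by (simp only: mult.left_commute)
        finally have top: "span \<Sigma> (h ^ M * (p i (D i) * mon s))" .
        have "h = p i (D i) * (\<Prod>i\<in>- F - {i}. p i (D i))"
          unfolding h_def using False by (intro prod.remove) auto
        then have "h ^ Suc M * mon s = (\<Prod>i\<in>- F - {i}. p i (D i)) * (h ^ M * (p i (D i) * mon s))"
          by (simp add: algebra_simps)
        moreover have "(\<Prod>i\<in>- F - {i}. p i (D i)) \<in> ?Q" using p(1) by (intro Q.prod_mem) auto
        ultimately have "span \<Sigma> (h ^ Suc M * mon s)" using span_mult[OF _ top] by metis
        then show ?thesis by blast
      qed
    qed
  qed
  have R_span: "\<exists>N. span \<Sigma> (h ^ N * r)" if r: "r \<in> ?R" for r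
  proof -
    let ?K = "keys r"
    have "\<exists>N. span \<Sigma> (h ^ N * mon s)" if "s \<in> ?K" for s
      using mon_span r that by (auto simp: semigroup_algebra_def)
    then obtain N where N: "\<And>s. s \<in> ?K \<Longrightarrow> span \<Sigma> (h ^ N s * mon s)" by metis
    define M where "M = (\<Sum>s\<in>?K. N s)"
    have low: "span \<Sigma> (h ^ M * mon s)" if "s \<in> ?K" for s
      using span_power[OF N[OF that], of M] member_le_sum[of s ?K N] that by (simp add: M_def)
    have constQ: "const c \<in> ?Q" for c
      by (rule single_mem_semigroup_algebra) (force simp: ray_cone_def intro: exI[of _ "\<lambda>_. 0"])
    have "span \<Sigma> (\<Sum>s\<in>?K. const (lookup r s) * (h ^ M * mon s))"
      by (rule span_sum, rule span_mult[OF constQ low])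
    also have "(\<Sum>s\<in>?K. const (lookup r s) * (h ^ M * mon s)) =
      h ^ M * (\<Sum>s\<in>?K. single s (lookup r s))"
      unfolding sum_distrib_left by (intro sum.cong refl) (simp add: mult.left_commute mult_single)
    also have "\<dots> = h ^ M * r" by (simp flip: poly_mapping_expand)
    finally show ?thesis by blast
  qed

  define free where "free X \<longleftrightarrow> (\<forall>q. (\<forall>t. q t \<in> ?Q) \<longrightarrow> (\<Sum>t\<in>X. q t * mon t) \<in> P \<longrightarrow> (\<forall>t\<in>X. q t = 0))"
    for X :: "(int ^ 'd) set"
  have free_zero: "free {0}" unfolding free_def using indep by auto
  have zero_\<Sigma>: "0 \<in> \<Sigma>"
  proof -
    have "0 - int (\<tau> i) *s a i \<notin> S" for i
    proof
      assume "0 - int (\<tau> i) *s a i \<in> S"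
      then have "int (\<tau> i) *s a i = 0" by (intro S_antisym) auto
      then show False using coords_scale_a[of "\<tau> i" i i] coords_scale_a[of 0 i i] D_pos[of i]
        by (auto simp: \<tau>_def split: if_splits)
    qed
    then show ?thesis by (simp add: \<Sigma>_def)
  qed
  have "finite {X. X \<subseteq> \<Sigma> \<and> free X}" using fin by (intro finite_subset[OF _ finite_Pow_iff[THEN iffD2]]) auto
  moreover have "{0} \<in> {X. X \<subseteq> \<Sigma> \<and> free X}" using free_zero zero_\<Sigma> by simp
  ultimately have "\<exists>X\<in>{X. X \<subseteq> \<Sigma> \<and> free X}. {0} \<subseteq> X \<and> (\<forall>Y\<in>{X. X \<subseteq> \<Sigma> \<and> free X}. X \<subseteq> Y \<longrightarrow> X = Y)"
    by (rule finite_has_maximal2)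
  then obtain X where Xmem: "X \<in> {X. X \<subseteq> \<Sigma> \<and> free X}" "{0} \<subseteq> X"
    and Xmax: "\<forall>Y\<in>{X. X \<subseteq> \<Sigma> \<and> free X}. X \<subseteq> Y \<longrightarrow> X = Y" by (elim bexE conjE)
  have X: "X \<subseteq> \<Sigma>" "0 \<in> X" "free X" using Xmem by simp_all
  have X_max: "X = Y" if "Y \<subseteq> \<Sigma>" "free Y" "X \<subseteq> Y" for Y
    using Xmax[rule_format, of Y] that by simp
  have finX: "finite X" using X(1) fin by (rule finite_subset)
  have "\<exists>c. c \<in> ?Q \<and> c \<noteq> 0 \<and> span X (c * mon t)" if t: "t \<in> \<Sigma>" for t
  proof (cases "t \<in> X")
    case True
    then show ?thesis using span_mon[OF finX True] by (intro exI[of _ 1]) auto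
  next
    case False
    then have "\<not> free (insert t X)" using X_max[of "insert t X"] X(1) t by blast
    then obtain q where q: "\<forall>s. q s \<in> ?Q" "(\<Sum>s\<in>insert t X. q s * mon s) \<in> P" "\<exists>s\<in>insert t X. q s \<noteq> 0"
      unfolding free_def by blast
    have sum: "(\<Sum>s\<in>insert t X. q s * mon s) = q t * mon t + (\<Sum>s\<in>X. q s * mon s)"
      using finX False by simp
    have "q t \<noteq> 0"
    proof
      assume "q t = 0"
      then show False using X(3) q sum unfolding free_def by auto
    qed
    moreover have "q t * mon t = (\<Sum>s\<in>X. (- q s) * mon s) + (\<Sum>s\<in>insert t X. q s * mon s)"
      unfolding sum by (simp add: sum_negf)
    then have "span X (q t * mon t)" unfolding span_def using q(1,2) Q.uminus_mem
      by (intro exI[of _ "\<lambda>s. - q s"] exI[of _ "\<Sum>s\<in>insert t X. q s * mon s"]) blast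
    ultimately show ?thesis using q(1) by blast
  qed
  then obtain \<gamma> where \<gamma>: "\<And>t. t \<in> \<Sigma> \<Longrightarrow> \<gamma> t \<in> ?Q" "\<And>t. t \<in> \<Sigma> \<Longrightarrow> \<gamma> t \<noteq> 0"
    "\<And>t. t \<in> \<Sigma> \<Longrightarrow> span X (\<gamma> t * mon t)" by metis
  define c where "c = prod \<gamma> \<Sigma>"
  have cQ: "c \<in> ?Q" unfolding c_def using \<gamma>(1) by (intro Q.prod_mem)
  have c_nz: "c \<noteq> 0" unfolding c_def using \<gamma>(1,2) fin by (intro prod_nz) auto
  have c_mon: "span X (c * mon t)" if t: "t \<in> \<Sigma>" for t
  proof -
    have "c = \<gamma> t * prod \<gamma> (\<Sigma> - {t})" unfolding c_def using fin t by (rule prod.remove)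
    then have "c * mon t = prod \<gamma> (\<Sigma> - {t}) * (\<gamma> t * mon t)" by (simp add: algebra_simps)
    moreover have "prod \<gamma> (\<Sigma> - {t}) \<in> ?Q" using \<gamma>(1) by (intro Q.prod_mem) auto
    ultimately show ?thesis using span_mult[OF _ \<gamma>(3)[OF t]] by metis
  qed
  have c_span: "span X (c * r)" if r: "span \<Sigma> r" for r
  proof -
    obtain q e where h: "\<forall>t. q t \<in> ?Q" "e \<in> P" "r = (\<Sum>t\<in>\<Sigma>. q t * mon t) + e"
      using r unfolding span_def by blast
    have eq: "c * r = (\<Sum>t\<in>\<Sigma>. q t * (c * mon t)) + c * e"
      unfolding h(3) distrib_left sum_distrib_left by (simp only: mult.left_commute)
    have comb: "span X (\<Sum>t\<in>\<Sigma>. q t * (c * mon t))"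
      by (rule span_sum, rule span_mult[OF h(1)[rule_format] c_mon])
    show ?thesis unfolding eq by (rule span_add[OF comb span_P[OF PI(4)[OF h(2) QR[OF cQ]]]])
  qed

  define y :: "(int ^ 'd) \<Rightarrow>\<^sub>0 'k" where "y = mon (a i0)"
  (* h * y = - (1 - u), so h becomes invertible modulo every power of u. *)
  define u where "u = 1 + h * y"
  have yQ: "y \<in> ?Q" unfolding y_def using a_ray_cone[OF i0] by (rule single_mem_semigroup_algebra)
  have uQ: "u \<in> ?Q" unfolding u_def using hQ yQ by blast
  have "- a i0 \<notin> S" using S_antisym[of "a i0"] a_nonzero by auto
  then have "lookup u 0 = 1"
    using semigroup_algebra_lookup[OF QR[OF hQ]]
    by (simp add: u_def y_def mult.commute[of h] lookup_add lookup_single_mult)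
  then have "u \<noteq> 0" by auto
  then have "u \<notin> P" using indep[OF uQ] by blast
  then obtain v where v: "v \<in> ?R" "u * v - 1 \<in> P"
    using maximalideal_ring_onD(3)[OF P QR[OF uQ]] by blast
  have divides: "\<exists>g\<in>?Q. c = u ^ m * g" for m
  proof -
    obtain N where N: "span \<Sigma> (h ^ N * v ^ m)" using R_span v(1) by blast
    obtain q e where q: "\<forall>t. q t \<in> ?Q" "e \<in> P" "c * (h ^ N * v ^ m) = (\<Sum>t\<in>X. q t * mon t) + e"
      using c_span[OF N] unfolding span_def by blast
    have uv: "u ^ m * v ^ m - 1 \<in> P"
    proof (induction m)
      case 0
      then show ?case using PI(2) by simp
    next
      case (Suc m)
      have "u ^ Suc m * v ^ Suc m - 1 = (u * v) * (u ^ m * v ^ m - 1) + (u * v - 1)"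
        by (simp add: algebra_simps)
      also have "\<dots> \<in> P" using QR[OF uQ] v by (intro PI(3) PI(4) Suc mult_mem)
      finally show ?case .
    qed
    (* Multiplying the expansion of c * h ^ N * v ^ m by u ^ m turns v ^ m into 1 modulo P; comparing
       coefficients at the free generator 1 gives c * h ^ N = u ^ m * q 0. *)
    define q' where "q' t = (if t = 0 then u ^ m * q t - c * h ^ N else u ^ m * q t)" for t
    have "(\<Sum>t\<in>X. q' t * mon t) = (u ^ m * q 0 - c * h ^ N) * mon 0 + (\<Sum>t\<in>X - {0}. u ^ m * q t * mon t)"
      using finX X(2) by (subst sum.remove[of X 0]) (auto simp: q'_def intro!: sum.cong)
    also have "\<dots> = (\<Sum>t\<in>X. u ^ m * q t * mon t) - c * h ^ N"
      using finX X(2) by (subst sum.remove[of X 0 "\<lambda>t. u ^ m * q t * mon t"]) (auto simp: algebra_simps)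
    also have "(\<Sum>t\<in>X. u ^ m * q t * mon t) = u ^ m * (c * (h ^ N * v ^ m) - e)"
      using q(3) by (simp add: sum_distrib_left mult.assoc)
    also have "u ^ m * (c * (h ^ N * v ^ m) - e) - c * h ^ N = (c * h ^ N) * (u ^ m * v ^ m - 1) - u ^ m * e"
      by (simp add: algebra_simps)
    also have "\<dots> \<in> P" using QR[OF cQ] QR[OF hQ] QR[OF uQ] by (intro PI(7) PI(4) uv q(2) mult_mem power_mem)
    finally have "(\<Sum>t\<in>X. q' t * mon t) \<in> P" .
    moreover have "\<forall>t. q' t \<in> ?Q"
      using q(1) cQ hQ uQ unfolding q'_def by (auto intro!: Q.diff_mem Q.mult_mem Q.power_mem)
    ultimately have "q' 0 = 0" using X(2,3) unfolding free_def by blast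
    then have ch: "c * h ^ N = u ^ m * q 0" by (simp add: q'_def)
    have "\<exists>g\<in>?Q. \<exists>g'\<in>?Q. 1 = (h * y) ^ n * g + u ^ m * g'" for n
    proof (induction n)
      case 0
      show ?case by (intro bexI[of _ 1] bexI[of _ 0]) auto
    next
      case (Suc n)
      then obtain g g' where g: "g \<in> ?Q" "g' \<in> ?Q" "1 = (h * y) ^ n * g + u ^ m * g'" by blast
      define G where "G = (\<Sum>k<m. u ^ k)"
      have GQ: "G \<in> ?Q" unfolding G_def using uQ by blast
      have "(1 - u) * G = 1 - u ^ m" unfolding G_def by (rule one_diff_power_eq[symmetric])
      then have one: "1 = (h * y) * (- G) + u ^ m" by (simp add: u_def algebra_simps)
      have "1 = (h * y) ^ n * g * 1 + u ^ m * g'" using g(3) by simp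
      also have "\<dots> = (h * y) ^ n * g * ((h * y) * (- G) + u ^ m) + u ^ m * g'" using one by simp
      also have "\<dots> = (h * y) ^ Suc n * (- (g * G)) + u ^ m * ((h * y) ^ n * g + g')"
        by (simp add: algebra_simps)
      finally have "1 = (h * y) ^ Suc n * (- (g * G)) + u ^ m * ((h * y) ^ n * g + g')" .
      moreover have "- (g * G) \<in> ?Q" "(h * y) ^ n * g + g' \<in> ?Q" using g GQ hQ yQ by blast+
      ultimately show ?case by blast
    qed
    then obtain g g' where g: "g \<in> ?Q" "g' \<in> ?Q" "1 = (h * y) ^ N * g + u ^ m * g'" by blast
    have "c = c * ((h * y) ^ N * g + u ^ m * g')" using g(3) by simp
    also have "\<dots> = (c * h ^ N) * (y ^ N * g) + u ^ m * (c * g')"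
      by (simp add: power_mult_distrib algebra_simps)
    also have "\<dots> = u ^ m * (q 0 * (y ^ N * g) + c * g')" unfolding ch by (simp add: algebra_simps)
    finally show ?thesis using q(1) g cQ yQ by blast
  qed

  have u_degree: "\<exists>x\<in>keys u. 1 \<le> total_degree x"
  proof -
    have deg: "total_degree x \<ge> 0" if "x \<in> keys h" for x
      using that QR[OF hQ] total_degree_nonneg by (auto simp: semigroup_algebra_def)
    obtain x where x: "x \<in> keys h" using h_nz by (metis ex_in_conv keys_eq_empty)
    have "lookup (h * y) (x + a i0) = lookup h x"
      by (simp add: y_def mult.commute[of h] lookup_single_mult)
    moreover have pos: "1 \<le> total_degree (x + a i0)"
      using deg[OF x] total_degree_pos[of "a i0"] a_nonzero by (simp add: total_degree_add)
    then have "x + a i0 \<noteq> 0" by auto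
    ultimately have "lookup u (x + a i0) \<noteq> 0"
      using x[unfolded in_keys_iff] by (simp add: u_def lookup_add lookup_one)
    then show ?thesis using pos by (intro bexI[of _ "x + a i0"]) (auto simp: lookup_not_eq_zero_eq_in_keys)
  qed
  have power_degree: "\<exists>x\<in>keys (u ^ m). int m \<le> total_degree x" for m
  proof (induction m)
    case (Suc m)
    show ?case using key_degree_mult[OF u_degree Suc] by (simp add: add.commute)
  qed simp
  have large: "\<exists>x\<in>keys c. int m \<le> total_degree x" for m
  proof -
    obtain g where g: "g \<in> ?Q" "c = u ^ m * g" using divides by blast
    then have "g \<noteq> 0" using c_nz by auto
    then obtain x where "x \<in> keys g" by (metis ex_in_conv keys_eq_empty)
    moreover have "0 \<le> total_degree x"
      using calculation QR[OF g(1)] total_degree_nonneg by (auto simp: semigroup_algebra_def)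
    ultimately show ?thesis using key_degree_mult[OF power_degree[of m], of g 0] g(2) by auto
  qed
  have "finite ((\<lambda>x. nat (total_degree x)) ` keys c)" by simp
  then obtain B where "\<forall>n\<in>(\<lambda>x. nat (total_degree x)) ` keys c. n < B"
    unfolding finite_nat_set_iff_bounded by blast
  then show False using large[of B] by force
qed

text \<open>The empty set of rays is independent modulo the proper ideal P, and by Zariski's lemma it is a
  maximal independent set; so the monomial of each single ray is algebraic modulo P.\<close>

corollary maximal_ideal_ray_polynomial:
  fixes P :: "((int ^ 'd) \<Rightarrow>\<^sub>0 'k::field) set"
  assumes P: "maximalideal P (ring_on (semigroup_algebra S))"
  shows "\<exists>D f. 0 < D \<and> f D = 1 \<and> (\<Sum>j\<le>D. single (int j *s a i) (f j)) \<in> P"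
proof -
  let ?R = "semigroup_algebra S :: ((int ^ 'd) \<Rightarrow>\<^sub>0 'k) set"
  interpret localized_subdomain ?R P by (rule localized_maximal[OF P])
  define indep where "indep F \<longleftrightarrow> (\<forall>f \<in> semigroup_algebra (ray_cone F). f \<in> P \<longrightarrow> f = 0)" for F
  have constR: "const c \<in> ?R" for c by (rule single_mem_semigroup_algebra) simp
  have cone_empty: "ray_cone {} = {0}"
  proof -
    have "acomb n = 0" if "\<forall>v. n v = 0" for n using that by (simp add: acomb_def)
    then show ?thesis unfolding ray_cone_def by (force intro: exI[of _ "\<lambda>_. 0"])
  qed
  have const_form: "f = const (lookup f 0)" if "f \<in> semigroup_algebra (ray_cone {})"
    for f :: "(int ^ 'd) \<Rightarrow>\<^sub>0 'k"
    using semigroup_algebra_lookup[OF that, unfolded cone_empty]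
    by (intro poly_mapping_eqI) (auto simp: lookup_single when_def)
  have unit: "const c \<notin> P" if "c \<noteq> 0" for c
  proof
    assume "const c \<in> P"
    then have "const (inverse c) * const c \<in> P" by (rule idlD(4)[OF P_idl _ constR])
    then show False using const_inverse[OF that] P_one by metis
  qed
  have "indep {}"
    unfolding indep_def
  proof (intro ballI impI)
    fix f assume f: "f \<in> semigroup_algebra (ray_cone {})" "f \<in> P"
    then have "lookup f 0 = 0" using const_form[OF f(1)] unit[of "lookup f 0"] by metis
    then show "f = 0" using const_form[OF f(1)] by simp
  qed
  then obtain F where F: "indep F" "\<And>F'. indep F' \<Longrightarrow> F \<subseteq> F' \<Longrightarrow> F = F'"
    using finite_has_maximal2[of "{F. indep F}" "{}"] by auto
  have "F = {}"
  proof (rule no_independent_rays[OF P])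
    show "f = 0" if "f \<in> semigroup_algebra (ray_cone F)" "f \<in> P" for f
      using F(1) that unfolding indep_def by blast
    show "\<exists>f. f \<in> semigroup_algebra (ray_cone (insert i F)) \<and> f \<in> P \<and> f \<noteq> 0" if "i \<notin> F" for i
      using F(2)[of "insert i F"] that unfolding indep_def by blast
  qed
  then have "\<not> indep {i}" using F(2)[of "{i}"] by blast
  then obtain f where f: "f \<in> semigroup_algebra (ray_cone (insert i {}))" "f \<in> P" "f \<noteq> 0"
    unfolding indep_def by auto
  obtain D p where p: "\<forall>j. p j \<in> semigroup_algebra (ray_cone {})" "p D \<noteq> 0"
    "f = (\<Sum>j\<le>D. p j * mon (int j *s a i))"
    using expand_in_ray[OF f(1,3)] by blast
  define g where "g j = lookup (p j) 0" for j
  have pg: "p j = const (g j)" for j unfolding g_def using const_form p(1) by blast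
  have gD: "g D \<noteq> 0" using p(2) pg by auto
  have feq: "f = (\<Sum>j\<le>D. single (int j *s a i) (g j))"
    unfolding p(3) pg by (simp add: mult_single)
  have "0 < D"
  proof (rule ccontr)
    assume "\<not> 0 < D"
    then have "const (g D) \<in> P" using f(2) feq by simp
    then show False using unit[OF gD] by simp
  qed
  moreover have "const (inverse (g D)) * f \<in> P" by (rule idlD(4)[OF P_idl f(2) constR])
  then have "(\<Sum>j\<le>D. single (int j *s a i) (inverse (g D) * g j)) \<in> P"
    unfolding feq sum_distrib_left by (simp add: mult_single)
  ultimately show ?thesis using gD by (intro exI[of _ D] exI[of _ "\<lambda>j. inverse (g D) * g j"]) simp
qed

end

section \<open>Polynomials in the extremal monomials as a regular sequence\<close>

text \<open>The coefficient of \<open>y ^ (D - 1)\<close> in the remainder of \<open>y ^ n\<close> modulo the monic polynomial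
  of degree D with coefficients f; equivalently, the coefficient of \<open>y ^ (- n - 1)\<close> in the expansion
  of its inverse at infinity.\<close>

function residue_coeff :: "nat \<Rightarrow> (nat \<Rightarrow> 'k::field) \<Rightarrow> nat \<Rightarrow> 'k" where
  "residue_coeff D f n = (if n + 1 < D then 0 else if n + 1 = D then 1
    else - (\<Sum>j<D. f j * residue_coeff D f (n - D + j)))"
  by auto
termination by (relation "measure (\<lambda>(D, f, n). n)") auto

declare residue_coeff.simps [simp del]

definition residue_int :: "nat \<Rightarrow> (nat \<Rightarrow> 'k::field) \<Rightarrow> int \<Rightarrow> 'k" where
  "residue_int D f z = (if z < 0 then 0 else residue_coeff D f (nat z))"

lemma residue_int_small: "z < int D - 1 \<Longrightarrow> residue_int D f z = 0"
  by (auto simp: residue_int_def residue_coeff.simps)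

lemma residue_int_top: "0 < D \<Longrightarrow> residue_int D f (int D - 1) = 1"
  by (auto simp: residue_int_def residue_coeff.simps)

text \<open>With the extension by zero to negative indices the recurrence also covers the initial values; the index
  - 1 is the one where only the leading coefficient contributes.\<close>

lemma residue_int_recurrence:
  assumes D: "0 < D" and monic: "f D = 1"
  shows "(\<Sum>j\<le>D. f j * residue_int D f (z + int j)) = (if z = - 1 then 1 else 0)"
proof (cases "z < 0")
  case True
  have "(\<Sum>j\<le>D. f j * residue_int D f (z + int j)) = (\<Sum>j\<le>D. if j = D then residue_int D f (z + int D) else 0)"
    using True by (intro sum.cong) (auto simp: monic residue_int_small)
  also have "\<dots> = residue_int D f (z + int D)" by simp
  finally show ?thesis using True residue_int_small[of "z + int D" D f] residue_int_top[OF D, of f]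
    by (cases "z = - 1") auto
next
  case False
  then have "residue_int D f (z + int D) = residue_coeff D f (nat z + D)"
    by (simp add: residue_int_def nat_add_distrib)
  also have "\<dots> = - (\<Sum>j<D. f j * residue_coeff D f (nat z + j))"
    using D by (subst residue_coeff.simps) simp
  also have "(\<Sum>j<D. f j * residue_coeff D f (nat z + j)) = (\<Sum>j<D. f j * residue_int D f (z + int j))"
    using False by (intro sum.cong) (auto simp: residue_int_def nat_add_distrib)
  finally show ?thesis using False by (simp add: lessThan_Suc_atMost[symmetric] monic)
qed

text \<open>Every functional on the span of finitely many elements is represented by a combination of the
  rows of a matrix that is unitriangular with respect to some ranking.\<close>

lemma unitriangular_solvable:
  fixes M :: "'s \<Rightarrow> 's \<Rightarrow> 'k::field" and rank :: "'s \<Rightarrow> int"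
  assumes "finite X" and "\<And>s. s \<in> X \<Longrightarrow> M s s = 1"
    and "\<And>s t. s \<in> X \<Longrightarrow> t \<in> X \<Longrightarrow> s \<noteq> t \<Longrightarrow> M s t \<noteq> 0 \<Longrightarrow> rank t < rank s"
  shows "\<exists>c. \<forall>s\<in>X. (\<Sum>t\<in>X. c t * M s t) = \<mu> s"
  using assms
proof (induction X rule: finite_ranking_induct[where f = rank])
  case empty
  show ?case by simp
next
  case (insert x X)
  show ?case
  proof (cases "x \<in> X")
    case True
    then show ?thesis using insert by (simp add: insert_absorb)
  next
    case False
    obtain c where c: "\<forall>s\<in>X. (\<Sum>t\<in>X. c t * M s t) = \<mu> s" using insert by auto
    define c' where "c' = c(x := \<mu> x - (\<Sum>t\<in>X. c t * M x t))"
    have eq: "(\<Sum>t\<in>insert x X. c' t * M s t) = c' x * M s x + (\<Sum>t\<in>X. c t * M s t)" for s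
    proof -
      have "(\<Sum>t\<in>X. c' t * M s t) = (\<Sum>t\<in>X. c t * M s t)"
        using False by (intro sum.cong) (auto simp: c'_def)
      then show ?thesis using False insert.hyps(1) by simp
    qed
    have "(\<Sum>t\<in>insert x X. c' t * M s t) = \<mu> s" if s: "s \<in> insert x X" for s
    proof (cases "s = x")
      case True
      then show ?thesis unfolding eq using insert.prems(1)[of x] by (simp add: c'_def)
    next
      case sx: False
      then have "M s x = 0" using insert.prems(2)[of s x] insert.hyps(2)[of s] s by fastforce
      then show ?thesis unfolding eq using c s sx by simp
    qed
    then show ?thesis by blast
  qed
qed

lemma vector_space_laurent: "vector_space (\<lambda>(c :: 'k::field) (p :: (int ^ 'd) \<Rightarrow>\<^sub>0 'k). const c * p)"
  by unfold_locales (simp_all add: algebra_simps single_add mult_single flip: mult.assoc)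

text \<open>Extend a basis of J by v.\<close>

lemma separating_functional:
  fixes J :: "((int ^ 'd) \<Rightarrow>\<^sub>0 'k::field) set"
  assumes J: "0 \<in> J" "\<And>x y. x \<in> J \<Longrightarrow> y \<in> J \<Longrightarrow> x + y \<in> J" "\<And>c x. x \<in> J \<Longrightarrow> const c * x \<in> J"
    and v: "v \<notin> J"
  shows "\<exists>\<mu>. (\<forall>x y. \<mu> (x + y) = \<mu> x + \<mu> y) \<and> (\<forall>c x. \<mu> (const c * x) = c * (\<mu> x :: 'k)) \<and>
    (\<forall>x\<in>J. \<mu> x = 0) \<and> \<mu> v \<noteq> 0"
proof -
  interpret V: vector_space "\<lambda>(c :: 'k) (p :: (int ^ 'd) \<Rightarrow>\<^sub>0 'k). const c * p" by (rule vector_space_laurent)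
  have field: "vector_space ((*) :: 'k \<Rightarrow> 'k \<Rightarrow> 'k)" by unfold_locales (simp_all add: algebra_simps)
  interpret vector_space_pair "\<lambda>(c :: 'k) (p :: (int ^ 'd) \<Rightarrow>\<^sub>0 'k). const c * p" "(*) :: 'k \<Rightarrow> 'k \<Rightarrow> 'k"
    using V.vector_space_axioms field by (rule vector_space_pair.intro)
  have sub: "V.subspace J" using J by (intro V.subspaceI) auto
  obtain B where B: "B \<subseteq> J" "V.independent B" "J \<subseteq> V.span B"
    by (rule V.basis_exists[of J]) (rule that; assumption)
  have span: "V.span B = J" using B(1,3) sub by (rule V.span_subspace)
  then have ind: "V.independent (insert v B)" using v B(2) by (intro V.independent_insertI) auto
  obtain \<mu> where \<mu>: "Vector_Spaces.linear (\<lambda>(c :: 'k) p. const c * p) (*) \<mu>"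
    "\<forall>x\<in>insert v B. \<mu> x = (if x = v then 1 else (0 :: 'k))"
    using linear_independent_extend[OF ind, of "\<lambda>x. if x = v then 1 else 0"] by blast
  have lin: "\<mu> (x + y) = \<mu> x + \<mu> y" "\<mu> (const c * x) = c * \<mu> x" for x y c
    using \<mu>(1) unfolding Vector_Spaces.linear_iff by auto
  have "\<mu> 0 = 0" using lin(2)[of 0 0] by simp
  then have ker: "V.subspace {x. \<mu> x = 0}" by (intro V.subspaceI) (auto simp: lin)
  have "B \<subseteq> {x. \<mu> x = 0}" using \<mu>(2) v B(1) by auto
  then have "J \<subseteq> {x. \<mu> x = 0}" using V.span_minimal[OF _ ker] span by blast
  then show ?thesis using lin \<mu>(2) by (intro exI[of _ \<mu>]) auto
qed

text \<open>\<open>F i\<close> is the monic polynomial of degree \<open>D i\<close> with coefficients \<open>f i\<close> in the monomial of the i-th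
  extremal ray. The assumption \<open>fill\<close> is what the Cohen-Macaulay property says about S.\<close>

locale ray_polynomials = simplicial_semigroup S G a
  for S G :: "(int ^ 'd) set" and a :: "'d \<Rightarrow> int ^ 'd" +
  fixes D :: "'d \<Rightarrow> nat" and f :: "'d \<Rightarrow> nat \<Rightarrow> 'k::field"
  assumes D_pos: "0 < D i" and monic: "f i (D i) = 1"
    and fill: "b + int n *s a i \<in> S \<Longrightarrow> b + acomb m \<in> S \<Longrightarrow> m i = 0 \<Longrightarrow> b \<in> S"
begin

abbreviation R :: "((int ^ 'd) \<Rightarrow>\<^sub>0 'k) set" where "R \<equiv> semigroup_algebra S"

sublocale R: subdomain R by (rule subdomain_S)

definition F :: "'d \<Rightarrow> (int ^ 'd) \<Rightarrow>\<^sub>0 'k" where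
  "F i = (\<Sum>j\<le>D i. single (int j *s a i) (f i j))"

abbreviation L :: "'d \<Rightarrow> int \<Rightarrow> 'k" where "L i \<equiv> residue_int (D i) (f i)"

lemma F_R [simp, intro]: "F i \<in> R"
  unfolding F_def by (intro R.sum_mem single_mem_semigroup_algebra) auto

lemma const_R [simp, intro]: "const c \<in> R"
  by (rule single_mem_semigroup_algebra) simp

lemma scale_a_cancel: "m *s a i = n *s a i \<longleftrightarrow> m = n" for m n :: int
proof
  assume eq: "m *s a i = n *s a i"
  obtain k where "a i $ k \<noteq> 0" using a_nonzero[of i] by (auto simp: vec_eq_iff)
  moreover have "(m *s a i) $ k = (n *s a i) $ k" using eq by simp
  ultimately show "m = n" by simp
qed simp

text \<open>The coefficient at v of the expansion of \<open>1 / F i\<close> in negative powers.\<close>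

definition inverse_coeff :: "'d \<Rightarrow> int ^ 'd \<Rightarrow> 'k" where
  "inverse_coeff i v = (if \<exists>m. v = m *s a i then L i ((THE m. v = m *s a i) - 1) else 0)"

lemma inverse_coeff_scale: "inverse_coeff i (m *s a i) = L i (m - 1)"
proof -
  have "(THE n. m *s a i = n *s a i) = m" by (rule the_equality) (auto simp: scale_a_cancel)
  then show ?thesis unfolding inverse_coeff_def by auto
qed

lemma inverse_coeff_nonzero:
  assumes "inverse_coeff i v \<noteq> 0" obtains n where "0 < n" "v = int n *s a i"
proof -
  obtain m where m: "v = m *s a i" using assms unfolding inverse_coeff_def by (auto split: if_splits)
  have "L i (m - 1) \<noteq> 0" using assms inverse_coeff_scale m by simp
  then have "0 < m" using residue_int_small[of "m - 1" "D i" "f i"] D_pos[of i] by force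
  then show ?thesis using that[of "nat m"] m by simp
qed

lemma inverse_coeff_recurrence:
  "(\<Sum>j\<le>D i. f i j * inverse_coeff i (v + int j *s a i)) = (if v = 0 then 1 else 0)"
proof (cases "\<exists>m. v = m *s a i")
  case True
  then obtain m where m: "v = m *s a i" by blast
  have "inverse_coeff i (v + int j *s a i) = L i ((m - 1) + int j)" for j
    unfolding m vector_sadd_rdistrib[symmetric] inverse_coeff_scale by (simp add: algebra_simps)
  then have "(\<Sum>j\<le>D i. f i j * inverse_coeff i (v + int j *s a i)) = (if m - 1 = - 1 then 1 else 0)"
    using residue_int_recurrence[where D = "D i" and f = "f i" and z = "m - 1", OF D_pos monic] by simp
  also have "m - 1 = - 1 \<longleftrightarrow> v = 0" unfolding m using scale_a_cancel[of m i 0] by auto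
  finally show ?thesis .
next
  case False
  have "inverse_coeff i (v + int j *s a i) = 0" for j
  proof (rule ccontr)
    assume "inverse_coeff i (v + int j *s a i) \<noteq> 0"
    then obtain n where "v + int j *s a i = int n *s a i" by (rule inverse_coeff_nonzero)
    then have "v = (int n - int j) *s a i" by (simp add: vector_sub_rdistrib algebra_simps)
    then show False using False by blast
  qed
  moreover have "v \<noteq> 0" using False by (metis vector_smult_lzero)
  ultimately show ?thesis by simp
qed

text \<open>The part of \<open>p / F i\<close> that is supported in S. Division by \<open>F i\<close> recovers a multiple of
  \<open>F i\<close>, and it commutes with the other polynomials, so that the sequence is regular.\<close>

definition quot_fun :: "'d \<Rightarrow> ((int ^ 'd) \<Rightarrow>\<^sub>0 'k) \<Rightarrow> int ^ 'd \<Rightarrow> 'k" where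
  "quot_fun i p t = (if t \<in> S then
    \<Sum>s\<in>keys p. lookup p s * inverse_coeff i (s - t) else 0)"

definition quot :: "'d \<Rightarrow> ((int ^ 'd) \<Rightarrow>\<^sub>0 'k) \<Rightarrow> (int ^ 'd) \<Rightarrow>\<^sub>0 'k" where
  "quot i p = Abs_poly_mapping (quot_fun i p)"

lemma finite_quot_fun: "finite {t. quot_fun i p t \<noteq> 0}"
proof -
  let ?T = "(\<lambda>(s, n). s - int n *s a i) ` (Sigma (keys p) (\<lambda>s. {..nat (total_degree s)}))"
  have "{t. quot_fun i p t \<noteq> 0} \<subseteq> ?T"
  proof
    fix t assume "t \<in> {t. quot_fun i p t \<noteq> 0}"
    then have t: "t \<in> S" "(\<Sum>s\<in>keys p. lookup p s * inverse_coeff i (s - t)) \<noteq> 0"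
      by (auto simp: quot_fun_def split: if_splits)
    then obtain s where s: "s \<in> keys p" "inverse_coeff i (s - t) \<noteq> 0"
      by (metis (no_types, lifting) mult_zero_right sum.neutral)
    obtain n where n: "0 < n" "s - t = int n *s a i" using s(2) by (rule inverse_coeff_nonzero)
    have eq: "s = t + int n *s a i" using n(2) by (simp add: algebra_simps)
    have "int n * 1 \<le> int n * total_degree (a i)"
      using total_degree_pos[OF a_S a_nonzero, of i] by (intro mult_left_mono) auto
    then have "int n \<le> total_degree s"
      using total_degree_nonneg[OF t(1)] unfolding eq total_degree_add total_degree_scale by simp
    then have "(s, n) \<in> Sigma (keys p) (\<lambda>s. {..nat (total_degree s)})" using s(1) by auto
    moreover have "t = (\<lambda>(s, n). s - int n *s a i) (s, n)" using eq by simp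
    ultimately show "t \<in> ?T" by blast
  qed
  then show ?thesis by (rule finite_subset) (intro finite_imageI finite_SigmaI; simp)
qed

lemma lookup_quot:
  assumes "finite K" "keys p \<subseteq> K"
  shows "lookup (quot i p) t =
    (if t \<in> S then \<Sum>s\<in>K. lookup p s * inverse_coeff i (s - t) else 0)"
proof -
  have "lookup (quot i p) t = quot_fun i p t"
    unfolding quot_def using finite_quot_fun by (simp add: lookup_Abs_poly_mapping)
  also have "(\<Sum>s\<in>keys p. lookup p s * inverse_coeff i (s - t)) =
    (\<Sum>s\<in>K. lookup p s * inverse_coeff i (s - t))"
    using assms by (intro sum.mono_neutral_left) (auto simp: not_in_keys_iff_lookup_eq_zero)
  then have "quot_fun i p t =
    (if t \<in> S then \<Sum>s\<in>K. lookup p s * inverse_coeff i (s - t) else 0)"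
    by (simp add: quot_fun_def)
  finally show ?thesis .
qed

lemma quot_R [simp, intro]: "quot i p \<in> R"
  by (rule semigroup_algebraI) (auto simp: lookup_quot[OF finite_keys order_refl] split: if_splits)

lemma quot_add: "quot i (p + q) = quot i p + quot i q"
proof (rule poly_mapping_eqI)
  fix t
  let ?K = "keys p \<union> keys q"
  have "keys (p + q) \<subseteq> ?K" by (rule Poly_Mapping.keys_add)
  then show "lookup (quot i (p + q)) t = lookup (quot i p + quot i q) t"
    by (simp add: lookup_quot[of ?K] lookup_add distrib_right sum.distrib)
qed

lemma quot_zero [simp]: "quot i 0 = 0"
  using quot_add[of i 0 0] by simp

lemma quot_sum: "quot i (\<Sum>j\<in>J. g j) = (\<Sum>j\<in>J. quot i (g j))"
  by (induction J rule: infinite_finite_induct) (simp_all add: quot_add)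

lemma keys_single_mult_subset: "keys (single u c * p) \<subseteq> (+) u ` keys p"
  for p :: "(int ^ 'd) \<Rightarrow>\<^sub>0 'k"
  using keys_mult[of "single u c" p] by (force split: if_splits)

lemma sum_single_mult:
  "(\<Sum>s\<in>(+) u ` keys p. lookup (single u c * p) s * h s) =
    (\<Sum>s\<in>keys p. lookup p s * (c * h (s + u)))"
  for p :: "(int ^ 'd) \<Rightarrow>\<^sub>0 'k"
  by (subst sum.reindex) (simp_all add: lookup_single_mult add.commute mult.assoc mult.left_commute)

lemma lookup_quot_single_mult:
  "lookup (quot i (single u c * p)) t = (if t \<in> S then
    \<Sum>s\<in>keys p. lookup p s * (c * inverse_coeff i (s + u - t)) else 0)"
  by (subst lookup_quot[OF _ keys_single_mult_subset]) (simp_all add: sum_single_mult)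

lemma lookup_quot_F_mult:
  "lookup (quot i (F k * p)) t = (if t \<in> S then
    \<Sum>s\<in>keys p. lookup p s *
      (\<Sum>j\<le>D k. f k j * inverse_coeff i (s - t + int j *s a k)) else 0)"
proof -
  have "lookup (quot i (F k * p)) t =
    (\<Sum>j\<le>D k. lookup (quot i (single (int j *s a k) (f k j) * p)) t)"
    by (simp add: F_def sum_distrib_right quot_sum lookup_sum)
  also have "\<dots> = (if t \<in> S then (\<Sum>j\<le>D k. \<Sum>s\<in>keys p. lookup p s *
      (f k j * inverse_coeff i (s - t + int j *s a k))) else 0)"
    by (cases "t \<in> S") (simp_all add: lookup_quot_single_mult diff_add_eq)
  also have "(\<Sum>j\<le>D k. \<Sum>s\<in>keys p. lookup p s *
      (f k j * inverse_coeff i (s - t + int j *s a k))) =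
    (\<Sum>s\<in>keys p. lookup p s *
      (\<Sum>j\<le>D k. f k j * inverse_coeff i (s - t + int j *s a k)))"
    by (subst sum.swap) (simp add: sum_distrib_left)
  finally show ?thesis .
qed

lemma quot_F_same:
  assumes "p \<in> R" shows "quot i (F i * p) = p"
proof (rule poly_mapping_eqI)
  fix t
  have "(\<Sum>s\<in>keys p. lookup p s *
      (\<Sum>j\<le>D i. f i j * inverse_coeff i (s - t + int j *s a i))) =
    (\<Sum>s\<in>keys p. if s = t then lookup p s else 0)"
    by (intro sum.cong) (simp_all add: inverse_coeff_recurrence)
  also have "\<dots> = lookup p t"
    by (simp add: not_in_keys_iff_lookup_eq_zero)
  finally show "lookup (quot i (F i * p)) t = lookup p t"
    using semigroup_algebra_lookup[OF assms] by (simp add: lookup_quot_F_mult)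
qed

lemma quot_F_other:
  assumes p: "p \<in> R" and "i \<noteq> k"
  shows "quot i (F k * p) = F k * quot i p"
proof (rule poly_mapping_eqI)
  fix t
  have "lookup (F k * quot i p) t =
    (\<Sum>j\<le>D k. f k j * lookup (quot i p) (t - int j *s a k))"
    by (simp add: F_def sum_distrib_right lookup_sum lookup_single_mult)
  also have "\<dots> = (\<Sum>j\<le>D k. if t \<in> S then (\<Sum>s\<in>keys p. lookup p s *
      (f k j * inverse_coeff i (s - t + int j *s a k))) else 0)"
  proof (rule sum.cong[OF refl])
    fix j
    show "f k j * lookup (quot i p) (t - int j *s a k) =
      (if t \<in> S then (\<Sum>s\<in>keys p. lookup p s *
      (f k j * inverse_coeff i (s - t + int j *s a k))) else 0)"
    proof (cases "t - int j *s a k \<in> S")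
      case True
      then have "t \<in> S" using add_S[OF True scale_S[OF a_S], of j k] by simp
      then show ?thesis using True
        by (simp add: lookup_quot[OF finite_keys order_refl] sum_distrib_left algebra_simps)
    next
      case False
      have zero: "inverse_coeff i (s - t + int j *s a k) = 0" if "t \<in> S" "s \<in> keys p" for s
      proof (rule ccontr)
        assume "inverse_coeff i (s - t + int j *s a k) \<noteq> 0"
        then obtain n where "s - t + int j *s a k = int n *s a i" by (rule inverse_coeff_nonzero)
        then have "(t - int j *s a k) + int n *s a i = s" by (simp add: algebra_simps)
        moreover have "s \<in> S" using p that(2) by (auto simp: semigroup_algebra_def)
        moreover have "(t - int j *s a k) + acomb (\<lambda>v. if v = k then j else 0) \<in> S"
          using that(1) by (simp add: acomb_single)
        ultimately have "t - int j *s a k \<in> S"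
          using fill[of "t - int j *s a k" n i "\<lambda>v. if v = k then j else 0"] assms(2) by simp
        then show False using False by simp
      qed
      then show ?thesis using False by (simp add: lookup_quot[OF finite_keys order_refl])
    qed
  qed
  also have "\<dots> = lookup (quot i (F k * p)) t"
    unfolding lookup_quot_F_mult by (subst sum_distrib_left, subst sum.swap) simp
  finally show "lookup (quot i (F k * p)) t = lookup (F k * quot i p) t" ..
qed

definition F_ideal :: "'d set \<Rightarrow> ((int ^ 'd) \<Rightarrow>\<^sub>0 'k) set" where
  "F_ideal J = {\<Sum>k\<in>J. F k * b k | b. \<forall>k. b k \<in> R}"

lemma F_ideal_idl: "R.idl (F_ideal J)"
  unfolding R.idl_def
proof (intro conjI ballI)
  show "F_ideal J \<subseteq> R" unfolding F_ideal_def by (auto intro!: R.sum_mem R.mult_mem)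
  show "0 \<in> F_ideal J" unfolding F_ideal_def by (auto intro!: exI[of _ "\<lambda>_. 0"])
  fix x assume "x \<in> F_ideal J"
  then obtain b where b: "x = (\<Sum>k\<in>J. F k * b k)" "\<forall>k. b k \<in> R" unfolding F_ideal_def by blast
  { fix y assume "y \<in> F_ideal J"
    then obtain c where c: "y = (\<Sum>k\<in>J. F k * c k)" "\<forall>k. c k \<in> R" unfolding F_ideal_def by blast
    have "x + y = (\<Sum>k\<in>J. F k * (b k + c k))" unfolding b(1) c(1) by (simp add: sum.distrib algebra_simps)
    moreover have "\<forall>k. b k + c k \<in> R" using b(2) c(2) by blast
    ultimately show "x + y \<in> F_ideal J" unfolding F_ideal_def
      by (intro CollectI exI[of _ "\<lambda>k. b k + c k"] conjI) }
  { fix r assume r: "r \<in> R"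
    have "r * x = (\<Sum>k\<in>J. F k * (r * b k))" unfolding b(1) by (simp add: sum_distrib_left algebra_simps)
    moreover have "\<forall>k. r * b k \<in> R" using b(2) r by blast
    ultimately show "r * x \<in> F_ideal J" unfolding F_ideal_def
      by (intro CollectI exI[of _ "\<lambda>k. r * b k"] conjI) }
qed

lemma F_mem_ideal: "k \<in> J \<Longrightarrow> finite J \<Longrightarrow> b \<in> R \<Longrightarrow> F k * b \<in> F_ideal J"
  unfolding F_ideal_def
  by (auto intro!: exI[of _ "\<lambda>j. if j = k then b else 0"] simp: if_distrib[of "(*) _"] cong: if_cong)

text \<open>Division by \<open>F i\<close> turns an expression of \<open>F i * p\<close> through the other polynomials into one of p.\<close>

lemma F_regular:
  assumes "i \<notin> J" "p \<in> R" "F i * p \<in> F_ideal J"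
  shows "p \<in> F_ideal J"
proof -
  obtain b where b: "F i * p = (\<Sum>k\<in>J. F k * b k)" "\<forall>k. b k \<in> R" using assms(3) unfolding F_ideal_def by blast
  have "p = quot i (\<Sum>k\<in>J. F k * b k)" using quot_F_same[OF assms(2)] b(1) by metis
  also have "\<dots> = (\<Sum>k\<in>J. F k * quot i (b k))"
    unfolding quot_sum using b(2) assms(1) by (intro sum.cong refl quot_F_other) auto
  finally show ?thesis unfolding F_ideal_def
    by (intro CollectI exI[of _ "\<lambda>k. quot i (b k)"] conjI allI quot_R)
qed

section \<open>The Frobenius form of the quotient by the ray polynomials\<close>

definition intcomb :: "('d \<Rightarrow> int) \<Rightarrow> int ^ 'd" where
  "intcomb z = (\<Sum>i\<in>UNIV. z i *s a i)"

lemma intcomb_inject: "intcomb z = intcomb w \<longleftrightarrow> z = w"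
proof
  assume eq: "intcomb z = intcomb w"
  have "(\<Sum>i\<in>UNIV. (of_int (z i - w i) :: rat) *s rat_vec (a i)) = rat_vec (intcomb z) - rat_vec (intcomb w)"
    by (simp add: intcomb_def rat_vec_sum rat_vec_scale sum_subtractf vector_sub_rdistrib)
  then have "of_int (z i - w i) = (0 :: rat)" for i using a_independent[of "\<lambda>i. of_int (z i - w i)"] eq by simp
  then show "z = w" by auto
qed simp

lemma intcomb_nat: "intcomb (\<lambda>i. int (n i)) = acomb n"
  by (simp add: intcomb_def acomb_def)

lemma intcomb_diff: "intcomb z - intcomb w = intcomb (\<lambda>i. z i - w i)"
  by (simp add: intcomb_def sum_subtractf vector_sub_rdistrib)

lemma intcomb_add_single: "intcomb z + k *s a i = intcomb (z(i := z i + k))"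
proof -
  have "intcomb (z(i := z i + k)) = (\<Sum>j\<in>UNIV. z j *s a j + (if j = i then k *s a j else 0))"
    unfolding intcomb_def by (intro sum.cong) (auto simp: vector_sadd_rdistrib)
  then show ?thesis by (simp add: sum.distrib intcomb_def)
qed

end

text \<open>R/I has a basis of monomials \<open>w + r\<close>, where w runs through the Apery set and the exponents
  \<open>r i < D i\<close> through the rays. If the Apery set has a greatest element m, then w and \<open>m - w\<close>, and r and
  \<open>D - 1 - r\<close>, are complementary, and the coefficient of the monomial \<open>m + (D - 1)\<close> defines a bilinear
  form on R/I that is unitriangular with respect to this pairing of the basis.\<close>

locale greatest_apery = ray_polynomials S G a D f
  for S G :: "(int ^ 'd) set" and a :: "'d \<Rightarrow> int ^ 'd" and D :: "'d \<Rightarrow> nat" and f :: "'d \<Rightarrow> nat \<Rightarrow> 'k::field" +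
  fixes m :: "int ^ 'd"
  assumes m_apery: "m \<in> apery S a" and greatest: "w \<in> apery S a \<Longrightarrow> m - w \<in> S"
begin

definition form_coeff :: "int ^ 'd \<Rightarrow> 'k" where
  "form_coeff s = (if \<exists>z. s = m + intcomb z then (\<Prod>i\<in>UNIV. L i ((THE z. s = m + intcomb z) i)) else 0)"

lemma form_coeff_comb: "form_coeff (m + intcomb z) = (\<Prod>i\<in>UNIV. L i (z i))"
proof -
  have "(THE w. m + intcomb z = m + intcomb w) = z" by (rule the_equality) (auto simp: intcomb_inject)
  then show ?thesis unfolding form_coeff_def by auto
qed

definition form :: "((int ^ 'd) \<Rightarrow>\<^sub>0 'k) \<Rightarrow> 'k" where
  "form p = (\<Sum>s\<in>keys p. lookup p s * form_coeff s)"

lemma form_superset: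
  assumes "finite K" "keys p \<subseteq> K"
  shows "form p = (\<Sum>s\<in>K. lookup p s * form_coeff s)"
  unfolding form_def using assms by (intro sum.mono_neutral_left) (auto simp: not_in_keys_iff_lookup_eq_zero)

lemma form_add: "form (p + q) = form p + form q"
  using form_superset[of "keys p \<union> keys q" "p + q"] Poly_Mapping.keys_add[of p q]
    form_superset[of "keys p \<union> keys q" p]
    form_superset[of "keys p \<union> keys q" q]
  by (simp add: lookup_add distrib_right sum.distrib)

lemma form_zero [simp]: "form 0 = 0"
  by (simp add: form_def)

lemma form_sum: "form (\<Sum>j\<in>J. g j) = (\<Sum>j\<in>J. form (g j))"
  by (induction J rule: infinite_finite_induct) (simp_all add: form_add)

lemma form_single_mult:
  "form (single u c * p) = (\<Sum>s\<in>keys p. lookup p s * (c * form_coeff (s + u)))"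
  by (subst form_superset[OF _ keys_single_mult_subset]) (simp_all add: sum_single_mult)

lemma form_scale: "form (const c * p) = c * form p"
  unfolding form_single_mult form_def[of p] by (simp add: sum_distrib_left mult.left_commute)

lemma form_mon: "form (mon s) = form_coeff s"
  by (simp add: form_def)

text \<open>The recurrence can fail to vanish only at an exponent - 1 of the i-th ray, with nonnegative exponents of
  all others. But then \<open>m - a i\<close> would fill into S, although m lies in the Apery set.\<close>

lemma form_coeff_recurrence:
  assumes s: "s \<in> S"
  shows "(\<Sum>j\<le>D i. f i j * form_coeff (s + int j *s a i)) = 0"
proof (cases "\<exists>z. s = m + intcomb z")
  case True
  then obtain z where z: "s = m + intcomb z" by blast
  have "form_coeff (s + int j *s a i) = (\<Prod>k\<in>UNIV - {i}. L k (z k)) * L i (z i + int j)" for j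
  proof -
    have "form_coeff (s + int j *s a i) = (\<Prod>k\<in>UNIV. L k ((z(i := z i + int j)) k))"
      unfolding z add.assoc intcomb_add_single form_coeff_comb ..
    also have "\<dots> = L i (z i + int j) * (\<Prod>k\<in>UNIV - {i}. L k ((z(i := z i + int j)) k))"
      by (subst prod.remove[of _ i]) auto
    also have "(\<Prod>k\<in>UNIV - {i}. L k ((z(i := z i + int j)) k)) = (\<Prod>k\<in>UNIV - {i}. L k (z k))"
      by (intro prod.cong) auto
    finally show ?thesis by (simp add: mult.commute)
  qed
  then have "(\<Sum>j\<le>D i. f i j * form_coeff (s + int j *s a i)) =
    (\<Prod>k\<in>UNIV - {i}. L k (z k)) * (\<Sum>j\<le>D i. f i j * L i (z i + int j))"
    by (simp add: sum_distrib_left algebra_simps)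
  also have "(\<Sum>j\<le>D i. f i j * L i (z i + int j)) = (if z i = - 1 then 1 else 0)"
    by (rule residue_int_recurrence[where D = "D i" and f = "f i", OF D_pos monic])
  also have "(\<Prod>k\<in>UNIV - {i}. L k (z k)) * (if z i = - 1 then 1 else 0) = 0"
  proof (rule ccontr)
    assume nz: "\<not> ?thesis"
    then have zi: "z i = - 1" by (auto split: if_splits)
    have nonneg_z: "0 \<le> z k" if "k \<noteq> i" for k
    proof (rule ccontr)
      assume "\<not> 0 \<le> z k"
      then have "L k (z k) = 0" by (simp add: residue_int_def)
      then show False using nz that by (auto simp: prod_zero_iff)
    qed
    define n where "n k = (if k = i then 0 else nat (z k))" for k
    have "z = (\<lambda>k. int (n k))(i := int (n i) + (- 1))"
      using zi nonneg_z by (auto simp: n_def fun_eq_iff)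
    then have "intcomb z = acomb n + (- 1) *s a i" unfolding intcomb_nat[symmetric] intcomb_add_single by metis
    then have "(m - a i) + acomb n = s" unfolding z by (simp add: vec_eq_iff)
    moreover have "(m - a i) + int 1 *s a i \<in> S" using m_apery by (simp add: apery_def)
    ultimately have "m - a i \<in> S" using fill[of "m - a i" 1 i n] s by (simp add: n_def)
    then show False using m_apery by (simp add: apery_def)
  qed
  finally show ?thesis .
next
  case False
  have "form_coeff (s + int j *s a i) = 0" for j
  proof -
    have "\<not> (\<exists>z. s + int j *s a i = m + intcomb z)"
    proof
      assume "\<exists>z. s + int j *s a i = m + intcomb z"
      then obtain z where "s + int j *s a i = m + intcomb z" by blast
      then have "s = m + (intcomb z + (- int j) *s a i)" by (simp add: vec_eq_iff algebra_simps)
      then show False using False unfolding intcomb_add_single by blast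
    qed
    then show ?thesis by (simp add: form_coeff_def)
  qed
  then show ?thesis by simp
qed

lemma form_F: "p \<in> R \<Longrightarrow> form (F i * p) = 0"
proof -
  assume p: "p \<in> R"
  have "form (F i * p) = (\<Sum>j\<le>D i. \<Sum>s\<in>keys p. lookup p s *
      (f i j * form_coeff (s + int j *s a i)))"
    by (simp add: F_def sum_distrib_right form_sum form_single_mult)
  also have "\<dots> = (\<Sum>s\<in>keys p. lookup p s *
      (\<Sum>j\<le>D i. f i j * form_coeff (s + int j *s a i)))"
    by (subst sum.swap) (simp add: sum_distrib_left)
  also have "\<dots> = 0"
    using p form_coeff_recurrence by (intro sum.neutral) (auto simp: semigroup_algebra_def)
  finally show ?thesis .
qed

abbreviation I :: "((int ^ 'd) \<Rightarrow>\<^sub>0 'k) set" where "I \<equiv> F_ideal UNIV"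

lemma form_I: "p \<in> I \<Longrightarrow> form p = 0"
  unfolding F_ideal_def by (auto simp: form_sum form_F)

definition reduced :: "(int ^ 'd) set" where
  "reduced = {s \<in> S. \<forall>i. s - int (D i) *s a i \<notin> S}"

lemma finite_reduced_set: "finite reduced"
  unfolding reduced_def by (rule finite_reduced)

lemma apery_decomposition: "s \<in> S \<Longrightarrow> \<exists>w n. w \<in> apery S a \<and> s = w + acomb n"
proof (induction "nat (total_degree s)" arbitrary: s rule: less_induct)
  case less
  show ?case
  proof (cases "s \<in> apery S a")
    case True
    then show ?thesis by (intro exI[of _ s] exI[of _ "\<lambda>_. 0"]) simp
  next
    case False
    then obtain i where i: "s - a i \<in> S" using less.prems by (auto simp: apery_def)
    have "nat (total_degree (s - a i)) < nat (total_degree s)"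
      using total_degree_pos[OF a_S a_nonzero, of i] total_degree_nonneg[OF i] by (simp add: total_degree_diff)
    then obtain w n where w: "w \<in> apery S a" "s - a i = w + acomb n" using less.hyps i by blast
    then have "s = w + (acomb n + int 1 *s a i)" by (simp add: algebra_simps)
    also have "\<dots> = w + acomb (\<lambda>j. n j + (if j = i then 1 else 0))"
      unfolding acomb_single[symmetric] acomb_add ..
    finally show ?thesis using w(1) by blast
  qed
qed

definition top_exponent :: "int ^ 'd" where
  "top_exponent = m + acomb (\<lambda>i. D i - 1)"

lemma complement_reduced:
  assumes s: "s \<in> reduced" shows "top_exponent - s \<in> S"
proof -
  obtain w n where w: "w \<in> apery S a" "s = w + acomb n"
    using s apery_decomposition unfolding reduced_def by blast
  have le: "n i \<le> D i - 1" for i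
  proof (rule ccontr)
    assume "\<not> n i \<le> D i - 1"
    then have "n i = (n i - D i) + D i" using D_pos[of i] by simp
    then have "acomb n = acomb (n(i := n i - D i)) + acomb (\<lambda>j. if j = i then D i else 0)"
      unfolding acomb_add by (intro arg_cong[of _ _ acomb]) auto
    then have "s - int (D i) *s a i = w + acomb (n(i := n i - D i))"
      unfolding w(2) acomb_single by simp
    moreover have "w + acomb (n(i := n i - D i)) \<in> S" using w(1) by (auto simp: apery_def)
    ultimately have "s - int (D i) *s a i \<in> S" by metis
    then show False using s unfolding reduced_def by blast
  qed
  have "acomb (\<lambda>i. D i - 1) = acomb n + acomb (\<lambda>i. D i - 1 - n i)"
    unfolding acomb_add by (intro arg_cong[of _ _ acomb] ext le_add_diff_inverse[symmetric] le)
  then have "top_exponent - s = (m - w) + acomb (\<lambda>i. D i - 1 - n i)" unfolding top_exponent_def w(2) by simp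
  then show ?thesis using greatest[OF w(1)] by auto
qed

lemma form_coeff_top_exponent: "form_coeff top_exponent = 1"
proof -
  have "form_coeff (m + intcomb (\<lambda>i. int (D i - 1))) = (\<Prod>i\<in>UNIV. L i (int (D i - 1)))"
    by (rule form_coeff_comb)
  also have "L i (int (D i - 1)) = 1" for i
    using residue_int_top[OF D_pos[of i], of "f i"] D_pos[of i] by (simp add: of_nat_diff Suc_leI)
  then have "(\<Prod>i\<in>UNIV. L i (int (D i - 1))) = 1" by simp
  finally show ?thesis by (simp add: top_exponent_def intcomb_nat)
qed

text \<open>A nonzero value requires all ray exponents to be at least \<open>D i - 1\<close>; so \<open>s - t\<close> is a nonnegative
  combination of the rays.\<close>

lemma form_coeff_triangular:
  assumes "s \<noteq> t" "form_coeff (s + (top_exponent - t)) \<noteq> 0"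
  shows "total_degree t < total_degree s"
proof -
  obtain z where z: "s + (top_exponent - t) = m + intcomb z" using assms(2) by (auto simp: form_coeff_def split: if_splits)
  have "(\<Prod>i\<in>UNIV. L i (z i)) \<noteq> 0" using assms(2) unfolding z form_coeff_comb .
  then have "L i (z i) \<noteq> 0" for i by (auto simp: prod_zero_iff)
  then have ge: "int (D i) - 1 \<le> z i" for i using residue_int_small[of "z i" "D i" "f i"] by force
  define n where "n i = nat (z i - (int (D i) - 1))" for i
  have "s - t = intcomb z - acomb (\<lambda>i. D i - 1)" using z by (simp add: top_exponent_def algebra_simps)
  also have "\<dots> = intcomb (\<lambda>i. int (n i))"
    unfolding intcomb_nat[symmetric] intcomb_diff using ge D_pos
    by (intro arg_cong[of _ _ intcomb]) (auto simp: n_def of_nat_diff Suc_leI)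
  finally have "s - t = acomb n" by (simp add: intcomb_nat)
  then have "s - t \<in> S" by simp
  then show ?thesis using total_degree_pos[of "s - t"] assms(1) by (simp add: total_degree_diff)
qed

lemma reduced_spans:
  assumes "p \<in> R" shows "\<exists>c. p - (\<Sum>t\<in>reduced. const (c t) * mon t) \<in> I"
proof -
  note II = R.idlD[OF F_ideal_idl[of UNIV]]
  define spans where "spans p \<longleftrightarrow> (\<exists>c. p - (\<Sum>t\<in>reduced. const (c t) * mon t) \<in> I)" for p
  have add: "spans (p + q)" if pq: "spans p" "spans q" for p q
  proof -
    obtain c e where ce: "p - (\<Sum>t\<in>reduced. const (c t) * mon t) \<in> I"
      "q - (\<Sum>t\<in>reduced. const (e t) * mon t) \<in> I" using pq unfolding spans_def by blast
    have "(p + q) - (\<Sum>t\<in>reduced. const (c t + e t) * mon t) =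
      (p - (\<Sum>t\<in>reduced. const (c t) * mon t)) + (q - (\<Sum>t\<in>reduced. const (e t) * mon t))"
      by (simp add: single_add distrib_right sum.distrib)
    then show ?thesis unfolding spans_def using II(3)[OF ce] by metis
  qed
  have scale: "spans (const b * p)" if p: "spans p" for b p
  proof -
    obtain c where c: "p - (\<Sum>t\<in>reduced. const (c t) * mon t) \<in> I" using p unfolding spans_def by blast
    have "const b * p - (\<Sum>t\<in>reduced. const (b * c t) * mon t) =
      const b * (p - (\<Sum>t\<in>reduced. const (c t) * mon t))"
      by (simp add: right_diff_distrib sum_distrib_left mult_single)
    then show ?thesis unfolding spans_def using II(4)[OF c const_R[of b]]
      by (intro exI[of _ "\<lambda>t. b * c t"]) simp
  qed
  have ideal: "spans p" if "p \<in> I" for p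
    unfolding spans_def using that by (intro exI[of _ "\<lambda>_. 0"]) simp
  have sum: "spans (\<Sum>j\<in>J. g j)" if "\<And>j. j \<in> J \<Longrightarrow> spans (g j)" for g and J :: "'j set"
    using that by (induction J rule: infinite_finite_induct) (auto intro: add ideal II(2))
  have mon_spans: "spans (mon s)" if "s \<in> S" for s
    using that
  proof (induction "nat (total_degree s)" arbitrary: s rule: less_induct)
    case less
    show ?case
    proof (cases "s \<in> reduced")
      case True
      have "(\<Sum>t\<in>reduced. const (if t = s then 1 else 0) * mon t) =
        (\<Sum>t\<in>reduced. if t = s then mon t else (0 :: (int ^ 'd) \<Rightarrow>\<^sub>0 'k))"
        by (intro sum.cong) (auto simp: mult_single)
      also have "\<dots> = mon s" using True finite_reduced_set by simp
      finally show ?thesis unfolding spans_def using II(2)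
        by (intro exI[of _ "\<lambda>t. if t = s then 1 else 0"]) simp
    next
      case False
      then obtain i where i: "s - int (D i) *s a i \<in> S" using less.prems by (auto simp: reduced_def)
      define t where "t = s - int (D i) *s a i"
      have s: "s = t + int (D i) *s a i" and t: "t \<in> S" using i by (simp_all add: t_def)
      have smaller: "spans (mon (t + int j *s a i))" if j: "j < D i" for j
      proof (rule less.hyps)
        show tj: "t + int j *s a i \<in> S" using t by blast
        have "int j * total_degree (a i) < int (D i) * total_degree (a i)"
          using j total_degree_pos[OF a_S a_nonzero, of i] by simp
        then show "nat (total_degree (t + int j *s a i)) < nat (total_degree s)"
          unfolding s using total_degree_nonneg[OF tj]
          by (simp add: total_degree_add total_degree_scale)
      qed
      have "F i * mon t = mon s + (\<Sum>j<D i. const (f i j) * mon (t + int j *s a i))"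
        unfolding s F_def by (simp add: lessThan_Suc_atMost[symmetric] monic distrib_right sum_distrib_right
            mult_single add.commute)
      then have "mon s = F i * mon t + (\<Sum>j<D i. const (- f i j) * mon (t + int j *s a i))"
        by (simp add: single_uminus sum_negf)
      moreover have "F i * mon t \<in> I" using t by (intro F_mem_ideal single_mem_semigroup_algebra) auto
      ultimately show ?thesis using add ideal sum[of "{..<D i}"] scale smaller by (metis (no_types, lifting) lessThan_iff)
    qed
  qed
  have expand: "(\<Sum>s\<in>keys p. const (lookup p s) * mon s) = p"
    using poly_mapping_expand[of p, symmetric] by (simp add: mult_single)
  moreover have "spans (\<Sum>s\<in>keys p. const (lookup p s) * mon s)"
    using assms by (intro sum scale mon_spans) (auto simp: semigroup_algebra_def)
  ultimately have "spans p" by simp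
  then show ?thesis unfolding spans_def .
qed

text \<open>The basis of R/I turns the equation into a unitriangular system for the coefficients of z.\<close>

lemma functional_represented:
  assumes \<mu>: "\<And>x y. \<mu> (x + y) = \<mu> x + \<mu> y" "\<And>c x. \<mu> (const c * x) = c * (\<mu> x :: 'k)"
    and ker: "\<And>x. x \<in> I \<Longrightarrow> \<mu> x = 0"
  shows "\<exists>z\<in>R. \<forall>r\<in>R. \<mu> r = form (z * r)"
proof -
  have \<mu>0: "\<mu> 0 = 0" using \<mu>(2)[of 0 0] by simp
  have \<mu>_sum: "\<mu> (\<Sum>j\<in>J. g j) = (\<Sum>j\<in>J. \<mu> (g j))" for g and J :: "(int ^ 'd) set"
    by (induction J rule: infinite_finite_induct) (simp_all add: \<mu> \<mu>0)
  obtain c where c: "\<And>s. s \<in> reduced \<Longrightarrow> (\<Sum>t\<in>reduced. c t * form_coeff (s + (top_exponent - t))) = \<mu> (mon s)"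
    using unitriangular_solvable[OF finite_reduced_set, of "\<lambda>s t. form_coeff (s + (top_exponent - t))" total_degree "\<lambda>s. \<mu> (mon s)"]
      form_coeff_top_exponent form_coeff_triangular by auto
  define z where "z = (\<Sum>t\<in>reduced. const (c t) * mon (top_exponent - t))"
  have zR: "z \<in> R" unfolding z_def using complement_reduced
    by (intro R.sum_mem R.mult_mem const_R single_mem_semigroup_algebra)
  have mon: "form (z * mon s) = \<mu> (mon s)" if "s \<in> reduced" for s
  proof -
    have "form (z * mon s) = (\<Sum>t\<in>reduced. form (const (c t) * mon (s + (top_exponent - t))))"
      unfolding z_def sum_distrib_right form_sum by (intro sum.cong) (simp_all add: mult_single add.commute)
    also have "\<dots> = \<mu> (mon s)" using c[OF that] by (simp only: form_scale form_mon)
    finally show ?thesis .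
  qed
  have "\<mu> r = form (z * r)" if r: "r \<in> R" for r
  proof -
    obtain e where e: "r - (\<Sum>t\<in>reduced. const (e t) * mon t) \<in> I" using reduced_spans[OF r] by blast
    define q where "q = r - (\<Sum>t\<in>reduced. const (e t) * mon t)"
    have r_eq: "r = q + (\<Sum>t\<in>reduced. const (e t) * mon t)" by (simp add: q_def)
    have "\<mu> r = (\<Sum>t\<in>reduced. e t * \<mu> (mon t))"
      unfolding r_eq \<mu>(1) \<mu>_sum \<mu>(2) using ker e by (simp add: q_def)
    also have "\<dots> = (\<Sum>t\<in>reduced. form (const (e t) * (z * mon t)))"
      unfolding form_scale using mon by (intro sum.cong) simp_all
    also have "\<dots> = form (z * (\<Sum>t\<in>reduced. const (e t) * mon t))"
      unfolding form_sum[symmetric] sum_distrib_left by (simp only: mult.left_commute)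
    also have "\<dots> = form (z * r)"
      unfolding r_eq distrib_left form_add
      using form_I[OF R.idlD(4)[OF F_ideal_idl _ zR]] e by (simp add: q_def)
    finally show ?thesis .
  qed
  then show ?thesis using zR by blast
qed

lemma idl_subspace:
  "R.idl J \<Longrightarrow> 0 \<in> J" "R.idl J \<Longrightarrow> x \<in> J \<Longrightarrow> y \<in> J \<Longrightarrow> x + y \<in> J" "R.idl J \<Longrightarrow> x \<in> J \<Longrightarrow> const c * x \<in> J"
  using R.idlD const_R by blast+

lemma form_nondegenerate:
  assumes p: "p \<in> R" and "\<And>r. r \<in> R \<Longrightarrow> form (p * r) = 0"
  shows "p \<in> I"
proof (rule ccontr)
  assume "p \<notin> I"
  then obtain \<mu> where \<mu>: "\<forall>x y. \<mu> (x + y) = \<mu> x + \<mu> y" "\<forall>c x. \<mu> (const c * x) = c * (\<mu> x :: 'k)"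
    "\<forall>x\<in>I. \<mu> x = 0" "\<mu> p \<noteq> 0"
    using separating_functional[of I p] idl_subspace[OF F_ideal_idl] by blast
  obtain z where "z \<in> R" "\<forall>r\<in>R. \<mu> r = form (z * r)" using functional_represented[of \<mu>] \<mu>(1-3) by blast
  then show False using assms \<mu>(4) by (metis mult.commute)
qed

text \<open>A nonzero functional that kills P is represented by some u, and P annihilates u modulo I. Suppose
  that P annihilates v as well, but v does not lie in I + R u. A functional that kills I + R u but not
  v is represented by some w with w u in I but w v not in I. So w lies outside P and is invertible
  modulo P, which forces u into I.\<close>

theorem annihilator_principal:
  assumes P: "maximalideal P (ring_on R)" and IP: "I \<subseteq> P"
  shows "\<exists>u\<in>R. u \<notin> I \<and> (\<forall>p\<in>P. p * u \<in> I) \<and> (\<forall>v\<in>R. (\<forall>p\<in>P. p * v \<in> I) \<longrightarrow> (\<exists>r\<in>R. v - r * u \<in> I))"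
proof -
  note Pmax = R.maximalideal_ring_onD[OF P]
  note II = R.idlD[OF F_ideal_idl[of UNIV]] and PI = R.idlD[OF Pmax(1)]
  obtain \<mu> where \<mu>: "\<forall>x y. \<mu> (x + y) = \<mu> x + \<mu> y" "\<forall>c x. \<mu> (const c * x) = c * (\<mu> x :: 'k)"
    "\<forall>x\<in>P. \<mu> x = 0" "\<mu> 1 \<noteq> 0"
    using separating_functional[of P 1] idl_subspace[OF Pmax(1)] Pmax(2) by blast
  have "\<exists>z\<in>R. \<forall>r\<in>R. \<mu> r = form (z * r)"
    using \<mu>(1-3) IP by (intro functional_represented) auto
  then obtain u where u: "u \<in> R" "\<forall>r\<in>R. \<mu> r = form (u * r)" by blast
  have uI: "u \<notin> I" using u(2) \<mu>(4) form_I[of u] R.one_mem by auto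
  have Pu: "p * u \<in> I" if p: "p \<in> P" for p
  proof (rule form_nondegenerate)
    show "p * u \<in> R" using p u(1) PI(8) by blast
    fix r assume r: "r \<in> R"
    have "form (p * u * r) = \<mu> (p * r)" using u(2) p r PI(8) by (simp add: R.mult_mem ac_simps)
    then show "form (p * u * r) = 0" using \<mu>(3) PI(5)[OF p r] by simp
  qed
  have "\<exists>r\<in>R. v - r * u \<in> I" if v: "v \<in> R" "\<forall>p\<in>P. p * v \<in> I" for v
  proof (rule ccontr)
    assume neg: "\<not> (\<exists>r\<in>R. v - r * u \<in> I)"
    define J where "J = {r * u + x | r x. r \<in> R \<and> x \<in> I}"
    have J: "R.idl J"
      unfolding R.idl_def
    proof (intro conjI ballI)
      show "J \<subseteq> R" using u(1) II(1) by (auto simp: J_def)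
      show "0 \<in> J" unfolding J_def using II(2) R.zero_mem by force
      fix x assume "x \<in> J"
      then obtain r x' where x: "x = r * u + x'" "r \<in> R" "x' \<in> I" unfolding J_def by blast
      { fix y assume "y \<in> J"
        then obtain s y' where y: "y = s * u + y'" "s \<in> R" "y' \<in> I" unfolding J_def by blast
        have "x + y = (r + s) * u + (x' + y')" using x y by (simp add: algebra_simps)
        then show "x + y \<in> J" unfolding J_def using x y II(3) R.add_mem by blast }
      { fix s assume s: "s \<in> R"
        have "s * x = (s * r) * u + s * x'" using x by (simp add: algebra_simps)
        then show "s * x \<in> J" unfolding J_def using x s II(4) R.mult_mem by blast }
    qed
    have "v \<notin> J"
    proof
      assume "v \<in> J"
      then obtain r x where "v = r * u + x" "r \<in> R" "x \<in> I" unfolding J_def by blast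
      then show False using neg by (metis add_diff_cancel_left')
    qed
    then obtain \<nu> where \<nu>: "\<forall>x y. \<nu> (x + y) = \<nu> x + \<nu> y" "\<forall>c x. \<nu> (const c * x) = c * (\<nu> x :: 'k)"
      "\<forall>x\<in>J. \<nu> x = 0" "\<nu> v \<noteq> 0"
      using separating_functional[of J v] idl_subspace[OF J] by blast
    have IJ: "x \<in> J" if "x \<in> I" for x unfolding J_def using that R.zero_mem by force
    have uJ: "r * u \<in> J" if "r \<in> R" for r unfolding J_def using that II(2) by force
    have "\<exists>z\<in>R. \<forall>r\<in>R. \<nu> r = form (z * r)"
      using \<nu>(1-3) IJ by (intro functional_represented) auto
    then obtain w where w: "w \<in> R" "\<forall>r\<in>R. \<nu> r = form (w * r)" by blast
    have wu: "w * u \<in> I"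
    proof (rule form_nondegenerate)
      show "w * u \<in> R" using w(1) u(1) by blast
      fix r assume r: "r \<in> R"
      have "form (w * u * r) = \<nu> (r * u)" using w(2) r u(1) by (simp add: R.mult_mem ac_simps)
      then show "form (w * u * r) = 0" using \<nu>(3) uJ[OF r] by simp
    qed
    have "w \<notin> P"
    proof
      assume "w \<in> P"
      then have "form (w * v) = 0" using v(2) form_I by blast
      then show False using w(2) v(1) \<nu>(4) by simp
    qed
    then obtain t where t: "t \<in> R" "w * t - 1 \<in> P" using Pmax(3)[OF w(1)] by blast
    have "u = t * (w * u) - (w * t - 1) * u" by (simp add: algebra_simps)
    also have "\<dots> \<in> I" by (intro II(7) II(4)[OF wu t(1)] Pu t(2))
    finally show False using uI by simp
  qed
  then show ?thesis using u(1) uI Pu by blast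
qed

end

section \<open>A greatest Apery element makes the ring Gorenstein\<close>

context greatest_apery
begin

text \<open>The ray polynomials are a regular sequence of length d, which is maximal because the dimension is at
  most d. The maximal ideal of the localized quotient is the image of P, so that the socle consists of
  the classes annihilated by P; up to a denominator these are the multiples of the
  generator of the annihilator of P in R/I.\<close>

lemma gorenstein_local_at:
  assumes P: "maximalideal P (ring_on R)" and F_P: "\<And>i. F i \<in> P"
    and noetherian: "noetherian_ring (ring_on R)"
    and CM: "cohen_macaulay_local (localize_at (ring_on R) P)"
  shows "gorenstein_local (localize_at (ring_on R) P)"
proof -
  interpret loc: localized_subdomain R P by (rule localized_maximal[OF P])
  let ?A = loc.A and ?fr = loc.frac
  have A_eq: "localize_at (ring_on R) P = ?A" by (simp add: loc.A_def)
  interpret A: cring ?A by (rule loc.cring_A)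
  note II = R.idlD[OF F_ideal_idl[of UNIV]] and PI = R.idlD[OF loc.P_idl]
  have IP: "I \<subseteq> P"
  proof
    fix x assume "x \<in> I"
    then obtain b where "x = (\<Sum>k\<in>UNIV. F k * b k)" "\<forall>k. b k \<in> R" unfolding F_ideal_def by blast
    then show "x \<in> P" using F_P by (auto intro!: R.idl_sum[OF loc.P_idl] PI(5))
  qed
  have Idl_F: "Idl\<^bsub>?A\<^esub> ((\<lambda>i. ?fr (F i) 1) ` K) = loc.extend (F_ideal K)" for K
  proof
    let ?X = "(\<lambda>i. ?fr (F i) 1) ` K"
    have X: "?X \<subseteq> carrier ?A" by auto
    have J: "ideal (Idl\<^bsub>?A\<^esub> ?X) ?A" by (rule A.genideal_ideal[OF X])
    have "F k \<in> F_ideal K" if "k \<in> K" for k using F_mem_ideal[OF that _ R.one_mem] by simp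
    then have "?X \<subseteq> loc.extend (F_ideal K)" by (auto simp: loc.extend_def)
    then show "Idl\<^bsub>?A\<^esub> ?X \<subseteq> loc.extend (F_ideal K)"
      by (rule A.genideal_minimal[OF loc.extend_ideal[OF F_ideal_idl]])
    note cI = R.idlD[OF loc.contract_idl[OF J]]
    have Fc: "F k \<in> loc.contract (Idl\<^bsub>?A\<^esub> ?X)" if "k \<in> K" for k
      using that A.genideal_self[OF X] by (auto simp: loc.contract_def)
    have sub: "F_ideal K \<subseteq> loc.contract (Idl\<^bsub>?A\<^esub> ?X)"
    proof
      fix x assume "x \<in> F_ideal K"
      then obtain b where "x = (\<Sum>k\<in>K. F k * b k)" "\<forall>k. b k \<in> R" unfolding F_ideal_def by blast
      then show "x \<in> loc.contract (Idl\<^bsub>?A\<^esub> ?X)"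
        using Fc by (auto intro!: R.idl_sum[OF loc.contract_idl[OF J]] cI(5))
    qed
    show "loc.extend (F_ideal K) \<subseteq> Idl\<^bsub>?A\<^esub> ?X"
    proof
      fix x assume "x \<in> loc.extend (F_ideal K)"
      then obtain b s where x: "x = ?fr b s" "b \<in> F_ideal K" "s \<in> loc.T" unfolding loc.extend_def by blast
      have "b \<in> R" using x(2) R.idlD(8)[OF F_ideal_idl] by blast
      then show "x \<in> Idl\<^bsub>?A\<^esub> ?X" using loc.frac_mem_ideal_iff[OF J _ x(3)] sub x(1,2) by blast
    qed
  qed
  define Q where "Q = loc.extend I"
  interpret Q: ideal Q ?A unfolding Q_def by (rule loc.extend_ideal[OF F_ideal_idl])
  define K where "K = loc.contract Q"
  have K_idl: "R.idl K" unfolding K_def by (rule loc.contract_idl[OF Q.ideal_axioms])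
  note KI = R.idlD[OF K_idl]
  have K_iff: "x \<in> K \<longleftrightarrow> (\<exists>s\<in>loc.T. s * x \<in> I)" if "x \<in> R" for x
    unfolding K_def Q_def by (rule loc.contract_extend_iff[OF F_ideal_idl that])
  have frac_Q: "?fr x s \<in> Q \<longleftrightarrow> x \<in> K" if "x \<in> R" "s \<in> loc.T" for x s
    unfolding K_def by (rule loc.frac_mem_ideal_iff[OF Q.ideal_axioms that])
  have KP: "x \<in> P" if x: "x \<in> K" for x
  proof -
    obtain s where s: "s \<in> loc.T" "s * x \<in> I" using K_iff x KI(8) by blast
    have "s \<in> P \<or> x \<in> P"
      using loc.P_prime[OF loc.T_mem(1)[OF s(1)] KI(8)[OF x] subsetD[OF IP s(2)]] .
    then show ?thesis using loc.T_mem(2)[OF s(1)] by blast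
  qed

  obtain ds :: "'d list" where ds: "set ds = UNIV" "distinct ds"
    using finite_distinct_list[of "UNIV :: 'd set"] by auto
  have len: "length ds = CARD('d)" using distinct_card[OF ds(2)] ds(1) by simp
  define xs where "xs = map (\<lambda>i. ?fr (F i) 1) ds"
  have len_xs: "length xs = CARD('d)" by (simp add: xs_def len)
  have Idl_take: "Idl\<^bsub>?A\<^esub> (set (take l xs)) = loc.extend (F_ideal (set (take l ds)))" for l
    unfolding xs_def take_map set_map by (rule Idl_F)
  have Idl_xs: "Idl\<^bsub>?A\<^esub> (set xs) = Q"
    unfolding xs_def set_map Idl_F ds(1) Q_def ..
  have Q_proper: "Q \<noteq> carrier ?A"
  proof
    assume "Q = carrier ?A"
    then have "?fr 1 1 \<in> Q" by auto
    then have "1 \<in> P" using frac_Q[OF R.one_mem loc.T_one] KP by blast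
    then show False using loc.P_one by simp
  qed
  have regular: "regular_sequence ?A xs"
    unfolding regular_sequence_def
  proof (intro conjI allI impI ballI)
    show "set xs \<subseteq> carrier ?A" by (auto simp: xs_def)
    show "Idl\<^bsub>?A\<^esub> (set xs) \<noteq> carrier ?A" using Idl_xs Q_proper by simp
    fix l x assume l: "l < length xs" and x: "x \<in> carrier ?A"
      and mem: "xs ! l \<otimes>\<^bsub>?A\<^esub> x \<in> Idl\<^bsub>?A\<^esub> (set (take l xs))"
    let ?J = "F_ideal (set (take l ds))"
    note J = loc.extend_ideal[OF F_ideal_idl[of "set (take l ds)"]]
    obtain b s where b: "x = ?fr b s" "b \<in> R" "s \<in> loc.T" using x by (rule loc.carrier_A_cases)
    have notin: "ds ! l \<notin> set (take l ds)"
      using l ds(2) len_xs len id_take_nth_drop[of l ds] by (metis (no_types) distinct_take not_distinct_conv_prefix take_Suc_conv_app_nth distinct_append disjoint_iff list.set_intros(1))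
    have "xs ! l \<otimes>\<^bsub>?A\<^esub> x = ?fr (F (ds ! l) * b) s"
      using l b len_xs len by (simp add: xs_def loc.mult_frac)
    then have "F (ds ! l) * b \<in> loc.contract (loc.extend ?J)"
      using mem Idl_take loc.frac_mem_ideal_iff[OF J R.mult_mem[OF F_R b(2)] b(3)] by simp
    then obtain t where t: "t \<in> loc.T" "t * (F (ds ! l) * b) \<in> ?J"
      using loc.contract_extend_iff[OF F_ideal_idl R.mult_mem[OF F_R b(2)]] by blast
    have "F (ds ! l) * (t * b) \<in> ?J" using t(2) by (simp add: mult.left_commute)
    then have "t * b \<in> ?J" using F_regular[OF notin] b(2) loc.T_mem(1)[OF t(1)] by blast
    then have "b \<in> loc.contract (loc.extend ?J)" using loc.contract_extend_iff[OF F_ideal_idl b(2)] t(1) by blast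
    then show "x \<in> Idl\<^bsub>?A\<^esub> (set (take l xs))"
      using Idl_take loc.frac_mem_ideal_iff[OF J b(2,3)] b(1) by simp
  qed
  have depth: "enat (length xs) = local_depth ?A"
  proof (rule antisym)
    show "enat (length xs) \<le> local_depth ?A"
      unfolding local_depth_def using regular by (intro Sup_upper) blast
    have "local_depth ?A = krull_dim ?A" using CM unfolding A_eq cohen_macaulay_local_def by simp
    also have "\<dots> \<le> enat CARD('d)" by (rule krull_dim_localization_le[OF localized_maximal[OF P]])
    finally show "local_depth ?A \<le> enat (length xs)" by (simp add: len_xs)
  qed

  let ?B = "?A Quot Q"
  define \<pi> where "\<pi> = a_r_coset ?A Q"
  interpret B: cring ?B by (rule Q.quotient_is_cring[OF loc.cring_A])
  interpret \<pi>: ring_hom_ring ?A ?B \<pi> unfolding \<pi>_def by (rule Q.rcos_ring_hom_ring)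
  have B_carrier: "carrier ?B = \<pi> ` carrier ?A"
    by (auto simp: FactRing_def A_RCOSETS_def' \<pi>_def)
  have B_cases: "\<exists>b s. \<beta> = \<pi> (?fr b s) \<and> b \<in> R \<and> s \<in> loc.T" if "\<beta> \<in> carrier ?B" for \<beta>
    using that unfolding B_carrier loc.carrier_A by blast
  have \<pi>_zero: "\<pi> x = \<zero>\<^bsub>?B\<^esub> \<longleftrightarrow> x \<in> Q" if "x \<in> carrier ?A" for x
  proof
    have zero: "\<zero>\<^bsub>?B\<^esub> = Q" by (simp add: FactRing_def)
    show "x \<in> Q" if "\<pi> x = \<zero>\<^bsub>?B\<^esub>"
      using Q.a_rcos_self[OF \<open>x \<in> carrier ?A\<close>] that zero by (simp add: \<pi>_def)
    show "\<pi> x = \<zero>\<^bsub>?B\<^esub>" if "x \<in> Q" using Q.a_rcos_const[OF that] zero by (simp add: \<pi>_def)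
  qed
  have \<pi>_frac_zero: "\<pi> (?fr b s) = \<zero>\<^bsub>?B\<^esub> \<longleftrightarrow> b \<in> K" if "b \<in> R" "s \<in> loc.T" for b s
    using \<pi>_zero frac_Q that by auto
  have \<pi>_carrier: "\<pi> (?fr b s) \<in> carrier ?B" if "b \<in> R" "s \<in> loc.T" for b s
    by (rule \<pi>.hom_closed[OF loc.frac_carrier[OF that]])
  have unit: "M = carrier ?B" if M: "ideal M ?B" and b: "\<pi> (?fr b s) \<in> M" "b \<in> loc.T" "s \<in> loc.T" for M b s
  proof -
    have bs: "b \<in> R" "s \<in> R" using b loc.T_mem(1) by auto
    have "\<pi> (?fr s b) \<otimes>\<^bsub>?B\<^esub> \<pi> (?fr b s) \<in> M"
      using bs b by (intro ideal.I_l_closed[OF M b(1)] \<pi>.hom_closed loc.frac_carrier)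
    moreover have "\<pi> (?fr s b) \<otimes>\<^bsub>?B\<^esub> \<pi> (?fr b s) = \<pi> (?fr s b \<otimes>\<^bsub>?A\<^esub> ?fr b s)"
      using bs b by (intro \<pi>.hom_mult[symmetric]) auto
    moreover have "?fr s b \<otimes>\<^bsub>?A\<^esub> ?fr b s = \<one>\<^bsub>?A\<^esub>"
      using bs b by (simp add: loc.mult_frac loc.one_A loc.frac_eq_iff R.mult_mem loc.T_mult mult.commute)
    ultimately have "\<one>\<^bsub>?B\<^esub> \<in> M" by simp
    then show ?thesis by (rule ideal.one_imp_carrier[OF M])
  qed
  define MB where "MB = \<pi> ` loc.extend P"
  have P_MB: "\<pi> (?fr p s) \<in> MB" if "p \<in> P" "s \<in> loc.T" for p s
    unfolding MB_def loc.extend_def using that by blast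
  have MB_ideal: "ideal MB ?B"
    unfolding MB_def \<pi>_def
    by (rule A.ring_ideal_imp_quot_ideal[OF Q.ideal_axioms loc.extend_ideal[OF loc.P_idl]])
  have MB_max: "maximalideal MB ?B"
  proof (rule maximalidealI[OF MB_ideal])
    show "carrier ?B \<noteq> MB"
    proof
      assume "carrier ?B = MB"
      then have "\<pi> (?fr 1 1) \<in> MB"
        using \<pi>.hom_closed[OF loc.frac_carrier[OF R.one_mem loc.T_one]] by metis
      then obtain p s where p: "\<pi> (?fr 1 1) = \<pi> (?fr p s)" "p \<in> P" "s \<in> loc.T"
        unfolding MB_def loc.extend_def by blast
      have pR: "p \<in> R" "s \<in> R" using p PI(8) loc.T_mem(1) by auto
      have eq: "?fr 1 1 = ?fr (s - p) s \<oplus>\<^bsub>?A\<^esub> ?fr p s"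
        using p(3) pR by (simp add: loc.add_frac R.diff_mem loc.frac_eq_iff R.add_mem R.mult_mem loc.T_mult algebra_simps)
      have "\<pi> (?fr 1 1) = \<pi> (?fr (s - p) s) \<oplus>\<^bsub>?B\<^esub> \<pi> (?fr p s)"
        unfolding eq using p(3) pR by (intro \<pi>.hom_add) auto
      then have "\<pi> (?fr (s - p) s) \<oplus>\<^bsub>?B\<^esub> \<pi> (?fr p s) = \<pi> (?fr p s)" using p(1) by simp
      then have "\<pi> (?fr (s - p) s) = \<zero>\<^bsub>?B\<^esub>"
        using p(3) pR by (metis B.add.l_cancel_one' B.add.r_cancel_one' \<pi>.hom_closed loc.frac_carrier R.diff_mem)
      then have "s - p \<in> K" using \<pi>_frac_zero[OF R.diff_mem[OF pR(2,1)] p(3)] by simp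
      then have "s - p \<in> P" by (rule KP)
      then have "(s - p) + p \<in> P" by (rule PI(3)) (rule p(2))
      then show False using p(3) loc.T_mem(2) by simp
    qed
    fix J assume J: "ideal J ?B" "MB \<subseteq> J" "J \<subseteq> carrier ?B"
    show "J = MB \<or> J = carrier ?B"
    proof (cases "J \<subseteq> MB")
      case False
      then obtain \<beta> where \<beta>: "\<beta> \<in> J" "\<beta> \<notin> MB" by blast
      then obtain b s where b: "\<beta> = \<pi> (?fr b s)" "b \<in> R" "s \<in> loc.T" using B_cases J(3) by blast
      then have "b \<in> loc.T" using \<beta>(2) P_MB loc.T_mem(3) by blast
      then show ?thesis using unit[OF J(1)] \<beta>(1) b by blast
    qed (use J(2) in blast)
  qed
  have socle_iff: "\<pi> (?fr b s) \<in> local_socle ?B \<longleftrightarrow> (\<forall>p\<in>P. p * b \<in> K)" if b: "b \<in> R" "s \<in> loc.T" for b s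
  proof
    assume soc: "\<pi> (?fr b s) \<in> local_socle ?B"
    show "\<forall>p\<in>P. p * b \<in> K"
    proof
      fix p assume p: "p \<in> P"
      then have pR: "p \<in> R" using PI(8) by blast
      have "\<pi> (?fr p 1) \<otimes>\<^bsub>?B\<^esub> \<pi> (?fr b s) = \<zero>\<^bsub>?B\<^esub>"
        using soc MB_max P_MB[OF p loc.T_one] unfolding local_socle_def by blast
      moreover have "\<pi> (?fr p 1) \<otimes>\<^bsub>?B\<^esub> \<pi> (?fr b s) = \<pi> (?fr (p * b) s)"
        using b pR by (subst \<pi>.hom_mult[symmetric]) (auto simp: loc.mult_frac)
      ultimately show "p * b \<in> K" using \<pi>_frac_zero[OF R.mult_mem[OF pR b(1)] b(2)] by simp
    qed
  next
    assume ann: "\<forall>p\<in>P. p * b \<in> K"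
    have "m' \<otimes>\<^bsub>?B\<^esub> \<pi> (?fr b s) = \<zero>\<^bsub>?B\<^esub>" if M: "maximalideal M ?B" and m': "m' \<in> M" for M m'
    proof -
      have ideal: "ideal M ?B" using M by (rule maximalideal.axioms(1))
      then have "m' \<in> carrier ?B" using m' by (rule ideal.Icarr)
      then obtain q t where q: "m' = \<pi> (?fr q t)" "q \<in> R" "t \<in> loc.T" using B_cases by blast
      have "q \<notin> loc.T" using unit[OF ideal] m' q maximalideal.I_notcarr[OF M] by blast
      then have "q \<in> P" using q(2) loc.T_mem(3) by blast
      then have "q * b \<in> K" using ann by blast
      moreover have "m' \<otimes>\<^bsub>?B\<^esub> \<pi> (?fr b s) = \<pi> (?fr (q * b) (t * s))"
        unfolding q(1) using b q by (subst \<pi>.hom_mult[symmetric]) (auto simp: loc.mult_frac)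
      ultimately show ?thesis using iffD2[OF \<pi>_frac_zero[OF R.mult_mem[OF q(2) b(1)] loc.T_mult[OF q(3) b(2)]]] by simp
    qed
    then show "\<pi> (?fr b s) \<in> local_socle ?B" using \<pi>_carrier[OF b] unfolding local_socle_def by blast
  qed

  obtain u where uR: "u \<in> R" and "u \<notin> I \<and> (\<forall>p\<in>P. p * u \<in> I) \<and>
      (\<forall>v\<in>R. (\<forall>p\<in>P. p * v \<in> I) \<longrightarrow> (\<exists>r\<in>R. v - r * u \<in> I))"
    using annihilator_principal[OF P IP] by (elim bexE)
  then have u: "u \<in> R" "u \<notin> I" "\<And>p. p \<in> P \<Longrightarrow> p * u \<in> I"
    "\<And>v. v \<in> R \<Longrightarrow> \<forall>p\<in>P. p * v \<in> I \<Longrightarrow> \<exists>r\<in>R. v - r * u \<in> I"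
    by simp_all
  have uK: "u \<notin> K"
  proof
    assume "u \<in> K"
    then obtain t where t: "t \<in> loc.T" "t * u \<in> I" using K_iff u(1) by blast
    obtain r where r: "r \<in> R" "t * r - 1 \<in> P"
      using R.maximalideal_ring_onD(3)[OF P, of t] t(1) loc.T_mem by blast
    have "u = r * (t * u) - (t * r - 1) * u" by (simp add: algebra_simps)
    also have "\<dots> \<in> I" by (intro II(7) II(4)[OF t(2) r(1)] u(3) r(2))
    finally show False using u(2) by simp
  qed
  have IK: "x \<in> K" if "x \<in> I" for x
    using K_iff[OF II(8)[OF that]] that by (intro iffD2[OF K_iff[OF II(8)[OF that]]] bexI[of _ 1]) auto
  have uB: "\<pi> (?fr u 1) \<in> carrier ?B" by (rule \<pi>_carrier[OF u(1) loc.T_one])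

  (* P is finitely generated, so the denominators for its generators have a common multiple. *)
  have clear: "\<exists>s\<in>loc.T. \<forall>p\<in>P. p * (s * b) \<in> I" if b: "b \<in> R" "\<forall>p\<in>P. p * b \<in> K" for b
  proof -
    have "ideal P (ring_on R)" using P by (rule maximalideal.axioms(1))
    then obtain X where X: "X \<subseteq> carrier (ring_on R)" "finite X" "P = Idl\<^bsub>ring_on R\<^esub> X"
      using noetherian_ring.finetely_gen[OF noetherian] by blast
    interpret RR: cring "ring_on R" by (rule R.cring_ring_on)
    have XP: "X \<subseteq> P" using RR.genideal_self[OF X(1)] X(3) by simp
    have "\<forall>p\<in>X. \<exists>s\<in>loc.T. s * (p * b) \<in> I"
      using K_iff b XP PI(8) by (meson R.mult_mem subsetD)
    then obtain \<sigma> where \<sigma>: "\<And>p. p \<in> X \<Longrightarrow> \<sigma> p \<in> loc.T" "\<And>p. p \<in> X \<Longrightarrow> \<sigma> p * (p * b) \<in> I" by metis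
    define s where "s = prod \<sigma> X"
    have s: "s \<in> loc.T" unfolding s_def using \<sigma>(1) by blast
    have sR: "s \<in> R" using s loc.T_mem(1) by blast
    define Y where "Y = {p \<in> R. p * (s * b) \<in> I}"
    have "R.idl Y"
      unfolding R.idl_def
    proof (intro conjI ballI)
      show "Y \<subseteq> R" "0 \<in> Y" using II(2) by (auto simp: Y_def)
      show "x + y \<in> Y" if "x \<in> Y" "y \<in> Y" for x y
        using that II(3)[of "x * (s * b)" "y * (s * b)"] by (auto simp: Y_def distrib_right)
      show "r * x \<in> Y" if "x \<in> Y" "r \<in> R" for x r
        using that II(4)[of "x * (s * b)" r] by (auto simp: Y_def mult.assoc)
    qed
    then have "ideal Y (ring_on R)" by (simp add: R.ideal_ring_on_iff)
    moreover have "X \<subseteq> Y"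
    proof
      fix p assume p: "p \<in> X"
      have "s = \<sigma> p * prod \<sigma> (X - {p})" unfolding s_def using X(2) p by (rule prod.remove)
      then have "p * (s * b) = prod \<sigma> (X - {p}) * (\<sigma> p * (p * b))" by (simp add: ac_simps)
      moreover have "prod \<sigma> (X - {p}) \<in> R" using \<sigma>(1) loc.T_mem(1) by blast
      ultimately have "p * (s * b) \<in> I" using II(4)[OF \<sigma>(2)[OF p]] by simp
      then show "p \<in> Y" using X(1) p by (auto simp: Y_def)
    qed
    ultimately have "P \<subseteq> Y" unfolding X(3) by (rule RR.genideal_minimal)
    then show ?thesis using s by (auto simp: Y_def)
  qed
  have socle: "Idl\<^bsub>?B\<^esub> {\<pi> (?fr u 1)} = local_socle ?B"
  proof -
    have PIdl: "Idl\<^bsub>?B\<^esub> {\<pi> (?fr u 1)} = {\<beta> \<otimes>\<^bsub>?B\<^esub> \<pi> (?fr u 1) | \<beta>. \<beta> \<in> carrier ?B}"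
      using B.cgenideal_eq_genideal[OF uB] unfolding cgenideal_def by simp
    show ?thesis
    proof
      show "Idl\<^bsub>?B\<^esub> {\<pi> (?fr u 1)} \<subseteq> local_socle ?B"
      proof
        fix \<gamma> assume "\<gamma> \<in> Idl\<^bsub>?B\<^esub> {\<pi> (?fr u 1)}"
        then obtain \<beta> where \<beta>: "\<gamma> = \<beta> \<otimes>\<^bsub>?B\<^esub> \<pi> (?fr u 1)" "\<beta> \<in> carrier ?B" unfolding PIdl by blast
        then obtain r s where r: "\<beta> = \<pi> (?fr r s)" "r \<in> R" "s \<in> loc.T" using B_cases by blast
        have "\<gamma> = \<pi> (?fr (r * u) s)"
          unfolding \<beta>(1) r(1) using r u(1) by (subst \<pi>.hom_mult[symmetric]) (auto simp: loc.mult_frac)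
        moreover have "p * (r * u) \<in> K" if "p \<in> P" for p
          using IK[OF II(4)[OF u(3)[OF that] r(2)]] by (simp add: mult.left_commute)
        ultimately show "\<gamma> \<in> local_socle ?B" using socle_iff[OF R.mult_mem[OF r(2) u(1)] r(3)] by simp
      qed
      show "local_socle ?B \<subseteq> Idl\<^bsub>?B\<^esub> {\<pi> (?fr u 1)}"
      proof
        fix \<gamma> assume soc: "\<gamma> \<in> local_socle ?B"
        then have "\<gamma> \<in> carrier ?B" unfolding local_socle_def by blast
        then obtain b s where b: "\<gamma> = \<pi> (?fr b s)" "b \<in> R" "s \<in> loc.T" using B_cases by blast
        then have "\<forall>p\<in>P. p * b \<in> K" using socle_iff soc by blast
        then obtain t where t: "t \<in> loc.T" "\<forall>p\<in>P. p * (t * b) \<in> I" using clear[OF b(2)] by blast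
        have R: "t \<in> R" "s \<in> R" "t * s \<in> loc.T" using t b loc.T_mem(1) by auto
        obtain r where r: "r \<in> R" "t * b - r * u \<in> I" using u(4)[of "t * b"] t(2) R(1) b(2) by blast
        have fr: "?fr (t * b - r * u) (t * s) \<in> carrier ?A" "?fr r (t * s) \<in> carrier ?A" "?fr u 1 \<in> carrier ?A"
          using R r(1) u(1) II(8)[OF r(2)] by (auto intro: loc.frac_carrier)
        have eq: "?fr b s = ?fr (t * b - r * u) (t * s) \<oplus>\<^bsub>?A\<^esub> ?fr r (t * s) \<otimes>\<^bsub>?A\<^esub> ?fr u 1"
          using R r(1) b u(1) t(1)
          by (simp add: loc.mult_frac loc.add_frac R.diff_mem R.mult_mem R.add_mem loc.T_mult
              loc.frac_eq_iff algebra_simps)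
        have "\<gamma> = \<pi> (?fr (t * b - r * u) (t * s)) \<oplus>\<^bsub>?B\<^esub> \<pi> (?fr r (t * s)) \<otimes>\<^bsub>?B\<^esub> \<pi> (?fr u 1)"
          unfolding b(1) eq
          by (simp only: \<pi>.hom_add[OF fr(1) A.m_closed[OF fr(2,3)]] \<pi>.hom_mult[OF fr(2,3)])
        also have "\<pi> (?fr (t * b - r * u) (t * s)) = \<zero>\<^bsub>?B\<^esub>"
          using iffD2[OF \<pi>_frac_zero[OF II(8)[OF r(2)] R(3)] IK[OF r(2)]] .
        finally have "\<gamma> = \<pi> (?fr r (t * s)) \<otimes>\<^bsub>?B\<^esub> \<pi> (?fr u 1)"
          using \<pi>_carrier[OF r(1) R(3)] uB by simp
        then show "\<gamma> \<in> Idl\<^bsub>?B\<^esub> {\<pi> (?fr u 1)}" unfolding PIdl using \<pi>_carrier[OF r(1) R(3)] by blast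
      qed
    qed
  qed
  have "socle_has_dim ?B 1"
    unfolding socle_has_dim_def
  proof (intro conjI allI impI)
    show "\<exists>G. G \<subseteq> carrier ?B \<and> finite G \<and> card G = 1 \<and> Idl\<^bsub>?B\<^esub> G = local_socle ?B"
      using socle uB by (intro exI[of _ "{\<pi> (?fr u 1)}"]) simp
    fix H assume H: "H \<subseteq> carrier ?B \<and> finite H \<and> Idl\<^bsub>?B\<^esub> H = local_socle ?B"
    have "H \<noteq> {}"
    proof
      assume "H = {}"
      then have "Idl\<^bsub>?B\<^esub> H \<subseteq> {\<zero>\<^bsub>?B\<^esub>}" by (intro B.genideal_minimal[OF B.zeroideal]) simp
      moreover have "\<pi> (?fr u 1) \<in> local_socle ?B" using B.genideal_self'[OF uB] socle by simp
      ultimately have "\<pi> (?fr u 1) = \<zero>\<^bsub>?B\<^esub>" using H by auto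
      then show False using \<pi>_frac_zero[OF u(1) loc.T_one] uK by simp
    qed
    then show "1 \<le> card H" using H by (simp add: Suc_le_eq card_gt_0_iff)
  qed
  then have "has_cohen_macaulay_type ?A 1"
    unfolding has_cohen_macaulay_type_def using regular depth Idl_xs by (intro exI[of _ xs]) simp
  then show ?thesis using CM unfolding gorenstein_local_def A_eq by simp
qed

end

context simplicial_semigroup
begin

text \<open>Every maximal ideal contains a monic polynomial in the monomial of each extremal ray; these polynomials
  serve as the regular sequence.\<close>

theorem gorenstein_if_greatest_apery:
  assumes CM: "cohen_macaulay (semigroup_ring TYPE('k::field) S)"
    and m: "m \<in> apery S a" "\<And>w. w \<in> apery S a \<Longrightarrow> m - w \<in> S"
  shows "gorenstein (semigroup_ring TYPE('k) S)"
  unfolding gorenstein_def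
proof (intro conjI allI impI)
  let ?R = "semigroup_algebra S :: ((int ^ 'd) \<Rightarrow>\<^sub>0 'k) set"
  show "cring (semigroup_ring TYPE('k) S)" and noeth: "noetherian_ring (semigroup_ring TYPE('k) S)"
    using CM unfolding cohen_macaulay_def by simp_all
  fix P assume "maximalideal P (semigroup_ring TYPE('k) S)"
  then have P: "maximalideal P (ring_on ?R)" by (simp add: semigroup_ring_eq)
  define poly where "poly i D f \<longleftrightarrow> 0 < D \<and> f D = 1 \<and> (\<Sum>j\<le>D. single (int j *s a i) (f j)) \<in> P"
    for i and D :: nat and f :: "nat \<Rightarrow> 'k"
  have "\<exists>D f. poly i D f" for i unfolding poly_def by (rule maximal_ideal_ray_polynomial[OF P])
  then obtain D f where "\<And>i. poly i (D i) (f i)" by metis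
  then have Df: "\<And>i. 0 < D i" "\<And>i. f i (D i) = 1"
    "\<And>i. (\<Sum>j\<le>D i. single (int j *s a i) (f i j)) \<in> P" unfolding poly_def by simp_all
  interpret greatest_apery S G a D f m
    by unfold_locales (use Df m cohen_macaulay_fill_combination[OF CM] in auto)
  show "gorenstein_local (localize_at (semigroup_ring TYPE('k) S) P)"
    unfolding semigroup_ring_eq
  proof (rule gorenstein_local_at[OF P])
    show "F i \<in> P" for i unfolding F_def by (rule Df(3))
    show "noetherian_ring (ring_on ?R)" using noeth by (simp add: semigroup_ring_eq)
    show "cohen_macaulay_local (localize_at (ring_on ?R) P)"
      using CM P unfolding cohen_macaulay_def semigroup_ring_eq by blast
  qed
qed

section \<open>Nearly Gorenstein semigroups\<close>

lemma finite_apery: "finite (apery S a)"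
  using finite_reduced[of "\<lambda>_. 1"] by (simp add: apery_def)

lemma max_apery_above:
  assumes w: "w \<in> apery S a" shows "\<exists>m\<in>max_apery S a. m - w \<in> S"
proof -
  let ?U = "{x \<in> apery S a. x - w \<in> S}"
  have "finite (total_degree ` ?U)" "total_degree ` ?U \<noteq> {}" using finite_apery w by force+
  then have "Max (total_degree ` ?U) \<in> total_degree ` ?U" by (rule Max_in)
  then obtain m where m: "m \<in> apery S a" "m - w \<in> S" "total_degree m = Max (total_degree ` ?U)" by auto
  have "m' = m" if m': "m' \<in> apery S a" "m' - m \<in> S" for m'
  proof -
    have "m' - w \<in> S" using add_S[OF m'(2) m(2)] by simp
    then have "total_degree m' \<le> total_degree m"
      unfolding m(3) using m'(1) finite_apery by (intro Max_ge) auto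
    then show ?thesis using total_degree_pos[OF m'(2)] by (auto simp: total_degree_diff)
  qed
  then have "m \<in> max_apery S a" using m(1) by (auto simp: max_apery_def semigroup_le_def)
  then show ?thesis using m(2) by blast
qed

lemma finite_quasi_frobenius: "finite (quasi_frobenius S a)"
proof -
  have "quasi_frobenius S a = (\<lambda>m. m - (\<Sum>i\<in>UNIV. a i)) ` max_apery S a"
    by (auto simp: quasi_frobenius_def)
  then show ?thesis using finite_apery finite_subset[of "max_apery S a" "apery S a"] by (auto simp: max_apery_def)
qed

text \<open>A decomposition of an extremal generator into two nonzero elements cannot involve this generator, as S
  has no inverses; so the generator would be redundant.\<close>

lemma extremal_irreducible:
  assumes st: "s \<in> S" "t \<in> S" and sum: "a i = s + t"
  shows "s = 0 \<or> t = 0"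
proof -
  obtain c where c: "s = (\<Sum>g\<in>G. int (c g) *s g)" using st(1) S_eq unfolding generated_semigroup_def by blast
  obtain e where e: "t = (\<Sum>g\<in>G. int (e g) *s g)" using st(2) S_eq unfolding generated_semigroup_def by blast
  have cancel: "y = 0" if x: "x = (\<Sum>g\<in>G. int (k g) *s g)" "0 < k (a i)" and y: "y \<in> S" "a i = x + y" for x y k
  proof -
    have "(\<Sum>g\<in>G. int ((k(a i := k (a i) - 1)) g) *s g) + a i =
      (\<Sum>g\<in>G. int ((k(a i := k (a i) - 1)) g) *s g + (if g = a i then g else 0))"
      using finite_G a_G by (simp add: sum.distrib)
    also have "\<dots> = x" unfolding x(1)
    proof (rule sum.cong[OF refl])
      fix g
      show "int ((k(a i := k (a i) - 1)) g) *s g + (if g = a i then g else 0) = int (k g) *s g"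
        using x(2) by (auto simp: of_nat_diff Suc_leI vector_sub_rdistrib)
    qed
    finally have "x - a i = (\<Sum>g\<in>G. int ((k(a i := k (a i) - 1)) g) *s g)" by (simp add: algebra_simps)
    then have "x - a i \<in> S" using generated_S by simp
    moreover have "x - a i = - y" using y(2) by simp
    ultimately show "y = 0" using S_antisym[OF y(1)] by simp
  qed
  show ?thesis
  proof (cases "0 < c (a i) \<or> 0 < e (a i)")
    case True
    then show ?thesis
      using cancel[OF c _ st(2) sum] cancel[OF e _ st(1)] sum by (auto simp: add.commute)
  next
    case False
    let ?H = "G - {a i}"
    have split: "(\<Sum>g\<in>G. int (k g) *s g) = int (k (a i)) *s a i + (\<Sum>g\<in>?H. int (k g) *s g)" for k
      using finite_G a_G by (rule sum.remove)
    have ai: "a i = (\<Sum>g\<in>?H. int (c g + e g) *s g)"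
      using sum False unfolding c e split[of c] split[of e]
      by (simp add: vector_sadd_rdistrib sum.distrib)
    have "S \<subseteq> generated_semigroup ?H"
    proof
      fix x assume "x \<in> S"
      then obtain k where k: "x = (\<Sum>g\<in>G. int (k g) *s g)" using S_eq unfolding generated_semigroup_def by blast
      have "x = int (k (a i)) *s (\<Sum>g\<in>?H. int (c g + e g) *s g) + (\<Sum>g\<in>?H. int (k g) *s g)"
        unfolding k split[of k] using ai by metis
      also have "\<dots> = (\<Sum>g\<in>?H. int (k (a i) * (c g + e g) + k g) *s g)"
        by (simp add: vec_eq_iff sum_distrib_left sum.distrib algebra_simps)
      finally show "x \<in> generated_semigroup ?H" unfolding generated_semigroup_def
        by (intro CollectI exI[of _ "\<lambda>g. k (a i) * (c g + e g) + k g"]) simp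
    qed
    moreover have "generated_semigroup ?H \<subseteq> S"
    proof
      fix x assume "x \<in> generated_semigroup ?H"
      then obtain k where "x = (\<Sum>g\<in>?H. int (k g) *s g)" unfolding generated_semigroup_def by blast
      then show "x \<in> S" using G_S by auto
    qed
    moreover have "generated_semigroup ?H \<noteq> S" using a_G by (intro G_minimal) auto
    ultimately show ?thesis by blast
  qed
qed

text \<open>Every Apery element lies below a maximal one, so it suffices to dominate these.\<close>

lemma gorenstein_if_greatest_quasi_frobenius:
  assumes CM: "cohen_macaulay (semigroup_ring TYPE('k::field) S)"
    and f: "f \<in> quasi_frobenius S a" "\<And>g. g \<in> quasi_frobenius S a \<Longrightarrow> f - g \<in> S"
  shows "gorenstein (semigroup_ring TYPE('k) S)"
proof -
  obtain m where m: "m \<in> max_apery S a" "f = m - (\<Sum>i\<in>UNIV. a i)" using f(1) by (auto simp: quasi_frobenius_def)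
  have max: "m - m' \<in> S" if "m' \<in> max_apery S a" for m'
    using f(2)[of "m' - (\<Sum>i\<in>UNIV. a i)"] that m(2) by (auto simp: quasi_frobenius_def)
  show ?thesis
  proof (rule gorenstein_if_greatest_apery[OF CM])
    show "m \<in> apery S a" using m(1) by (simp add: max_apery_def)
    fix w assume "w \<in> apery S a"
    then obtain m' where "m' \<in> max_apery S a" "m' - w \<in> S" using max_apery_above by blast
    then show "m - w \<in> S" using add_S[OF max, of m' "m' - w"] by simp
  qed
qed

end

theorem corollary2p4:
  fixes S G :: "(int ^ 'd) set" and a :: "'d \<Rightarrow> int ^ 'd"
  assumes "simplicial_affine_semigroup S G a"
    and "nearly_gorenstein TYPE('k::field) S a"
    and "\<not> gorenstein (semigroup_ring TYPE('k) S)"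
  shows "CARD('d) \<le> semigroup_type S a"
proof -
  interpret simplicial_semigroup S G a using assms(1) by unfold_locales
  let ?QF = "quasi_frobenius S a"
  have CM: "cohen_macaulay (semigroup_ring TYPE('k) S)" and trace: "S - {0} \<subseteq> semigroup_trace S a"
    using assms(2) unfolding nearly_gorenstein_def by simp_all
  have not_greatest: "\<not> (\<forall>g\<in>?QF. f - g \<in> S)" if "f \<in> ?QF" for f
    using gorenstein_if_greatest_quasi_frobenius[OF CM that] assms(3) by blast
  have "\<exists>f\<in>?QF. \<forall>g\<in>?QF. a i + f - g \<in> S" for i
  proof -
    have "a i \<in> semigroup_trace S a" using trace a_nonzero[of i] by auto
    then obtain f s z where h: "a i = (- f + s) + z" "f \<in> ?QF" "s \<in> S" "z \<in> canonical_inverse S a"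
      unfolding semigroup_trace_def canonical_ideal_def by blast
    have z: "z - g \<in> S" if "g \<in> ?QF" for g
    proof -
      have "- g + 0 \<in> canonical_ideal S a" using that unfolding canonical_ideal_def by blast
      then have "z + (- g + 0) \<in> S" using h(4) unfolding canonical_inverse_def by blast
      then show ?thesis by simp
    qed
    have "a i = (z - f) + s" using h(1) by simp
    then have "z - f = 0 \<or> s = 0" by (rule extremal_irreducible[OF z[OF h(2)] h(3)])
    then show ?thesis
    proof
      assume "z - f = 0"
      then show ?thesis using z not_greatest[OF h(2)] by auto
    next
      assume "s = 0"
      then have "z = a i + f" using h(1) by simp
      then show ?thesis using z h(2) by auto
    qed
  qed
  then obtain \<phi> where \<phi>: "\<And>i. \<phi> i \<in> ?QF" "\<And>i g. g \<in> ?QF \<Longrightarrow> a i + \<phi> i - g \<in> S" by metis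
  have "inj \<phi>"
  proof (rule injI, rule ccontr)
    fix i j assume eq: "\<phi> i = \<phi> j" and ne: "i \<noteq> j"
    have "\<phi> i - g \<in> S" if g: "g \<in> ?QF" for g
    proof (rule cohen_macaulay_fill[OF CM, of _ 1 i 1 j])
      show "\<phi> i - g + int 1 *s a i \<in> S" using \<phi>(2)[OF g, of i] by (simp add: algebra_simps)
      show "\<phi> i - g + int 1 *s a j \<in> S" using \<phi>(2)[OF g, of j] eq by (simp add: algebra_simps)
    qed (rule ne)
    then show False using not_greatest[OF \<phi>(1)[of i]] by blast
  qed
  then have "CARD('d) \<le> card ?QF"
    using \<phi>(1) finite_quasi_frobenius by (intro card_inj_on_le[of \<phi> UNIV]) auto
  then show ?thesis by (simp add: semigroup_type_def)
qed

end
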